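(* Let $R$ be an Arf ring and let $I$ be an integrally closed ideal of $R$ that contains a non-zerodivisor on $R$. Let $(R_{(I,n)})_{n\ge 0}$ and $(I_n)_{n\ge 0}$ be the sequences of subrings of $\mathrm{Q}(R)$ and ideals $I_n$ of $R_{(I,n)}$ constructed recursively from $I$ by $R_{(I,0)}=R$, $I_0=I$, $R_{(I,n)}=\sqrt{I_{n-1}}:\sqrt{I_{n-1}}$ and $I_n=I_{n-1}:\sqrt{I_{n-1}}$ for $n>0$, where $\sqrt{I_{n-1}}$ is the radical in $R_{(I,n-1)}$. Then there exists $n\ge 0$ such that $R=R_{(I,0)}\subseteq R_{(I,1)}\subseteq\cdots\subseteq R_{(I,n)}\subseteq\overline{R}$ is a tower of Arf rings, $I_i$ is an integrally closed ideal of $R_{(I,i)}$ for each $0\le i\le n$, and $$I=\sqrt{I_0}\,\sqrt{I_1}\cdots\sqrt{I_n}.$$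
   Context: All rings are commutative. $\mathrm{Q}(R)$ is the total ring of fractions of $R$, $W(R)$ the set of non-zerodivisors on $R$, and $\overline{R}$ the integral closure of $R$ in $\mathrm{Q}(R)$. For an ideal $I$ of $R$, $\overline{I}$ is the integral closure of $I$ in $R$; $I$ is integrally closed if $\overline{I}=I$. For $R$-submodules $X,Y$ of $\mathrm{Q}(R)$, $X:Y=\{a\in \mathrm{Q}(R)\mid aY\subseteq X\}$. $\mathcal{X}_R$ denotes the set of integrally closed ideals of $R$ that contain a non-zerodivisor on $R$. Arf ring: a (Noetherian) Cohen-Macaulay semi-local ring $R$ of dimension one with $\dim R_M=1$ for every maximal ideal $M$, is called an Arf ring if (1) for every $I\in\mathcal{X}_R$ there is $a\in I$ with $I=\overline{aR}$ (that is, $I^{n+1}=aI^n$ for some $n\ge0$), and (2) if $x,y,z\in R$ with $x\in W(R)$ and $\frac{y}{x},\frac{z}{x}\in\overline{R}$, then $\frac{yz}{x}\in R$. All the rings $R_{(I,n)}$ lie between $R$ and $\mathrm{Q}(R)$, and colons are taken in $\mathrm{Q}(R)$. Since $I_{n-1}\subseteq\sqrt{I_{n-1}}$, $I_n$ is an ideal of $R_{(I,n)}$. The product of ideals of different rings $R_{(I,i)}$ means the set of finite sums of products of elements in $\mathrm{Q}(R)$. *)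

theory Defs
  imports "HOL-Algebra.Algebra" "HOL-Library.Extended_Nat"
begin

section \<open>Total rings of fractions and subrings\<close>

text \<open>Rings between \<open>R\<close> and \<open>Q(R)\<close> are represented by their carrier sets
  \<open>A \<subseteq> carrier Q\<close>, where \<open>Q\<close> is the total ring of fractions.\<close>

abbreviation sub_ring :: "('a, 'b) ring_scheme \<Rightarrow> 'a set \<Rightarrow> ('a, 'b) ring_scheme"
  where "sub_ring Q A \<equiv> Q\<lparr>carrier := A\<rparr>"

definition nonzerodivisors :: "('a, 'b) ring_scheme \<Rightarrow> 'a set"
  where "nonzerodivisors R =
    {x \<in> carrier R. \<forall>y \<in> carrier R. x \<otimes>\<^bsub>R\<^esub> y = \<zero>\<^bsub>R\<^esub> \<longrightarrow> y = \<zero>\<^bsub>R\<^esub>}"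

definition total_ring_of_fractions :: "('a, 'b) ring_scheme \<Rightarrow> 'a set \<Rightarrow> bool"
  where "total_ring_of_fractions Q A \<longleftrightarrow>
    cring Q \<and> subcring A Q \<and>
    nonzerodivisors (sub_ring Q A) \<subseteq> Units Q \<and>
    (\<forall>q \<in> carrier Q. \<exists>a \<in> A. \<exists>s \<in> nonzerodivisors (sub_ring Q A). q = a \<otimes>\<^bsub>Q\<^esub> inv\<^bsub>Q\<^esub> s)"

definition colon :: "('a, 'b) ring_scheme \<Rightarrow> 'a set \<Rightarrow> 'a set \<Rightarrow> 'a set"
  where "colon Q U V = {a \<in> carrier Q. \<forall>v \<in> V. a \<otimes>\<^bsub>Q\<^esub> v \<in> U}"

definition radical :: "('a, 'b) ring_scheme \<Rightarrow> 'a set \<Rightarrow> 'a set"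
  where "radical R J = {x \<in> carrier R. \<exists>n::nat. n \<ge> 1 \<and> x [^]\<^bsub>R\<^esub> n \<in> J}"


section \<open>Integral closure\<close>

text \<open>\<open>x\<close> satisfies an equation \<open>x^n + a 1 x^(n-1) + \<dots> + a n = 0\<close> with \<open>n \<ge> 1\<close>
  and \<open>a i \<in> F i\<close>.\<close>

definition integral_equation :: "('a, 'b) ring_scheme \<Rightarrow> (nat \<Rightarrow> 'a set) \<Rightarrow> 'a \<Rightarrow> bool"
  where "integral_equation R F x \<longleftrightarrow>
    (\<exists>(n::nat) a. n \<ge> 1 \<and> (\<forall>i \<in> {1..n}. a i \<in> F i) \<and>
      x [^]\<^bsub>R\<^esub> n \<oplus>\<^bsub>R\<^esub> (\<Oplus>\<^bsub>R\<^esub>i \<in> {1..n}. a i \<otimes>\<^bsub>R\<^esub> x [^]\<^bsub>R\<^esub> (n - i)) = \<zero>\<^bsub>R\<^esub>)"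

definition ring_closure :: "('a, 'b) ring_scheme \<Rightarrow> 'a set \<Rightarrow> 'a set"
  where "ring_closure Q A = {x \<in> carrier Q. integral_equation Q (\<lambda>_. A) x}"

text \<open>\<^const>\<open>ideals_set\<close> is the multiplicative structure on the ideals of \<open>R\<close>, so the power
  below is the usual ideal power \<open>J^i\<close> (with \<open>J^0 = R\<close>).\<close>

definition ideal_closure :: "('a, 'b) ring_scheme \<Rightarrow> 'a set \<Rightarrow> 'a set"
  where "ideal_closure R J =
    {x \<in> carrier R. integral_equation R (\<lambda>i. J [^]\<^bsub>ideals_set R\<^esub> i) x}"

definition integrally_closed_ideal :: "('a, 'b) ring_scheme \<Rightarrow> 'a set \<Rightarrow> bool"
  where "integrally_closed_ideal R J \<longleftrightarrow> ideal J R \<and> ideal_closure R J = J"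

definition regular_closed_ideals :: "('a, 'b) ring_scheme \<Rightarrow> 'a set set"
  where "regular_closed_ideals R =
    {J. integrally_closed_ideal R J \<and> J \<inter> nonzerodivisors R \<noteq> {}}"


section \<open>Localization, dimension and depth\<close>

definition loc_rel :: "('a, 'b) ring_scheme \<Rightarrow> 'a set \<Rightarrow> (('a \<times> 'a) \<times> ('a \<times> 'a)) set"
  where "loc_rel R S =
    {((a, s), (b, t)). a \<in> carrier R \<and> b \<in> carrier R \<and> s \<in> S \<and> t \<in> S \<and>
      (\<exists>u \<in> S. u \<otimes>\<^bsub>R\<^esub> (a \<otimes>\<^bsub>R\<^esub> t \<ominus>\<^bsub>R\<^esub> b \<otimes>\<^bsub>R\<^esub> s) = \<zero>\<^bsub>R\<^esub>)}"

definition localization :: "('a, 'b) ring_scheme \<Rightarrow> 'a set \<Rightarrow> ('a \<times> 'a) set ring"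
  where "localization R S =
    \<lparr>carrier = (carrier R \<times> S) // loc_rel R S,
     monoid.mult = (\<lambda>U V. \<Union>(a, s) \<in> U. \<Union>(b, t) \<in> V. loc_rel R S `` {(a \<otimes>\<^bsub>R\<^esub> b, s \<otimes>\<^bsub>R\<^esub> t)}),
     monoid.one = loc_rel R S `` {(\<one>\<^bsub>R\<^esub>, \<one>\<^bsub>R\<^esub>)},
     ring.zero = loc_rel R S `` {(\<zero>\<^bsub>R\<^esub>, \<one>\<^bsub>R\<^esub>)},
     ring.add = (\<lambda>U V. \<Union>(a, s) \<in> U. \<Union>(b, t) \<in> V.
       loc_rel R S `` {(a \<otimes>\<^bsub>R\<^esub> t \<oplus>\<^bsub>R\<^esub> b \<otimes>\<^bsub>R\<^esub> s, s \<otimes>\<^bsub>R\<^esub> t)})\<rparr>"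

abbreviation local_ring_at :: "('a, 'b) ring_scheme \<Rightarrow> 'a set \<Rightarrow> ('a \<times> 'a) set ring"
  where "local_ring_at R P \<equiv> localization R (carrier R - P)"

text \<open>Supremum of the lengths \<open>n\<close> of chains \<open>P 0 \<subset> \<dots> \<subset> P n\<close> of prime ideals
  (with value \<open>0\<close> for the zero ring, which is never relevant below).\<close>

definition krull_dim :: "('a, 'b) ring_scheme \<Rightarrow> enat"
  where "krull_dim R =
    Sup {enat n | n. \<exists>P. (\<forall>i \<le> n. primeideal (P i) R) \<and> (\<forall>i < n. P i \<subset> P (Suc i))}"

definition regular_sequence :: "('a, 'b) ring_scheme \<Rightarrow> 'a list \<Rightarrow> bool"
  where "regular_sequence R xs \<longleftrightarrow>
    set xs \<subseteq> carrier R \<and> genideal R (set xs) \<noteq> carrier R \<and>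
    (\<forall>i < length xs. \<forall>r \<in> carrier R.
      xs ! i \<otimes>\<^bsub>R\<^esub> r \<in> genideal R (set (take i xs)) \<longrightarrow> r \<in> genideal R (set (take i xs)))"

definition depth :: "('a, 'b) ring_scheme \<Rightarrow> 'a set \<Rightarrow> enat"
  where "depth R J = Sup {enat (length xs) | xs. regular_sequence R xs \<and> set xs \<subseteq> J}"

text \<open>The definition of Eisenbud (Commutative Algebra, 18.2): \<open>depth M = codim M\<close> for every
  maximal ideal \<open>M\<close> of the Noetherian ring \<open>R\<close>, where \<open>codim M = dim R_M\<close> and \<open>depth M\<close> is
  the length of the longest regular sequences on \<open>R\<close> contained in \<open>M\<close>.\<close>

definition cohen_macaulay :: "('a, 'b) ring_scheme \<Rightarrow> bool"
  where "cohen_macaulay R \<longleftrightarrow> cring R \<and> noetherian_ring R \<and>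
    (\<forall>M. maximalideal M R \<longrightarrow> depth R M = krull_dim (local_ring_at R M))"

definition semi_local :: "('a, 'b) ring_scheme \<Rightarrow> bool"
  where "semi_local R \<longleftrightarrow> finite {M. maximalideal M R}"


section \<open>Arf rings\<close>

text \<open>\<open>arf_ring Q A\<close>: \<open>A\<close> is an Arf ring with total ring of fractions \<open>Q\<close>.\<close>

definition arf_ring :: "('a, 'b) ring_scheme \<Rightarrow> 'a set \<Rightarrow> bool"
  where "arf_ring Q A \<longleftrightarrow>
    total_ring_of_fractions Q A \<and>
    cohen_macaulay (sub_ring Q A) \<and> semi_local (sub_ring Q A) \<and>
    krull_dim (sub_ring Q A) = 1 \<and>
    (\<forall>M. maximalideal M (sub_ring Q A) \<longrightarrow> krull_dim (local_ring_at (sub_ring Q A) M) = 1) \<and>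
    (\<forall>J \<in> regular_closed_ideals (sub_ring Q A).
       \<exists>a \<in> J. J = ideal_closure (sub_ring Q A) (cgenideal (sub_ring Q A) a)) \<and>
    (\<forall>x \<in> nonzerodivisors (sub_ring Q A). \<forall>y \<in> A. \<forall>z \<in> A.
       y \<otimes>\<^bsub>Q\<^esub> inv\<^bsub>Q\<^esub> x \<in> ring_closure Q A \<longrightarrow> z \<otimes>\<^bsub>Q\<^esub> inv\<^bsub>Q\<^esub> x \<in> ring_closure Q A \<longrightarrow>
       y \<otimes>\<^bsub>Q\<^esub> z \<otimes>\<^bsub>Q\<^esub> inv\<^bsub>Q\<^esub> x \<in> A)"

text \<open>\<open>tower_ring Q R I n\<close> is \<open>R_(I,n)\<close>, \<open>tower_ideal Q R I n\<close> is \<open>I_n\<close>, and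
  \<open>tower_rad Q R I n\<close> is the radical of \<open>I_n\<close> in \<open>R_(I,n)\<close>.\<close>

fun tower_ring :: "('a, 'b) ring_scheme \<Rightarrow> 'a set \<Rightarrow> 'a set \<Rightarrow> nat \<Rightarrow> 'a set"
  and tower_ideal :: "('a, 'b) ring_scheme \<Rightarrow> 'a set \<Rightarrow> 'a set \<Rightarrow> nat \<Rightarrow> 'a set"
  where
    "tower_ring Q R I 0 = R"
  | "tower_ring Q R I (Suc n) =
      colon Q (radical (sub_ring Q (tower_ring Q R I n)) (tower_ideal Q R I n))
              (radical (sub_ring Q (tower_ring Q R I n)) (tower_ideal Q R I n))"
  | "tower_ideal Q R I 0 = I"
  | "tower_ideal Q R I (Suc n) =
      colon Q (tower_ideal Q R I n)
              (radical (sub_ring Q (tower_ring Q R I n)) (tower_ideal Q R I n))"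

abbreviation tower_rad :: "('a, 'b) ring_scheme \<Rightarrow> 'a set \<Rightarrow> 'a set \<Rightarrow> nat \<Rightarrow> 'a set"
  where "tower_rad Q R I n \<equiv> radical (sub_ring Q (tower_ring Q R I n)) (tower_ideal Q R I n)"

text \<open>\<open>F 0 F 1 \<dots> F n\<close> for subsets of \<open>Q\<close>; \<^const>\<open>ideal_prod\<close> \<open>Q U V\<close> is the set of finite
  sums of products \<open>u v\<close> in \<open>Q\<close> for arbitrary subsets \<open>U\<close>, \<open>V\<close>.\<close>

primrec set_product :: "('a, 'b) ring_scheme \<Rightarrow> (nat \<Rightarrow> 'a set) \<Rightarrow> nat \<Rightarrow> 'a set"
  where
    "set_product Q F 0 = F 0"
  | "set_product Q F (Suc n) = ideal_prod Q (set_product Q F n) (F (Suc n))"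

end

theory Submission
  imports Defs
begin

text \<open>Let \<open>J\<close> be the radical of \<open>I\<close>. It is integrally closed, so \<open>J\<close> is the integral closure of a
  principal ideal \<open>aR\<close> with \<open>a \<in> J\<close> regular, and the second Arf condition gives \<open>J J \<subseteq> a J\<close>. Hence
  \<open>J : J = a\<^sup>-\<^sup>1 J\<close> and \<open>I : J = a\<^sup>-\<^sup>1 I\<close>, so that \<open>J = a R\<^sub>1\<close> and \<open>I = a I\<^sub>1\<close>. Multiplication by \<open>a\<close> embeds the
  ideals of \<open>R\<^sub>1\<close> into those of \<open>R\<close>; this transfers the Arf property from \<open>R\<close> to \<open>R\<^sub>1\<close>, and because \<open>R\<close> is
  Noetherian, integrality means having powers with a common denominator, so \<open>R\<close> and \<open>R\<^sub>1\<close> have the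
  same integral closure. Iterating, with \<open>c\<^sub>n = a\<^sub>0 \<cdots> a\<^sub>n\<^sub>-\<^sub>1\<close>, the ideals \<open>c\<^sub>n R\<^sub>n\<close> of \<open>R\<close> decrease and contain
  \<open>I = c\<^sub>n I\<^sub>n\<close>. They become stationary since \<open>R/I\<close> is Artinian, and then \<open>I\<^sub>n = R\<^sub>n\<close>. Finally
  \<open>\<surd>I\<^sub>0 \<cdots> \<surd>I\<^sub>n = c\<^sub>n \<surd>I\<^sub>n\<close>.\<close>

section \<open>Prime ideals and descending chains\<close>

text \<open>The obstacle is that \<open>arf_ring\<close> asks for Cohen-Macaulayness, semi-locality
  and the dimension of every localization, and all of this has to be re-established for
  \<open>B = J : J\<close> at each step. The dimension conditions are therefore traded for the
  axioms of \<open>one_dim_ring\<close>, which speak only of primes and non-zerodivisors; depth and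
  localizations occur only in the passage to and from them. Primes of \<open>B\<close> are then
  split by whether they contain a. Those that do are maximal, by a descending chain argument on
  multiples by a; those that do not are determined by their traces on the smaller ring, because a
  times any element of \<open>B\<close> lies there. Common denominators also replace determinants:
  they give products of integral elements directly, and a denominator d over \<open>B\<close>
  becomes the denominator a d over the smaller ring. The generator a is regular because J contains a
  unit b of Q, and some power of b is a multiple of a. The product of radicals collapses because c_n
  J_n = c_(n+1) R_(n+1): what has been multiplied so far is a multiple of the next ring, and the
  next radical absorbs that ring.\<close>

lemma (in ideal) I_minus_closed: "x \<in> I \<Longrightarrow> y \<in> I \<Longrightarrow> x \<ominus> y \<in> I"
  by (simp add: a_minus_def a_closed a_inv_closed)

lemma (in cring) ideal_add_cgenideal:
  assumes "ideal I R" "x \<in> carrier R"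
  shows "ideal (I <+>\<^bsub>R\<^esub> PIdl x) R" "I \<subseteq> I <+>\<^bsub>R\<^esub> PIdl x" "x \<in> I <+>\<^bsub>R\<^esub> PIdl x"
    "y \<in> I <+>\<^bsub>R\<^esub> PIdl x \<longleftrightarrow> (\<exists>i \<in> I. \<exists>r \<in> carrier R. y = i \<oplus> r \<otimes> x)"
proof -
  interpret I: ideal I R by fact
  show iff: "y \<in> I <+>\<^bsub>R\<^esub> PIdl x \<longleftrightarrow> (\<exists>i \<in> I. \<exists>r \<in> carrier R. y = i \<oplus> r \<otimes> x)" for y
    unfolding set_add_def' cgenideal_def by blast
  show "ideal (I <+>\<^bsub>R\<^esub> PIdl x) R"
    using add_ideals assms cgenideal_ideal by blast
  show "I \<subseteq> I <+>\<^bsub>R\<^esub> PIdl x"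
  proof
    fix i assume "i \<in> I"
    then have "i = i \<oplus> \<zero> \<otimes> x" using I.Icarr assms by simp
    then show "i \<in> I <+>\<^bsub>R\<^esub> PIdl x" using \<open>i \<in> I\<close> iff by blast
  qed
  have "x = \<zero> \<oplus> \<one> \<otimes> x" using assms by simp
  then show "x \<in> I <+>\<^bsub>R\<^esub> PIdl x" using I.zero_closed iff by blast
qed

text \<open>The common Zorn argument for two existence results: \<open>S = {\<one>}\<close> gives
  maximal ideals, a multiplicative \<open>S\<close> gives primes.\<close>

lemma (in cring) ex_maximal_disjoint_ideal:
  assumes "ideal I R" "I \<inter> S = {}"
  shows "\<exists>P. ideal P R \<and> I \<subseteq> P \<and> P \<inter> S = {} \<and>
    (\<forall>J. ideal J R \<longrightarrow> P \<subset> J \<longrightarrow> J \<inter> S \<noteq> {})"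
proof -
  define A where "A = {J. ideal J R \<and> I \<subseteq> J \<and> J \<inter> S = {}}"
  have "\<exists>M \<in> A. \<forall>Z \<in> A. M \<subseteq> Z \<longrightarrow> Z = M"
  proof (rule subset_Zorn_nonempty)
    show "A \<noteq> {}" unfolding A_def using assms by blast
  next
    fix C assume C: "C \<noteq> {}" "subset.chain A C"
    then have "subset.chain {J. ideal J R} C" unfolding A_def subset_chain_def by blast
    from chain_Union_is_ideal[OF this] C(1) have "ideal (\<Union>C) R" by simp
    then show "\<Union>C \<in> A" using C unfolding A_def subset_chain_def by blast
  qed
  then obtain M where M: "M \<in> A" "\<And>Z. Z \<in> A \<Longrightarrow> M \<subseteq> Z \<Longrightarrow> Z = M" by blast
  show ?thesis
  proof (intro exI conjI allI impI)
    show "ideal M R" "I \<subseteq> M" "M \<inter> S = {}" using M(1) unfolding A_def by auto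
    fix J assume "ideal J R" "M \<subset> J"
    then show "J \<inter> S \<noteq> {}" using M(1) M(2)[of J] unfolding A_def by blast
  qed
qed

lemma (in cring) ex_maximalideal:
  assumes "ideal I R" "I \<noteq> carrier R"
  shows "\<exists>M. maximalideal M R \<and> I \<subseteq> M"
proof -
  have "I \<inter> {\<one>} = {}" using assms ideal.one_imp_carrier by blast
  from ex_maximal_disjoint_ideal[OF assms(1) this]
  obtain M where M: "ideal M R" "I \<subseteq> M" "M \<inter> {\<one>} = {}"
    "\<And>J. ideal J R \<Longrightarrow> M \<subset> J \<Longrightarrow> J \<inter> {\<one>} \<noteq> {}" by blast
  have "maximalideal M R"
  proof (rule maximalidealI[OF M(1)])
    show "carrier R \<noteq> M" using M(3) by auto
    fix J assume J: "ideal J R" "M \<subseteq> J" "J \<subseteq> carrier R"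
    then show "J = M \<or> J = carrier R"
      using M(4)[of J] ideal.one_imp_carrier[of J R] by blast
  qed
  with M(2) show ?thesis by blast
qed

lemma (in cring) ex_disjoint_primeideal:
  assumes I: "ideal I R" "I \<inter> S = {}"
    and S: "S \<subseteq> carrier R" "\<one> \<in> S" "\<And>s t. s \<in> S \<Longrightarrow> t \<in> S \<Longrightarrow> s \<otimes> t \<in> S"
  shows "\<exists>P. primeideal P R \<and> I \<subseteq> P \<and> P \<inter> S = {}"
proof -
  from ex_maximal_disjoint_ideal[OF I]
  obtain P where P: "ideal P R" "I \<subseteq> P" "P \<inter> S = {}"
    "\<And>J. ideal J R \<Longrightarrow> P \<subset> J \<Longrightarrow> J \<inter> S \<noteq> {}" by blast
  interpret P: ideal P R by fact
  \<comment> \<open>By maximality, P + (x) meets S as soon as x is outside P. For two such elements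
    a, b with a b in P, the product of the two elements of S found in this way would lie in
    P.\<close>
  have meets: "\<exists>i \<in> P. \<exists>r \<in> carrier R. i \<oplus> r \<otimes> x \<in> S" if x: "x \<in> carrier R" "x \<notin> P" for x
  proof -
    have "P \<subset> P <+>\<^bsub>R\<^esub> PIdl x" using ideal_add_cgenideal(2,3)[OF P(1) x(1)] x(2) by blast
    from P(4)[OF ideal_add_cgenideal(1)[OF P(1) x(1)] this]
    obtain y where "y \<in> S" "y \<in> P <+>\<^bsub>R\<^esub> PIdl x" by blast
    then show ?thesis using ideal_add_cgenideal(4)[OF P(1) x(1), of y] by blast
  qed
  have "primeideal P R"
  proof (rule primeidealI[OF P(1) is_cring])
    show "carrier R \<noteq> P" using P(3) S by blast
    fix a b assume ab: "a \<in> carrier R" "b \<in> carrier R" "a \<otimes> b \<in> P"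
    show "a \<in> P \<or> b \<in> P"
    proof (rule ccontr)
      assume "\<not> ?thesis"
      with meets ab obtain i r j q where *: "i \<in> P" "r \<in> carrier R" "i \<oplus> r \<otimes> a \<in> S"
        "j \<in> P" "q \<in> carrier R" "j \<oplus> q \<otimes> b \<in> S" by meson
      have c: "i \<in> carrier R" "j \<in> carrier R" using * P.Icarr by auto
      have "(i \<oplus> r \<otimes> a) \<otimes> (j \<oplus> q \<otimes> b)
        = i \<otimes> (j \<oplus> q \<otimes> b) \<oplus> (j \<otimes> (r \<otimes> a) \<oplus> (a \<otimes> b) \<otimes> (r \<otimes> q))"
        using ab * c by algebra
      also have "\<dots> \<in> P" using ab * c by (simp add: P.a_closed P.I_r_closed)
      finally show False using S(3)[OF *(3) *(6)] P(3) by blast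
    qed
  qed
  with P show ?thesis by blast
qed

text \<open>A maximal counterexample \<open>L\<close> cannot be prime; if \<open>x y \<in> L\<close> with \<open>x, y \<notin> L\<close>, a descending
  chain is controlled by its images over \<open>L + (x)\<close> and its quotients by \<open>x\<close>, which contain \<open>y\<close>.\<close>

lemma descending_chain_condition:
  fixes R (structure)
  assumes "cring R" "noetherian_ring R" "ideal I R"
    and maximal: "\<And>P. primeideal P R \<Longrightarrow> I \<subseteq> P \<Longrightarrow> maximalideal P R"
    and K: "\<And>n. ideal (K n) R" "\<And>n. I \<subseteq> K n" "\<And>n. K (Suc n) \<subseteq> K n"
  shows "\<exists>N::nat. \<forall>n \<ge> N. K (Suc n) = K n"
proof -
  interpret cring R by fact
  interpret noetherian_ring R by fact
  \<comment> \<open>The chain is quantified inside, so that the condition becomes a property of the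
    lower bound \<open>L\<close> alone and Noetherian induction on \<open>L\<close> applies.\<close>
  define dcc where "dcc L \<longleftrightarrow> (\<forall>K. (\<forall>n. ideal (K n) R \<and> L \<subseteq> K n \<and> K (Suc n) \<subseteq> K n) \<longrightarrow>
    (\<exists>N::nat. \<forall>n \<ge> N. K (Suc n) = K n))" for L
  have dccD: "\<exists>N::nat. \<forall>n \<ge> N. K (Suc n) = K n" if "dcc L"
    "\<And>n. ideal (K n) R" "\<And>n. L \<subseteq> K n" "\<And>n. K (Suc n) \<subseteq> K n" for L K
    using that unfolding dcc_def by simp
  define A where "A = {L. ideal L R \<and> I \<subseteq> L \<and> \<not> dcc L}"
  have "dcc I"
  proof (rule ccontr)
    assume "\<not> dcc I"
    \<comment> \<open>A nonempty chain of ideals in a Noetherian ring contains its own union, so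
      Zorn's lemma yields a maximal counterexample.\<close>
    have "\<exists>M \<in> A. \<forall>Z \<in> A. M \<subseteq> Z \<longrightarrow> Z = M"
    proof (rule subset_Zorn_nonempty)
      show "A \<noteq> {}" unfolding A_def using \<open>\<not> dcc I\<close> assms(3) by blast
    next
      fix C assume C: "C \<noteq> {}" "subset.chain A C"
      then have "subset.chain {J. ideal J R} C" unfolding A_def subset_chain_def by blast
      from ideal_chain_is_trivial[OF C(1) this]
      show "\<Union>C \<in> A" using C(2) unfolding subset_chain_def by blast
    qed
    then obtain L where LA: "L \<in> A" and max: "\<And>Z. Z \<in> A \<Longrightarrow> L \<subseteq> Z \<Longrightarrow> Z = L" by blast
    then have L: "ideal L R" "I \<subseteq> L" "\<not> dcc L" unfolding A_def by auto
    have Lmax: "dcc Z" if "ideal Z R" "L \<subset> Z" for Z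
      using max[of Z] that L(2) unfolding A_def by blast
    interpret L: ideal L R by fact
    from L(3) obtain K where "\<forall>n. ideal (K n) R \<and> L \<subseteq> K n \<and> K (Suc n) \<subseteq> K n"
      and bad: "\<not> (\<exists>N::nat. \<forall>n \<ge> N. K (Suc n) = K n)"
      unfolding dcc_def not_all not_imp by (elim exE conjE)
    then have K: "ideal (K n) R" "L \<subseteq> K n" "K (Suc n) \<subseteq> K n" for n by auto
    have Kc: "K n \<subseteq> carrier R" for n
      using ideal.Icarr[OF K(1)] by (rule subsetI)
    show False
    proof (cases "primeideal L R")
      case True
      interpret L: maximalideal L R using maximal True L(2) by blast
      \<comment> \<open>A prime \<open>L\<close> is maximal by hypothesis, so only two values are
        possible and the chain can drop at most once.\<close>
      have alt: "K n = L \<or> K n = carrier R" for n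
        using L.I_maximal K(1,2) Kc by blast
      then obtain N where "K N = L" using bad by metis
      have "K n = L" if "n \<ge> N" for n
        using that
      proof (induction n rule: dec_induct)
        case base then show ?case using \<open>K N = L\<close> .
      next
        case (step n) then show ?case using K(2,3) by blast
      qed
      then show False using bad by (metis le_SucI)
    next
      case False
      have "L \<noteq> carrier R" using bad K(2) Kc by blast
      with L.primeidealCD[OF is_cring False] obtain x y where
        xy: "x \<in> carrier R" "y \<in> carrier R" "x \<otimes> y \<in> L" "x \<notin> L" "y \<notin> L" by blast
      \<comment> \<open>Both L + (x) and (L : x) are strictly larger than \<open>L\<close>, the
        first because of x, the second because of y. Hence the chains K n + X and (K n : x) become
        stationary.\<close>
      let ?X = "L <+>\<^bsub>R\<^esub> PIdl x"
      let ?Y = "{r \<in> carrier R. x \<otimes> r \<in> L}"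
      have X: "ideal ?X R" "L \<subseteq> ?X" "x \<in> ?X" using ideal_add_cgenideal(1-3)[OF L(1) xy(1)] .
      interpret X: ideal ?X R by fact
      have "dcc ?X" using Lmax X xy by blast
      moreover have "ideal (K n <+>\<^bsub>R\<^esub> ?X) R" for n using add_ideals K(1) X(1) by blast
      moreover have "?X \<subseteq> K n <+>\<^bsub>R\<^esub> ?X" for n
      proof
        fix z assume "z \<in> ?X"
        moreover then have "z = \<zero> \<oplus> z" using X.Icarr by simp
        moreover have "\<zero> \<in> K n"
          using K(1) additive_subgroup.zero_closed ideal_def by blast
        ultimately show "z \<in> K n <+>\<^bsub>R\<^esub> ?X" unfolding set_add_def' by blast
      qed
      moreover have "K (Suc n) <+>\<^bsub>R\<^esub> ?X \<subseteq> K n <+>\<^bsub>R\<^esub> ?X" for n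
        using K(3) unfolding set_add_def' by blast
      ultimately obtain N1 where N1: "\<forall>n \<ge> N1. K (Suc n) <+>\<^bsub>R\<^esub> ?X = K n <+>\<^bsub>R\<^esub> ?X"
        using dccD[of ?X "\<lambda>n. K n <+>\<^bsub>R\<^esub> ?X"] by blast
      have "ideal ?Y R" using L.helper_max_prime[OF is_cring xy(1)] .
      moreover have "L \<subset> ?Y" using xy L.I_l_closed L.Icarr by blast
      ultimately have "dcc ?Y" using Lmax by blast
      moreover have "ideal {r \<in> carrier R. x \<otimes> r \<in> K n} R" for n
        using ideal.helper_max_prime[OF K(1) is_cring xy(1)] .
      moreover have "?Y \<subseteq> {r \<in> carrier R. x \<otimes> r \<in> K n}" for n using K(2) by blast
      moreover have "{r \<in> carrier R. x \<otimes> r \<in> K (Suc n)} \<subseteq> {r \<in> carrier R. x \<otimes> r \<in> K n}" for n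
        using K(3) by blast
      ultimately obtain N2 where
        N2: "\<forall>n \<ge> N2. {r \<in> carrier R. x \<otimes> r \<in> K (Suc n)} = {r \<in> carrier R. x \<otimes> r \<in> K n}"
        using dccD[of ?Y "\<lambda>n. {r \<in> carrier R. x \<otimes> r \<in> K n}"] by blast
      have "K (Suc n) = K n" if n: "n \<ge> max N1 N2" for n
      proof
        show "K (Suc n) \<subseteq> K n" by fact
        show "K n \<subseteq> K (Suc n)"
        proof
          fix k assume k: "k \<in> K n"
          interpret Kn: ideal "K n" R by fact
          interpret Ks: ideal "K (Suc n)" R by fact
          have "k = k \<oplus> \<zero>" "\<zero> \<in> ?X" using k Kn.Icarr by auto
          then have "k \<in> K n <+>\<^bsub>R\<^esub> ?X" using k unfolding set_add_def' by blast
          then have "k \<in> K (Suc n) <+>\<^bsub>R\<^esub> ?X" using N1 n by auto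
          then obtain k' z where k': "k' \<in> K (Suc n)" "z \<in> ?X" "k = k' \<oplus> z"
            unfolding set_add_def' by blast
          then obtain l r where l: "l \<in> L" "r \<in> carrier R" "z = l \<oplus> r \<otimes> x"
            using ideal_add_cgenideal(4)[OF L(1) xy(1)] by blast
          have c: "k' \<in> carrier R" "l \<in> carrier R" using k' l Ks.Icarr L.Icarr by auto
          \<comment> \<open>Stationarity modulo X gives k = k' + l + r x with k' already in the
            smaller ideal. The remaining term r x is handled by the chain of quotients, since r lies
            in (K n : x).\<close>
          have "x \<otimes> r = (k \<ominus> k') \<ominus> l" using c k' l xy by algebra
          moreover have "(k \<ominus> k') \<ominus> l \<in> K n"
            using k k' l K(2,3) by (blast intro: Kn.I_minus_closed)
          ultimately have "r \<in> {r \<in> carrier R. x \<otimes> r \<in> K n}" using l(2) by simp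
          then have "x \<otimes> r \<in> K (Suc n)" using N2 n by (metis (no_types, lifting) max.boundedE mem_Collect_eq)
          then have "k' \<oplus> (l \<oplus> x \<otimes> r) \<in> K (Suc n)" using k' l K(2) by (blast intro: Ks.a_closed)
          moreover have "k = k' \<oplus> (l \<oplus> x \<otimes> r)" using k' l c xy by algebra
          ultimately show "k \<in> K (Suc n)" by simp
        qed
      qed
      then show False using bad by blast
    qed
  qed
  then show ?thesis using dccD[of I K] K by blast
qed

text \<open>If no member of F lies in P, multiplying elements chosen outside P gives an element of
  the intersection outside P. The factor \<open>carrier R\<close> gives the empty intersection its
  value in the ring, since \<open>\<Inter>{}\<close> is the whole type.\<close>

lemma (in cring) primeideal_finite_Inter:
  assumes "primeideal P R" "finite F" "\<And>J. J \<in> F \<Longrightarrow> ideal J R" "carrier R \<inter> \<Inter>F \<subseteq> P"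
  shows "\<exists>J \<in> F. J \<subseteq> P"
  using assms(2-4)
proof (induction F rule: finite_induct)
  case empty
  then show ?case using primeideal.I_notcarr[OF assms(1)] ideal.Icarr[OF primeideal.axioms(1)[OF assms(1)]] by auto
next
  case (insert J F)
  interpret P: primeideal P R by fact
  show ?case
  proof (rule ccontr)
    assume no: "\<not> ?case"
    then obtain x where x: "x \<in> J" "x \<notin> P" by blast
    from no insert.IH insert.prems have "\<not> carrier R \<inter> \<Inter>F \<subseteq> P" by blast
    then obtain y where y: "y \<in> carrier R" "\<And>K. K \<in> F \<Longrightarrow> y \<in> K" "y \<notin> P" by blast
    have J: "ideal J R" using insert.prems by blast
    have xc: "x \<in> carrier R" using x J ideal.Icarr by fast
    have "x \<otimes> y \<in> K" if "K \<in> insert J F" for K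
      using that x y xc insert.prems(1)[OF that]
      by (auto intro: ideal.I_l_closed ideal.I_r_closed)
    then have "x \<otimes> y \<in> P" using insert.prems(2) x y xc by blast
    then show False using P.I_prime x y xc by blast
  qed
qed

text \<open>Infinitely many maximal ideals would give a descending chain of partial intersections.
  Where it stops, a finite intersection lies in the next maximal ideal, which then equals one of the
  earlier ones.\<close>

lemma finite_maximalideals_above:
  fixes R (structure)
  assumes "cring R" "noetherian_ring R" "ideal I R"
    and maximal: "\<And>P. primeideal P R \<Longrightarrow> I \<subseteq> P \<Longrightarrow> maximalideal P R"
  shows "finite {M. maximalideal M R \<and> I \<subseteq> M}"
proof (rule ccontr)
  interpret cring R by fact
  assume "infinite {M. maximalideal M R \<and> I \<subseteq> M}"
  then obtain M :: "nat \<Rightarrow> _" where M: "inj M" "range M \<subseteq> {M. maximalideal M R \<and> I \<subseteq> M}"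
    using infinite_countable_subset by blast
  then have Mm: "maximalideal (M n) R" "ideal (M n) R" "I \<subseteq> M n" for n
    using maximalideal.axioms(1) by blast+
  define K where "K n = (\<Inter>i \<le> n. M i)" for n
  have "ideal (K n) R" for n
    unfolding K_def by (rule i_Intersect) (use Mm in auto)
  moreover have "I \<subseteq> K n" "K (Suc n) \<subseteq> K n" for n
    using Mm(3) unfolding K_def by auto
  ultimately obtain N where "\<forall>n \<ge> N. K (Suc n) = K n"
    using descending_chain_condition[OF assms, of K] by blast
  then have "K N \<subseteq> M (Suc N)" unfolding K_def by blast
  then have "carrier R \<inter> \<Inter>(M ` {..N}) \<subseteq> M (Suc N)" unfolding K_def by auto
  then obtain i where i: "i \<le> N" "M i \<subseteq> M (Suc N)"
    using primeideal_finite_Inter[OF maximalideal_prime[OF Mm(1)], of "M ` {..N}" "Suc N"] Mm(2)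
    by auto
  then have "M i = M (Suc N)"
    using maximalideal.I_maximal[OF Mm(1)[of i] Mm(2)[of "Suc N"]] ideal.Icarr[OF Mm(2)]
      maximalideal.I_notcarr[OF Mm(1)[of "Suc N"]] by blast
  then show False using M(1) i(1) by (auto dest: injD)
qed

section \<open>Localization\<close>

locale multiplicative_subset = cring R for R (structure) +
  fixes S
  assumes S_subset: "S \<subseteq> carrier R"
    and S_one: "\<one> \<in> S"
    and S_mult: "\<And>s t. s \<in> S \<Longrightarrow> t \<in> S \<Longrightarrow> s \<otimes> t \<in> S"
begin

lemma S_carrier: "s \<in> S \<Longrightarrow> s \<in> carrier R"
  using S_subset by blast

definition frac :: "'a \<Rightarrow> 'a \<Rightarrow> ('a \<times> 'a) set"
  where "frac a s = loc_rel R S `` {(a, s)}"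

lemma equiv_loc_rel: "equiv (carrier R \<times> S) (loc_rel R S)"
proof (rule equivI)
  show "loc_rel R S \<subseteq> (carrier R \<times> S) \<times> (carrier R \<times> S)"
    unfolding loc_rel_def by blast
  show "refl_on (carrier R \<times> S) (loc_rel R S)"
    unfolding refl_on_def loc_rel_def using S_one S_carrier by (auto intro!: bexI[of _ \<one>] simp: r_neg a_minus_def)
  show "sym (loc_rel R S)"
  proof (rule symI, clarsimp simp: loc_rel_def)
    fix a s b t u
    assume *: "a \<in> carrier R" "s \<in> S" "b \<in> carrier R" "t \<in> S" "u \<in> S"
      "u \<otimes> (a \<otimes> t \<ominus> b \<otimes> s) = \<zero>"
    have "u \<otimes> (b \<otimes> s \<ominus> a \<otimes> t) = \<ominus> (u \<otimes> (a \<otimes> t \<ominus> b \<otimes> s))"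
      using *(1,3) S_carrier[OF *(2)] S_carrier[OF *(4)] S_carrier[OF *(5)] by algebra
    also have "\<dots> = \<zero>" using *(6) by simp
    finally show "\<exists>u\<in>S. u \<otimes> (b \<otimes> s \<ominus> a \<otimes> t) = \<zero>" using *(5) by (rule bexI)
  qed
  show "trans (loc_rel R S)"
  proof (rule transI, clarsimp simp: loc_rel_def)
    fix a s b t c w u v
    assume *: "a \<in> carrier R" "s \<in> S" "b \<in> carrier R" "t \<in> S" "c \<in> carrier R" "w \<in> S" "u \<in> S" "v \<in> S"
      "u \<otimes> (a \<otimes> t \<ominus> b \<otimes> s) = \<zero>" "v \<otimes> (b \<otimes> w \<ominus> c \<otimes> t) = \<zero>"
    note c = S_carrier[OF *(2)] S_carrier[OF *(4)] S_carrier[OF *(6)] S_carrier[OF *(7)] S_carrier[OF *(8)]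
    have "(u \<otimes> v \<otimes> t) \<otimes> (a \<otimes> w \<ominus> c \<otimes> s)
      = (v \<otimes> w) \<otimes> (u \<otimes> (a \<otimes> t \<ominus> b \<otimes> s)) \<oplus> (u \<otimes> s) \<otimes> (v \<otimes> (b \<otimes> w \<ominus> c \<otimes> t))"
      using *(1,3,5) c by algebra
    then have "(u \<otimes> v \<otimes> t) \<otimes> (a \<otimes> w \<ominus> c \<otimes> s) = \<zero>" using * c by simp
    moreover have "u \<otimes> v \<otimes> t \<in> S" using * S_mult by simp
    ultimately show "\<exists>u\<in>S. u \<otimes> (a \<otimes> w \<ominus> c \<otimes> s) = \<zero>" by blast
  qed
qed

lemma frac_eq_iff:
  assumes "a \<in> carrier R" "b \<in> carrier R" "s \<in> S" "t \<in> S"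
  shows "frac a s = frac b t \<longleftrightarrow> (\<exists>u \<in> S. u \<otimes> (a \<otimes> t \<ominus> b \<otimes> s) = \<zero>)"
proof -
  have "frac a s = frac b t \<longleftrightarrow> ((a, s), (b, t)) \<in> loc_rel R S"
    unfolding frac_def using eq_equiv_class_iff[OF equiv_loc_rel] assms by simp
  then show ?thesis using assms unfolding loc_rel_def by auto
qed

lemma frac_eqI:
  assumes "a \<in> carrier R" "b \<in> carrier R" "s \<in> S" "t \<in> S" "a \<otimes> t = b \<otimes> s"
  shows "frac a s = frac b t"
  using assms S_one S_carrier by (subst frac_eq_iff) (auto intro!: bexI[of _ \<one>] simp: r_right_minus_eq)

lemma localization_carrier:
  "x \<in> carrier (localization R S) \<longleftrightarrow> (\<exists>a \<in> carrier R. \<exists>s \<in> S. x = frac a s)"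
  unfolding localization_def frac_def by (auto simp: quotient_def)

lemma frac_closed [simp]:
  "a \<in> carrier R \<Longrightarrow> s \<in> S \<Longrightarrow> frac a s \<in> carrier (localization R S)"
  using localization_carrier by blast

lemma localization_one: "\<one>\<^bsub>localization R S\<^esub> = frac \<one> \<one>"
  unfolding localization_def frac_def by simp

lemma localization_zero: "\<zero>\<^bsub>localization R S\<^esub> = frac \<zero> \<one>"
  unfolding localization_def frac_def by simp

lemma mem_frac_iff:
  assumes "a \<in> carrier R" "s \<in> S"
  shows "p \<in> frac a s \<longleftrightarrow> (\<exists>b t. p = (b, t) \<and> b \<in> carrier R \<and> t \<in> S \<and> frac b t = frac a s)"
proof -
  have "((a, s), p) \<in> loc_rel R S \<longleftrightarrow> p \<in> carrier R \<times> S \<and> frac a s = frac (fst p) (snd p)"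
    unfolding frac_def using equiv_class_eq_iff[OF equiv_loc_rel, of "(a, s)" p] assms by auto
  then show ?thesis unfolding frac_def by (cases p) auto
qed

text \<open>The operations of \<open>localization\<close> are unions over all representatives. Such
  a union collapses to one class once the class is independent of the representatives, which reduces
  \<open>frac_mult\<close> and \<open>frac_add\<close> to well-definedness.\<close>

lemma frac_Union:
  assumes "a \<in> carrier R" "s \<in> S" "b \<in> carrier R" "t \<in> S"
    and "\<And>a' s' b' t'. a' \<in> carrier R \<Longrightarrow> s' \<in> S \<Longrightarrow> b' \<in> carrier R \<Longrightarrow> t' \<in> S \<Longrightarrow>
      frac a' s' = frac a s \<Longrightarrow> frac b' t' = frac b t \<Longrightarrow> F (a', s') (b', t') = F (a, s) (b, t)"
  shows "(\<Union>p \<in> frac a s. \<Union>q \<in> frac b t. F p q) = F (a, s) (b, t)"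
proof -
  have "(a, s) \<in> frac a s" "(b, t) \<in> frac b t" using assms(1-4) by (auto simp: mem_frac_iff)
  moreover have "F p q = F (a, s) (b, t)" if "p \<in> frac a s" "q \<in> frac b t" for p q
  proof -
    from that(1) obtain a' s' where p: "p = (a', s')" "a' \<in> carrier R" "s' \<in> S" "frac a' s' = frac a s"
      unfolding mem_frac_iff[OF assms(1,2)] by auto
    from that(2) obtain b' t' where q: "q = (b', t')" "b' \<in> carrier R" "t' \<in> S" "frac b' t' = frac b t"
      unfolding mem_frac_iff[OF assms(3,4)] by auto
    show ?thesis using assms(5)[OF p(2,3) q(2,3) p(4) q(4)] p(1) q(1) by simp
  qed
  ultimately show ?thesis by blast
qed

lemma frac_mult:
  assumes "a \<in> carrier R" "s \<in> S" "b \<in> carrier R" "t \<in> S"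
  shows "frac a s \<otimes>\<^bsub>localization R S\<^esub> frac b t = frac (a \<otimes> b) (s \<otimes> t)"
proof -
  have "frac a s \<otimes>\<^bsub>localization R S\<^esub> frac b t =
    (\<Union>p \<in> frac a s. \<Union>q \<in> frac b t. frac (fst p \<otimes> fst q) (snd p \<otimes> snd q))"
    unfolding localization_def frac_def by (simp add: case_prod_beta)
  also have "\<dots> = frac (fst (a, s) \<otimes> fst (b, t)) (snd (a, s) \<otimes> snd (b, t))"
  proof (rule frac_Union[OF assms])
    fix a' s' b' t'
    assume *: "a' \<in> carrier R" "s' \<in> S" "b' \<in> carrier R" "t' \<in> S"
      "frac a' s' = frac a s" "frac b' t' = frac b t"
    then obtain u v where uv: "u \<in> S" "u \<otimes> (a' \<otimes> s \<ominus> a \<otimes> s') = \<zero>"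
      "v \<in> S" "v \<otimes> (b' \<otimes> t \<ominus> b \<otimes> t') = \<zero>"
      using assms by (auto simp: frac_eq_iff)
    note c = assms(1,3) *(1,3) S_carrier[OF assms(2)] S_carrier[OF assms(4)] S_carrier[OF *(2)]
      S_carrier[OF *(4)] S_carrier[OF uv(1)] S_carrier[OF uv(3)]
    \<comment> \<open>The two fractions are replaced one at a time; the mixed term a s' b' t
      cancels.\<close>
    have "(u \<otimes> v) \<otimes> ((a' \<otimes> b') \<otimes> (s \<otimes> t) \<ominus> (a \<otimes> b) \<otimes> (s' \<otimes> t'))
      = (v \<otimes> b' \<otimes> t) \<otimes> (u \<otimes> (a' \<otimes> s \<ominus> a \<otimes> s')) \<oplus> (u \<otimes> a \<otimes> s') \<otimes> (v \<otimes> (b' \<otimes> t \<ominus> b \<otimes> t'))"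
      using c by algebra
    then have "(u \<otimes> v) \<otimes> ((a' \<otimes> b') \<otimes> (s \<otimes> t) \<ominus> (a \<otimes> b) \<otimes> (s' \<otimes> t')) = \<zero>"
      using uv c by simp
    moreover have "u \<otimes> v \<in> S" using uv S_mult by simp
    ultimately show "frac (fst (a', s') \<otimes> fst (b', t')) (snd (a', s') \<otimes> snd (b', t')) =
      frac (fst (a, s) \<otimes> fst (b, t)) (snd (a, s) \<otimes> snd (b, t))"
      using c assms * S_mult by (simp add: frac_eq_iff) blast
  qed
  finally show ?thesis by simp
qed

lemma frac_add:
  assumes "a \<in> carrier R" "s \<in> S" "b \<in> carrier R" "t \<in> S"
  shows "frac a s \<oplus>\<^bsub>localization R S\<^esub> frac b t = frac (a \<otimes> t \<oplus> b \<otimes> s) (s \<otimes> t)"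
proof -
  have "frac a s \<oplus>\<^bsub>localization R S\<^esub> frac b t =
    (\<Union>p \<in> frac a s. \<Union>q \<in> frac b t. frac (fst p \<otimes> snd q \<oplus> fst q \<otimes> snd p) (snd p \<otimes> snd q))"
    unfolding localization_def frac_def by (simp add: case_prod_beta)
  also have "\<dots> = frac (fst (a, s) \<otimes> snd (b, t) \<oplus> fst (b, t) \<otimes> snd (a, s)) (snd (a, s) \<otimes> snd (b, t))"
  proof (rule frac_Union[OF assms])
    fix a' s' b' t'
    assume *: "a' \<in> carrier R" "s' \<in> S" "b' \<in> carrier R" "t' \<in> S"
      "frac a' s' = frac a s" "frac b' t' = frac b t"
    then obtain u v where uv: "u \<in> S" "u \<otimes> (a' \<otimes> s \<ominus> a \<otimes> s') = \<zero>"
      "v \<in> S" "v \<otimes> (b' \<otimes> t \<ominus> b \<otimes> t') = \<zero>"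
      using assms by (auto simp: frac_eq_iff)
    note c = assms(1,3) *(1,3) S_carrier[OF assms(2)] S_carrier[OF assms(4)] S_carrier[OF *(2)]
      S_carrier[OF *(4)] S_carrier[OF uv(1)] S_carrier[OF uv(3)]
    have "(u \<otimes> v) \<otimes> ((a' \<otimes> t' \<oplus> b' \<otimes> s') \<otimes> (s \<otimes> t) \<ominus> (a \<otimes> t \<oplus> b \<otimes> s) \<otimes> (s' \<otimes> t'))
      = (v \<otimes> t \<otimes> t') \<otimes> (u \<otimes> (a' \<otimes> s \<ominus> a \<otimes> s')) \<oplus> (u \<otimes> s \<otimes> s') \<otimes> (v \<otimes> (b' \<otimes> t \<ominus> b \<otimes> t'))"
      using c by algebra
    then have "(u \<otimes> v) \<otimes> ((a' \<otimes> t' \<oplus> b' \<otimes> s') \<otimes> (s \<otimes> t) \<ominus> (a \<otimes> t \<oplus> b \<otimes> s) \<otimes> (s' \<otimes> t')) = \<zero>"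
      using uv c by simp
    moreover have "u \<otimes> v \<in> S" using uv S_mult by simp
    ultimately show "frac (fst (a', s') \<otimes> snd (b', t') \<oplus> fst (b', t') \<otimes> snd (a', s')) (snd (a', s') \<otimes> snd (b', t')) =
      frac (fst (a, s) \<otimes> snd (b, t) \<oplus> fst (b, t) \<otimes> snd (a, s)) (snd (a, s) \<otimes> snd (b, t))"
      using c assms * S_mult by (simp add: frac_eq_iff) blast
  qed
  finally show ?thesis by simp
qed

lemma localization_cring: "cring (localization R S)"
proof (rule cringI)
  let ?L = "localization R S"
  show "abelian_group ?L"
  proof (rule abelian_groupI)
    fix x y z assume "x \<in> carrier ?L" "y \<in> carrier ?L" "z \<in> carrier ?L"
    then obtain a s b t c w where *: "a \<in> carrier R" "s \<in> S" "x = frac a s"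
      "b \<in> carrier R" "t \<in> S" "y = frac b t" "c \<in> carrier R" "w \<in> S" "z = frac c w"
      unfolding localization_carrier by blast
    note c = *(1,4,7) S_carrier[OF *(2)] S_carrier[OF *(5)] S_carrier[OF *(8)]
    show "x \<oplus>\<^bsub>?L\<^esub> y \<in> carrier ?L" using * c by (simp add: frac_add S_mult)
    show "x \<oplus>\<^bsub>?L\<^esub> y = y \<oplus>\<^bsub>?L\<^esub> x"
      using * c by (simp add: frac_add a_comm m_comm)
    have "(((a \<otimes> t) \<oplus> b \<otimes> s) \<otimes> w \<oplus> c \<otimes> (s \<otimes> t)) \<otimes> (s \<otimes> (t \<otimes> w)) =
      (a \<otimes> (t \<otimes> w) \<oplus> (b \<otimes> w \<oplus> c \<otimes> t) \<otimes> s) \<otimes> (s \<otimes> t \<otimes> w)"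
      using c by algebra
    then show "x \<oplus>\<^bsub>?L\<^esub> y \<oplus>\<^bsub>?L\<^esub> z = x \<oplus>\<^bsub>?L\<^esub> (y \<oplus>\<^bsub>?L\<^esub> z)"
      using * c by (simp add: frac_add S_mult) (rule frac_eqI, auto simp: S_mult)
  next
    show "\<zero>\<^bsub>?L\<^esub> \<in> carrier ?L" by (simp add: localization_zero S_one)
  next
    fix x assume "x \<in> carrier ?L"
    then obtain a s where *: "a \<in> carrier R" "s \<in> S" "x = frac a s"
      unfolding localization_carrier by blast
    note c = *(1) S_carrier[OF *(2)]
    show "\<zero>\<^bsub>?L\<^esub> \<oplus>\<^bsub>?L\<^esub> x = x"
      using * c S_one by (simp add: localization_zero frac_add)
    have "frac (\<ominus> a) s \<oplus>\<^bsub>?L\<^esub> x = \<zero>\<^bsub>?L\<^esub>"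
      unfolding *(3) localization_zero using * c S_one
      by (simp add: frac_add l_minus l_neg) (rule frac_eqI, auto simp: S_mult)
    then show "\<exists>y \<in> carrier ?L. y \<oplus>\<^bsub>?L\<^esub> x = \<zero>\<^bsub>?L\<^esub>" using c * by (meson a_inv_closed frac_closed)
  qed
  show "comm_monoid ?L"
  proof (rule comm_monoidI)
    fix x y z assume "x \<in> carrier ?L" "y \<in> carrier ?L" "z \<in> carrier ?L"
    then obtain a s b t c w where *: "a \<in> carrier R" "s \<in> S" "x = frac a s"
      "b \<in> carrier R" "t \<in> S" "y = frac b t" "c \<in> carrier R" "w \<in> S" "z = frac c w"
      unfolding localization_carrier by blast
    note c = *(1,4,7) S_carrier[OF *(2)] S_carrier[OF *(5)] S_carrier[OF *(8)]
    show "x \<otimes>\<^bsub>?L\<^esub> y \<in> carrier ?L" using * c by (simp add: frac_mult S_mult)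
    show "x \<otimes>\<^bsub>?L\<^esub> y = y \<otimes>\<^bsub>?L\<^esub> x"
      using * c by (simp add: frac_mult m_comm)
    show "x \<otimes>\<^bsub>?L\<^esub> y \<otimes>\<^bsub>?L\<^esub> z = x \<otimes>\<^bsub>?L\<^esub> (y \<otimes>\<^bsub>?L\<^esub> z)"
      using * c by (simp add: frac_mult S_mult m_assoc)
  next
    show "\<one>\<^bsub>?L\<^esub> \<in> carrier ?L" by (simp add: localization_one S_one)
  next
    fix x assume "x \<in> carrier ?L"
    then obtain a s where "a \<in> carrier R" "s \<in> S" "x = frac a s"
      unfolding localization_carrier by blast
    then show "\<one>\<^bsub>?L\<^esub> \<otimes>\<^bsub>?L\<^esub> x = x"
      using S_one S_carrier by (simp add: localization_one frac_mult)
  qed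
  fix x y z assume "x \<in> carrier ?L" "y \<in> carrier ?L" "z \<in> carrier ?L"
  then obtain a s b t c w where *: "a \<in> carrier R" "s \<in> S" "x = frac a s"
    "b \<in> carrier R" "t \<in> S" "y = frac b t" "c \<in> carrier R" "w \<in> S" "z = frac c w"
    unfolding localization_carrier by blast
  note c = *(1,4,7) S_carrier[OF *(2)] S_carrier[OF *(5)] S_carrier[OF *(8)]
  have "((a \<otimes> t \<oplus> b \<otimes> s) \<otimes> c) \<otimes> (s \<otimes> w \<otimes> (t \<otimes> w)) =
    (a \<otimes> c \<otimes> (t \<otimes> w) \<oplus> b \<otimes> c \<otimes> (s \<otimes> w)) \<otimes> (s \<otimes> t \<otimes> w)"
    using c by algebra
  then show "(x \<oplus>\<^bsub>?L\<^esub> y) \<otimes>\<^bsub>?L\<^esub> z = x \<otimes>\<^bsub>?L\<^esub> z \<oplus>\<^bsub>?L\<^esub> y \<otimes>\<^bsub>?L\<^esub> z"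
    using * c by (simp add: frac_mult frac_add S_mult) (rule frac_eqI, auto simp: S_mult)
qed

lemma frac_one_ring_hom: "ring_hom_ring R (localization R S) (\<lambda>a. frac a \<one>)"
proof -
  have "(\<lambda>a. frac a \<one>) \<in> ring_hom R (localization R S)"
    by (rule ring_hom_memI) (simp_all add: S_one frac_mult frac_add localization_one)
  then show ?thesis
    using ring_axioms localization_cring cring.axioms(1)
    by (auto simp: ring_hom_ring_def ring_hom_ring_axioms_def)
qed

lemma frac_factor:
  assumes "a \<in> carrier R" "s \<in> S"
  shows "frac a s = frac a \<one> \<otimes>\<^bsub>localization R S\<^esub> frac \<one> s"
    and "frac a \<one> = frac a s \<otimes>\<^bsub>localization R S\<^esub> frac s \<one>"
proof -
  note c = assms S_one S_carrier[OF assms(2)]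
  show "frac a s = frac a \<one> \<otimes>\<^bsub>localization R S\<^esub> frac \<one> s"
    using c by (simp add: frac_mult)
  have "frac a \<one> = frac (a \<otimes> s) (s \<otimes> \<one>)"
    using c by (intro frac_eqI) (simp_all add: S_mult)
  then show "frac a \<one> = frac a s \<otimes>\<^bsub>localization R S\<^esub> frac s \<one>"
    using c by (simp add: frac_mult)
qed

section \<open>Contraction and extension of prime ideals along a localization\<close>

lemma contraction_primeideal:
  assumes "primeideal P (localization R S)"
  shows "primeideal {a \<in> carrier R. frac a \<one> \<in> P} R"
  using ring_hom_ring.primeideal_vimage[OF frac_one_ring_hom is_cring assms] .

text \<open>The fractions a/s and a/1 differ by the factors 1/s and s/1 of the localization. Ideals
  are thus determined by their numerators, which makes contraction strictly monotone.\<close>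

lemma frac_mem_iff:
  assumes "ideal P (localization R S)" "a \<in> carrier R" "s \<in> S"
  shows "frac a s \<in> P \<longleftrightarrow> frac a \<one> \<in> P"
proof -
  interpret P: ideal P "localization R S" by fact
  note c = assms(2,3) S_carrier[OF assms(3)] S_one
  show ?thesis
  proof
    assume "frac a s \<in> P"
    then have "frac a s \<otimes>\<^bsub>localization R S\<^esub> frac s \<one> \<in> P"
      using c by (intro P.I_r_closed) simp_all
    then show "frac a \<one> \<in> P" using frac_factor(2)[OF assms(2,3)] by simp
  next
    assume "frac a \<one> \<in> P"
    then have "frac a \<one> \<otimes>\<^bsub>localization R S\<^esub> frac \<one> s \<in> P"
      using c by (intro P.I_r_closed) simp_all
    then show "frac a s \<in> P" using frac_factor(1)[OF assms(2,3)] by simp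
  qed
qed

lemma contraction_strict:
  assumes "ideal P (localization R S)" "ideal P' (localization R S)" "P \<subset> P'"
  shows "{a \<in> carrier R. frac a \<one> \<in> P} \<subset> {a \<in> carrier R. frac a \<one> \<in> P'}"
proof -
  from psubset_imp_ex_mem[OF assms(3)] obtain x where x: "x \<in> P'" "x \<notin> P" by auto
  have "x \<in> carrier (localization R S)" using ideal.Icarr[OF assms(2) x(1)] .
  then obtain a s where as: "a \<in> carrier R" "s \<in> S" "x = frac a s"
    unfolding localization_carrier by blast
  have "frac a \<one> \<in> P'" "frac a \<one> \<notin> P"
    using x frac_mem_iff[OF assms(1) as(1,2)] frac_mem_iff[OF assms(2) as(1,2)] as(3) by simp_all
  moreover have "{a \<in> carrier R. frac a \<one> \<in> P} \<subseteq> {a \<in> carrier R. frac a \<one> \<in> P'}"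
    using assms(3) by auto
  ultimately show ?thesis using as(1) by auto
qed

definition extension :: "'a set \<Rightarrow> ('a \<times> 'a) set set"
  where "extension P = {frac a s | a s. a \<in> P \<and> s \<in> S}"

text \<open>Membership asks for some representative with numerator in \<open>P\<close>. Equality of
  fractions puts u t a into \<open>P\<close> with u t in \<open>S\<close>, and primality makes the
  choice of representative irrelevant.\<close>

lemma frac_mem_extension:
  assumes "primeideal P R" "P \<inter> S = {}" "a \<in> carrier R" "s \<in> S"
  shows "frac a s \<in> extension P \<longleftrightarrow> a \<in> P"
proof
  interpret P: primeideal P R by fact
  assume "frac a s \<in> extension P"
  then obtain b t where bt: "b \<in> P" "t \<in> S" "frac a s = frac b t" unfolding extension_def by blast
  then obtain u where u: "u \<in> S" "u \<otimes> (a \<otimes> t \<ominus> b \<otimes> s) = \<zero>"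
    using frac_eq_iff[OF assms(3) P.Icarr[OF bt(1)] assms(4) bt(2)] by blast
  note c = S_carrier[OF assms(4)] S_carrier[OF bt(2)] S_carrier[OF u(1)] assms(3) P.Icarr[OF bt(1)]
  have "(u \<otimes> t) \<otimes> a = u \<otimes> (a \<otimes> t \<ominus> b \<otimes> s) \<oplus> b \<otimes> (u \<otimes> s)" using c by algebra
  also have "\<dots> \<in> P" using u bt c by (simp add: P.I_r_closed)
  finally have "u \<otimes> t \<in> P \<or> a \<in> P" using c by (intro P.I_prime) simp_all
  then show "a \<in> P" using S_mult[OF u(1) bt(2)] assms(2) by blast
next
  assume "a \<in> P"
  then show "frac a s \<in> extension P" using assms unfolding extension_def by blast
qed

lemma extension_primeideal:
  assumes P: "primeideal P R" "P \<inter> S = {}"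
  shows "primeideal (extension P) (localization R S)"
proof (rule primeidealI[OF idealI localization_cring])
  let ?L = "localization R S"
  interpret P: primeideal P R by fact
  interpret L: cring ?L by (rule localization_cring)
  note mem = frac_mem_extension[OF P]
  have sub: "extension P \<subseteq> carrier ?L"
    unfolding extension_def using P.Icarr by auto
  show "ring ?L" by (rule L.ring_axioms)
  show "subgroup (extension P) (add_monoid ?L)"
  proof (rule L.add.subgroupI)
    show "extension P \<subseteq> carrier ?L" by (rule sub)
    show "extension P \<noteq> {}" unfolding extension_def using P.zero_closed S_one by blast
    fix x assume "x \<in> extension P"
    then obtain a s where x: "a \<in> P" "s \<in> S" "x = frac a s" unfolding extension_def by blast
    note c = P.Icarr[OF x(1)] S_carrier[OF x(2)]
    have "frac (\<ominus> a) s \<oplus>\<^bsub>?L\<^esub> x = \<zero>\<^bsub>?L\<^esub>"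
      unfolding x(3) localization_zero using x c S_one
      by (simp add: frac_add l_minus l_neg) (rule frac_eqI, auto simp: S_mult)
    then have "\<ominus>\<^bsub>?L\<^esub> x = frac (\<ominus> a) s"
      using x c by (intro L.minus_equality) auto
    then show "\<ominus>\<^bsub>?L\<^esub> x \<in> extension P" using x c by (simp add: mem)
    fix y assume "y \<in> extension P"
    then obtain b t where y: "b \<in> P" "t \<in> S" "y = frac b t" unfolding extension_def by blast
    note d = P.Icarr[OF y(1)] S_carrier[OF y(2)]
    show "x \<oplus>\<^bsub>?L\<^esub> y \<in> extension P"
      using x y c d by (simp add: frac_add mem S_mult P.I_r_closed P.a_closed)
  qed
  show closed: "x \<otimes>\<^bsub>?L\<^esub> y \<in> extension P" if "y \<in> extension P" "x \<in> carrier ?L" for x y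
  proof -
    from that(2) obtain a s where x: "a \<in> carrier R" "s \<in> S" "x = frac a s"
      unfolding localization_carrier by auto
    from that(1) obtain b t where y: "b \<in> P" "t \<in> S" "y = frac b t"
      unfolding extension_def by auto
    show ?thesis using x y P.Icarr[OF y(1)] by (simp add: frac_mult mem S_mult P.I_l_closed)
  qed
  show "y \<otimes>\<^bsub>?L\<^esub> x \<in> extension P" if "y \<in> extension P" "x \<in> carrier ?L" for x y
    using closed[OF that] L.m_comm[OF that(2) subsetD[OF sub that(1)]] by simp
  have "\<one>\<^bsub>?L\<^esub> \<notin> extension P"
    using P(2) S_one by (auto simp: localization_one mem)
  then show "carrier ?L \<noteq> extension P" by auto
  fix x y assume xy: "x \<in> carrier ?L" "y \<in> carrier ?L" "x \<otimes>\<^bsub>?L\<^esub> y \<in> extension P"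
  from xy(1) obtain a s where x: "a \<in> carrier R" "s \<in> S" "x = frac a s"
    unfolding localization_carrier by auto
  from xy(2) obtain b t where y: "b \<in> carrier R" "t \<in> S" "y = frac b t"
    unfolding localization_carrier by auto
  show "x \<in> extension P \<or> y \<in> extension P"
    using P.I_prime[OF x(1) y(1)] xy(3) x y by (simp add: frac_mult mem S_mult)
qed

end

section \<open>One-dimensional Cohen-Macaulay rings\<close>

lemma (in cring) nonzerodivisors_pow_cancel:
  assumes "x \<in> nonzerodivisors R" "s \<in> carrier R" "x [^] (n::nat) \<otimes> s = \<zero>"
  shows "s = \<zero>"
  using assms(3)
proof (induction n)
  case 0
  then show ?case using assms(2) by simp
next
  case (Suc n)
  have x: "x \<in> carrier R" using assms(1) by (simp add: nonzerodivisors_def)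
  have "x \<otimes> (x [^] n \<otimes> s) = \<zero>"
    using Suc.prems x assms(2) by (simp add: m_ac)
  then have "x [^] n \<otimes> s = \<zero>"
    using assms(1,2) x by (simp add: nonzerodivisors_def)
  then show ?case by (rule Suc.IH)
qed

text \<open>The elements x^n s with s outside P form a multiplicative set without zero, because x
  can be cancelled. A prime avoiding it lies in P (take n = 0) and misses x (take n = 1, s =
  1).\<close>

lemma (in cring) ex_smaller_primeideal:
  assumes "primeideal P R" "x \<in> P" "x \<in> nonzerodivisors R"
  shows "\<exists>P0. primeideal P0 R \<and> P0 \<subset> P"
proof -
  interpret P: primeideal P R by fact
  have x: "x \<in> carrier R" using assms(3) by (simp add: nonzerodivisors_def)
  define S where "S = {x [^] (n::nat) \<otimes> s | n s. s \<in> carrier R \<and> s \<notin> P}"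
  have memS: "x [^] (n::nat) \<otimes> s \<in> S" if "s \<in> carrier R" "s \<notin> P" for n s
    using that unfolding S_def by blast
  have one: "\<one> \<notin> P" using P.I_notcarr P.one_imp_carrier by blast
  have "\<exists>P0. primeideal P0 R \<and> {\<zero>} \<subseteq> P0 \<and> P0 \<inter> S = {}"
  proof (rule ex_disjoint_primeideal[OF zeroideal])
    show "{\<zero>} \<inter> S = {}"
    proof (rule ccontr)
      assume "{\<zero>} \<inter> S \<noteq> {}"
      then obtain n s where s: "s \<in> carrier R" "s \<notin> P" "x [^] (n::nat) \<otimes> s = \<zero>"
        unfolding S_def by auto
      then have "s = \<zero>" using nonzerodivisors_pow_cancel[OF assms(3)] by blast
      then show False using s P.zero_closed by simp
    qed
    show "S \<subseteq> carrier R" unfolding S_def using x by auto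
    show "\<one> \<in> S" using memS[OF one_closed one, of 0] by simp
    fix u v assume "u \<in> S" "v \<in> S"
    then obtain n s m t where st: "s \<in> carrier R" "s \<notin> P" "u = x [^] (n::nat) \<otimes> s"
      "t \<in> carrier R" "t \<notin> P" "v = x [^] (m::nat) \<otimes> t"
      unfolding S_def by auto
    have "u \<otimes> v = (x [^] n \<otimes> x [^] m) \<otimes> (s \<otimes> t)"
      using st x by (simp add: m_ac)
    also have "\<dots> = x [^] (n + m) \<otimes> (s \<otimes> t)" using x by (simp add: nat_pow_mult)
    also have "\<dots> \<in> S" using st P.I_prime[of s t] by (intro memS) auto
    finally show "u \<otimes> v \<in> S" .
  qed
  then obtain P0 where P0: "primeideal P0 R" "P0 \<inter> S = {}" by blast
  interpret P0: primeideal P0 R by fact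
  have "x \<otimes> \<one> \<in> S" using memS[OF one_closed one, of 1] x by simp
  then have "x \<notin> P0" using P0(2) x by auto
  moreover have "P0 \<subseteq> P"
  proof
    fix y assume y: "y \<in> P0"
    then have "y \<in> carrier R" using P0.Icarr by blast
    then show "y \<in> P" using memS[of y 0] P0(2) y by auto
  qed
  ultimately show ?thesis using assms(2) P0(1) by blast
qed

text \<open>The chain I + (y^n) stops, so y^N = i + r y^(N+1) for some i in I. The descending chain
  condition is a hypothesis because it has two sources: a regular element of the ring itself, and,
  for \<open>J : J\<close>, the ideals multiplied by a.\<close>

lemma (in cring) stationary_powers:
  assumes I: "ideal I R" and y: "y \<in> carrier R"
    and dcc: "\<And>K :: nat \<Rightarrow> 'a set. (\<And>n. ideal (K n) R) \<Longrightarrow> (\<And>n. I \<subseteq> K n) \<Longrightarrow>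
      (\<And>n. K (Suc n) \<subseteq> K n) \<Longrightarrow> \<exists>N. K (Suc N) = K N"
  shows "\<exists>N::nat. \<exists>r \<in> carrier R. y [^] N \<otimes> (\<one> \<ominus> r \<otimes> y) \<in> I"
proof -
  define K where "K n = I <+>\<^bsub>R\<^esub> PIdl (y [^] (n::nat))" for n
  have yn: "y [^] n \<in> carrier R" for n :: nat using y by simp
  note K = ideal_add_cgenideal[OF I yn, folded K_def]
  have "K (Suc n) \<subseteq> K n" for n
  proof
    fix z assume "z \<in> K (Suc n)"
    then obtain i r where ir: "i \<in> I" "r \<in> carrier R" "z = i \<oplus> r \<otimes> y [^] Suc n"
      using K(4)[of _ "Suc n"] by blast
    then have "z = i \<oplus> (r \<otimes> y) \<otimes> y [^] n" using y ir(2) by (simp add: m_ac)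
    then show "z \<in> K n" using K(4)[of z n] ir y by blast
  qed
  then have "\<exists>N. K (Suc N) = K N"
    by (rule dcc[OF K(1,2)])
  then obtain N where N: "K (Suc N) = K N" by auto
  have "y [^] N \<in> K (Suc N)" using K(3)[of N] N by simp
  then obtain i r where ir: "i \<in> I" "r \<in> carrier R" "y [^] N = i \<oplus> r \<otimes> y [^] Suc N"
    unfolding K(4) by (elim bexE)
  have ic: "i \<in> carrier R" using ideal.Icarr[OF I] ir by blast
  define q where "q = r \<otimes> (y [^] N \<otimes> y)"
  have qc: "q \<in> carrier R" unfolding q_def using y ir(2) yn by simp
  have q: "i \<oplus> q = y [^] N" using ir(3) unfolding q_def by simp
  have "y [^] N \<otimes> (\<one> \<ominus> r \<otimes> y) = y [^] N \<ominus> q"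
    unfolding q_def using y ir(2) yn by algebra
  also have "\<dots> = i" unfolding q[symmetric] using ic qc by algebra
  finally show ?thesis using ir(1,2) by (intro exI[of _ N] bexI[of _ r]) simp_all
qed

lemma krull_dim_ge:
  assumes "primeideal P0 R" "primeideal P1 R" "P0 \<subset> P1"
  shows "1 \<le> krull_dim R"
proof -
  have "enat 1 \<le> krull_dim R"
    unfolding krull_dim_def
    by (rule Sup_upper) (use assms in \<open>auto intro!: exI[of _ "\<lambda>i::nat. if i = 0 then P0 else P1"]\<close>)
  then show ?thesis by (simp add: one_enat_def)
qed

lemma krull_dim_le:
  assumes "\<And>P0 P1 P2. primeideal P0 R \<Longrightarrow> primeideal P1 R \<Longrightarrow> primeideal P2 R \<Longrightarrow>
    P0 \<subset> P1 \<Longrightarrow> P1 \<subset> P2 \<Longrightarrow> False"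
  shows "krull_dim R \<le> 1"
  unfolding krull_dim_def
proof (rule Sup_least, clarify)
  fix n P assume *: "\<forall>i \<le> n. primeideal (P i) R" "\<forall>i < n. P i \<subset> P (Suc i)"
  have "n \<le> 1"
  proof (rule ccontr)
    assume "\<not> n \<le> 1"
    then have "0 < n" "1 < n" by auto
    then have "primeideal (P 0) R" "primeideal (P 1) R" "primeideal (P 2) R"
      "P 0 \<subset> P 1" "P 1 \<subset> P 2"
      using * by (auto simp: numeral_2_eq_2)
    then show False using assms by blast
  qed
  then show "enat n \<le> 1" by (simp add: one_enat_def)
qed

text \<open>The dimension and depth conditions of \<open>arf_ring\<close> in terms of primes and
  non-zerodivisors. They follow from the original ones in \<open>one_dim_ringI\<close> and give them
  back in \<open>cohen_macaulay\<close>, \<open>krull_dim_eq_1\<close> and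
  \<open>krull_dim_localization\<close>. In this form they can be transferred to
  \<open>J : J\<close>.\<close>

locale one_dim_ring = cring R + noetherian_ring R for R (structure) +
  assumes one_not_zero: "\<one> \<noteq> \<zero>"
    and maximal_regular: "\<And>M. maximalideal M R \<Longrightarrow> M \<inter> nonzerodivisors R \<noteq> {}"
    and no_prime_chain: "\<And>P0 P1 P2. primeideal P0 R \<Longrightarrow> primeideal P1 R \<Longrightarrow> primeideal P2 R \<Longrightarrow>
      P0 \<subset> P1 \<Longrightarrow> P1 \<subset> P2 \<Longrightarrow> False"
begin

text \<open>A regular element forces a prime strictly below P, so a maximal ideal strictly above P
  would complete a forbidden chain of three primes.\<close>

lemma regular_primeideal_maximal:
  assumes "primeideal P R" "x \<in> P" "x \<in> nonzerodivisors R"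
  shows "maximalideal P R"
proof -
  interpret P: primeideal P R by fact
  obtain M where M: "maximalideal M R" "P \<subseteq> M"
    using ex_maximalideal[OF P.is_ideal] P.I_notcarr by blast
  obtain P0 where "primeideal P0 R" "P0 \<subset> P"
    using ex_smaller_primeideal[OF assms] by blast
  then have "\<not> P \<subset> M"
    using no_prime_chain assms(1) maximalideal_prime[OF M(1)] by blast
  then show ?thesis using M by auto
qed

lemma maximalideal_not_minimal:
  assumes "maximalideal M R"
  shows "\<exists>P. primeideal P R \<and> P \<subset> M"
proof -
  from maximal_regular[OF assms] obtain x where "x \<in> M" "x \<in> nonzerodivisors R" by auto
  then show ?thesis by (rule ex_smaller_primeideal[OF maximalideal_prime[OF assms]])
qed

lemma krull_dim_eq_1: "krull_dim R = 1"
proof (rule antisym)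
  show "krull_dim R \<le> 1" using no_prime_chain by (rule krull_dim_le)
  have "{\<zero>} \<noteq> carrier R" using one_not_zero one_closed by (metis singletonD)
  then obtain M where "maximalideal M R" using ex_maximalideal[OF zeroideal] by blast
  then show "1 \<le> krull_dim R"
    using maximalideal_not_minimal maximalideal_prime krull_dim_ge by metis
qed

text \<open>Contraction keeps chains of primes strict, which bounds the dimension by one. Conversely
  the extensions of M and of a prime strictly below M form a chain of length one.\<close>

lemma krull_dim_localization:
  assumes "maximalideal M R"
  shows "krull_dim (local_ring_at R M) = 1"
proof -
  let ?S = "carrier R - M"
  interpret M: primeideal M R using maximalideal_prime[OF assms] .
  interpret loc: multiplicative_subset R ?S
  proof unfold_locales
    show "?S \<subseteq> carrier R" by blast
    show "\<one> \<in> ?S" using M.I_notcarr M.one_imp_carrier by blast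
    fix s t assume "s \<in> ?S" "t \<in> ?S"
    then show "s \<otimes> t \<in> ?S" using M.I_prime[of s t] by auto
  qed
  show ?thesis
  proof (rule antisym)
    show "krull_dim (local_ring_at R M) \<le> 1"
    proof (rule krull_dim_le)
      fix P0 P1 P2
      assume P: "primeideal P0 (localization R ?S)" "primeideal P1 (localization R ?S)"
        "primeideal P2 (localization R ?S)" and sub: "P0 \<subset> P1" "P1 \<subset> P2"
      show False
        using no_prime_chain[OF loc.contraction_primeideal[OF P(1)] loc.contraction_primeideal[OF P(2)]
          loc.contraction_primeideal[OF P(3)] loc.contraction_strict[OF _ _ sub(1)]
          loc.contraction_strict[OF _ _ sub(2)]] P
        by (blast dest: primeideal.axioms(1))
    qed
    obtain P where P: "primeideal P R" "P \<subset> M" using maximalideal_not_minimal[OF assms] by blast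
    then obtain y where y: "y \<in> M" "y \<notin> P" by blast
    interpret P: primeideal P R by fact
    have disj: "P \<inter> ?S = {}" "M \<inter> ?S = {}" using P by auto
    have pr: "primeideal (loc.extension P) (localization R ?S)"
      "primeideal (loc.extension M) (localization R ?S)"
      using loc.extension_primeideal[OF P(1) disj(1)]
        loc.extension_primeideal[OF M.primeideal disj(2)] .
    have yc: "y \<in> carrier R" using M.Icarr[OF y(1)] .
    have "loc.frac y \<one> \<in> loc.extension M" "loc.frac y \<one> \<notin> loc.extension P"
      using loc.frac_mem_extension[OF P(1) disj(1) yc loc.S_one]
        loc.frac_mem_extension[OF M.primeideal disj(2) yc loc.S_one] y by simp_all
    moreover have "loc.extension P \<subseteq> loc.extension M"
      unfolding loc.extension_def using P(2) by blast
    ultimately have "loc.extension P \<subset> loc.extension M" by blast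
    then show "1 \<le> krull_dim (local_ring_at R M)" using krull_dim_ge pr by blast
  qed
qed

text \<open>Primes containing x are maximal, so this is the Artinian property of R/(x), phrased for
  ideals of R that contain x.\<close>

lemma descending_chain_regular:
  assumes "x \<in> nonzerodivisors R"
    and "\<And>n. ideal (K n) R" "\<And>n. x \<in> K n" "\<And>n. K (Suc n) \<subseteq> K n"
  shows "\<exists>N::nat. \<forall>n \<ge> N. K (Suc n) = K n"
proof (rule descending_chain_condition[OF is_cring noetherian_ring_axioms])
  have x: "x \<in> carrier R" using assms(1) by (simp add: nonzerodivisors_def)
  show "ideal (PIdl x) R" using cgenideal_ideal[OF x] .
  show "maximalideal P R" if "primeideal P R" "PIdl x \<subseteq> P" for P
    using regular_primeideal_maximal[OF that(1) _ assms(1)] that(2) cgenideal_self[OF x] by blast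
  show "PIdl x \<subseteq> K n" for n using cgenideal_minimal assms by blast
qed (use assms in auto)

lemma finite_maximalideals_containing:
  assumes "x \<in> nonzerodivisors R"
  shows "finite {M. maximalideal M R \<and> x \<in> M}"
proof -
  have x: "x \<in> carrier R" using assms(1) by (simp add: nonzerodivisors_def)
  have "finite {M. maximalideal M R \<and> PIdl x \<subseteq> M}"
    using finite_maximalideals_above[OF is_cring noetherian_ring_axioms cgenideal_ideal[OF x]]
      regular_primeideal_maximal[OF _ _ assms] cgenideal_self[OF x] by blast
  moreover have "{M. maximalideal M R \<and> x \<in> M} \<subseteq> {M. maximalideal M R \<and> PIdl x \<subseteq> M}"
    using cgenideal_minimal maximalideal.axioms(1) by blast
  ultimately show ?thesis using finite_subset by blast
qed

text \<open>If \<open>y\<close> is a non-zerodivisor modulo \<open>x\<close>, then the chain \<open>(x, y^n)\<close> becomes stationary, so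
  \<open>y\<close> is a unit modulo \<open>x\<close>: no regular sequence of length two lies in a proper ideal.\<close>

lemma regular_sequence_length:
  assumes "regular_sequence R xs"
  shows "length xs \<le> 1"
proof (rule ccontr)
  assume "\<not> length xs \<le> 1"
  then obtain x y zs where xs: "xs = x # y # zs"
    by (metis One_nat_def Suc_le_eq add_is_1 length_0_conv length_Cons less_Suc0 linorder_not_less list.exhaust zero_le zero_less_one)
  have c: "x \<in> carrier R" "y \<in> carrier R" "set xs \<subseteq> carrier R"
    using assms xs unfolding regular_sequence_def by auto
  have reg: "\<And>i r. i < length xs \<Longrightarrow> r \<in> carrier R \<Longrightarrow>
    xs ! i \<otimes> r \<in> Idl (set (take i xs)) \<Longrightarrow> r \<in> Idl (set (take i xs))"
    using assms unfolding regular_sequence_def by blast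
  \<comment> \<open>The condition at index 0 is relative to the ideal generated by the empty set, so
    it says that x is a non-zerodivisor.\<close>
  have "Idl {} = {\<zero>}" using genideal_minimal[OF zeroideal, of "{}"] genideal_ideal[of "{}"]
      additive_subgroup.zero_closed ideal.axioms(1) by blast
  then have x: "x \<in> nonzerodivisors R"
    using reg[of 0] c unfolding nonzerodivisors_def xs by simp
  let ?X = "PIdl x"
  interpret X: ideal ?X R using cgenideal_ideal[OF c(1)] .
  have regy: "r \<in> ?X" if "r \<in> carrier R" "y \<otimes> r \<in> ?X" for r
    using reg[of 1 r] that cgenideal_eq_genideal[OF c(1)] by (simp add: xs)
  obtain N :: nat and r where r: "r \<in> carrier R" and yN: "y [^] N \<otimes> (\<one> \<ominus> r \<otimes> y) \<in> ?X"
    using stationary_powers[OF X.is_ideal c(2)] descending_chain_regular[OF x]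
      cgenideal_self[OF c(1)] by (metis order_refl subsetD)
  have pow_cancel: "s \<in> ?X" if "s \<in> carrier R" "y [^] (n::nat) \<otimes> s \<in> ?X" for n s
    using that(2)
  proof (induction n)
    case 0
    then show ?case using that(1) by simp
  next
    case (Suc n)
    have "y \<otimes> (y [^] n \<otimes> s) \<in> ?X" using Suc.prems c that(1) by (simp add: m_ac)
    then show ?case using Suc.IH regy[of "y [^] n \<otimes> s"] c that(1) by simp
  qed
  \<comment> \<open>Cancelling y^N modulo x shows that 1 - r y is a multiple of x, so x and y
    together generate the unit ideal.\<close>
  have *: "\<one> \<ominus> r \<otimes> y \<in> ?X"
    by (rule pow_cancel[OF _ yN]) (use c r in simp)
  let ?J = "Idl (set xs)"
  interpret J: ideal ?J R using genideal_ideal[OF c(3)] .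
  have "x \<in> ?J" "y \<in> ?J" using genideal_self[OF c(3)] xs by auto
  then have "(\<one> \<ominus> r \<otimes> y) \<oplus> r \<otimes> y \<in> ?J"
    using subsetD[OF cgenideal_minimal[OF J.is_ideal] *] r by (simp add: J.a_closed J.I_l_closed)
  moreover have "(\<one> \<ominus> r \<otimes> y) \<oplus> r \<otimes> y = \<one>" using c(2) r by algebra
  ultimately have "?J = carrier R" using J.one_imp_carrier by simp
  then show False using assms unfolding regular_sequence_def by simp
qed

lemma depth_maximalideal:
  assumes "maximalideal M R"
  shows "depth R M = 1"
proof (rule antisym)
  show "depth R M \<le> 1"
    unfolding depth_def using regular_sequence_length
    by (intro Sup_least) (auto simp: one_enat_def)
  interpret M: maximalideal M R by fact
  obtain x where x: "x \<in> M" "x \<in> nonzerodivisors R" using maximal_regular[OF assms] by blast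
  have xc: "x \<in> carrier R" using x(1) by (rule M.Icarr)
  have zero: "Idl {} = {\<zero>}" using genideal_minimal[OF zeroideal, of "{}"] genideal_ideal[of "{}"]
      additive_subgroup.zero_closed ideal.axioms(1) by blast
  have "Idl {x} \<subseteq> M" using genideal_minimal[OF M.is_ideal] x(1) by simp
  then have "Idl {x} \<noteq> carrier R" using M.I_notcarr M.a_subset by blast
  then have "regular_sequence R [x]"
    unfolding regular_sequence_def using x(2) zero xc by (simp add: nonzerodivisors_def)
  then have "enat (length [x]) \<le> depth R M"
    unfolding depth_def using x(1) by (intro Sup_upper) (auto intro!: exI[of _ "[x]"])
  then show "1 \<le> depth R M" by (simp add: one_enat_def)
qed

lemma cohen_macaulay: "cohen_macaulay R"
  unfolding cohen_macaulay_def
  using is_cring noetherian_ring_axioms depth_maximalideal krull_dim_localization by simp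

end

text \<open>The zero ring has no primes, and the supremum of the empty set is 0, not 1. The equality
  of depth and dimension at M supplies a regular element of M. Three nested primes would make the
  dimension at least 2.\<close>

lemma one_dim_ringI:
  assumes CM: "cohen_macaulay R" and dim: "krull_dim R = 1"
    and loc: "\<And>M. maximalideal M R \<Longrightarrow> krull_dim (local_ring_at R M) = 1"
  shows "one_dim_ring R"
proof -
  interpret cring R using CM by (simp add: cohen_macaulay_def)
  interpret noetherian_ring R using CM by (simp add: cohen_macaulay_def)
  show ?thesis
  proof unfold_locales
    show "\<one>\<^bsub>R\<^esub> \<noteq> \<zero>\<^bsub>R\<^esub>"
    proof
      assume "\<one>\<^bsub>R\<^esub> = \<zero>\<^bsub>R\<^esub>"
      then have "\<not> primeideal P R" for P
        using primeideal.I_notcarr[of P R] ideal.one_imp_carrier[of P R] additive_subgroup.zero_closed[of P R]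
        by (metis ideal.axioms(1) primeideal.axioms(1))
      then have "{enat n | n. \<exists>P. (\<forall>i \<le> n. primeideal (P i) R) \<and> (\<forall>i < n. P i \<subset> P (Suc i))} = {}"
        by auto
      then have "krull_dim R = Sup {}" unfolding krull_dim_def by (rule arg_cong)
      then show False using dim by (simp add: bot_enat_def)
    qed
    show "M \<inter> nonzerodivisors R \<noteq> {}" if M: "maximalideal M R" for M
    proof -
      have "depth R M = 1" using CM M loc unfolding cohen_macaulay_def by simp
      \<comment> \<open>Positive depth means a nonempty regular sequence in M; its first entry is
        regular modulo the zero ideal.\<close>
      then have "\<not> Sup {enat (length xs) | xs. regular_sequence R xs \<and> set xs \<subseteq> M} \<le> 0"
        unfolding depth_def by simp
      then obtain xs where xs: "regular_sequence R xs" "set xs \<subseteq> M" "\<not> enat (length xs) \<le> 0"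
        using Sup_least[of "{enat (length xs) | xs. regular_sequence R xs \<and> set xs \<subseteq> M}" 0] by auto
      then obtain x ys where x: "xs = x # ys" by (cases xs) (auto simp: zero_enat_def)
      have xc: "x \<in> carrier R" using xs(1) x unfolding regular_sequence_def by simp
      have reg: "r \<in> genideal R {}" if "r \<in> carrier R" "x \<otimes>\<^bsub>R\<^esub> r \<in> genideal R {}" for r
        using xs(1) that unfolding regular_sequence_def x by (auto dest!: spec[of _ 0])
      have "genideal R {} = {\<zero>\<^bsub>R\<^esub>}" using genideal_minimal[OF zeroideal, of "{}"] genideal_ideal[of "{}"]
          additive_subgroup.zero_closed ideal.axioms(1) by blast
      then have "x \<in> nonzerodivisors R" unfolding nonzerodivisors_def using xc reg by simp
      then show ?thesis using xs(2) x by auto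
    qed
    fix P0 P1 P2
    assume P: "primeideal P0 R" "primeideal P1 R" "primeideal P2 R" "P0 \<subset> P1" "P1 \<subset> P2"
    let ?P = "\<lambda>i::nat. if i = 0 then P0 else if i = 1 then P1 else P2"
    have "(\<forall>i \<le> 2. primeideal (?P i) R) \<and> (\<forall>i < 2. ?P i \<subset> ?P (Suc i))"
      using P by (auto simp: less_2_cases_iff)
    then have "\<exists>P. (\<forall>i \<le> 2. primeideal (P i) R) \<and> (\<forall>i < 2. P i \<subset> P (Suc i))"
      by (rule exI[of _ ?P])
    then have "enat 2 \<le> krull_dim R"
      unfolding krull_dim_def by (intro Sup_upper CollectI exI[of _ 2] conjI refl)
    then show False using dim by (simp add: one_enat_def)
  qed
qed

section \<open>Ideals of subrings and integral equations\<close>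

context cring
begin

lemma sub_cring: "subcring A R \<Longrightarrow> cring (sub_ring R A)"
  using subcring_iff[OF subcringE(1)] by blast

text \<open>All rings of the tower share the operations of Q, so their ideals can be handled inside
  Q. Closure under negation comes from multiplication by -1.\<close>

lemma ideal_sub_ring_iff:
  assumes A: "subcring A R"
  shows "ideal J (sub_ring R A) \<longleftrightarrow> J \<subseteq> A \<and> \<zero> \<in> J \<and>
    (\<forall>x \<in> J. \<forall>y \<in> J. x \<oplus> y \<in> J) \<and> (\<forall>r \<in> A. \<forall>x \<in> J. r \<otimes> x \<in> J)"
proof
  assume "ideal J (sub_ring R A)"
  then interpret J: ideal J "sub_ring R A" .
  show "J \<subseteq> A \<and> \<zero> \<in> J \<and> (\<forall>x \<in> J. \<forall>y \<in> J. x \<oplus> y \<in> J) \<and> (\<forall>r \<in> A. \<forall>x \<in> J. r \<otimes> x \<in> J)"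
    using J.a_subset additive_subgroup.zero_closed[OF J.additive_subgroup_axioms]
      additive_subgroup.a_closed[OF J.additive_subgroup_axioms] J.I_l_closed by auto
next
  interpret S: cring "sub_ring R A" using sub_cring[OF A] .
  assume J: "J \<subseteq> A \<and> \<zero> \<in> J \<and>
    (\<forall>x \<in> J. \<forall>y \<in> J. x \<oplus> y \<in> J) \<and> (\<forall>r \<in> A. \<forall>x \<in> J. r \<otimes> x \<in> J)"
  have l: "x \<otimes>\<^bsub>sub_ring R A\<^esub> a \<in> J" if "a \<in> J" "x \<in> carrier (sub_ring R A)" for a x
    using J that by simp
  show "ideal J (sub_ring R A)"
  proof (rule idealI[OF S.ring_axioms _ l])
    show "subgroup J (add_monoid (sub_ring R A))"
    proof (rule S.add.subgroupI)
      fix x assume x: "x \<in> J"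
      have "\<ominus>\<^bsub>sub_ring R A\<^esub> x = (\<ominus>\<^bsub>sub_ring R A\<^esub> \<one>\<^bsub>sub_ring R A\<^esub>) \<otimes>\<^bsub>sub_ring R A\<^esub> x"
        using x J S.l_minus[OF S.one_closed, of x] S.l_one[of x] by auto
      then show "\<ominus>\<^bsub>sub_ring R A\<^esub> x \<in> J"
        using l[OF x, of "\<ominus>\<^bsub>sub_ring R A\<^esub> \<one>\<^bsub>sub_ring R A\<^esub>"] S.a_inv_closed[OF S.one_closed] by simp
    qed (use J in auto)
    show "a \<otimes>\<^bsub>sub_ring R A\<^esub> x \<in> J" if "a \<in> J" "x \<in> carrier (sub_ring R A)" for a x
      using l[OF that] S.m_comm[of a x] that J by auto
  qed
qed

lemma finsum_subset_closed:
  assumes "A \<subseteq> carrier R" "\<zero> \<in> A" "\<And>x y. x \<in> A \<Longrightarrow> y \<in> A \<Longrightarrow> x \<oplus> y \<in> A"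
    and "\<And>i. i \<in> I \<Longrightarrow> f i \<in> A"
  shows "(\<Oplus>i \<in> I. f i) \<in> A"
proof (cases "finite I")
  case True
  then show ?thesis using assms(4)
  proof (induction I rule: finite_induct)
    case empty
    then show ?case using assms(2) by simp
  next
    case (insert i I)
    have "f \<in> I \<rightarrow> carrier R" "f i \<in> carrier R" using insert.prems assms(1) by auto
    then show ?case using insert assms(3) by simp
  qed
next
  case False
  then show ?thesis using assms(2) by (simp add: finsum_infinite)
qed

text \<open>The definition of \<open>finsum\<close> refers to the carrier, so the sums in a subring
  and in the whole ring have to be compared by induction.\<close>

lemma finsum_sub_ring:
  assumes A: "subcring A R" and f: "\<And>i. i \<in> I \<Longrightarrow> f i \<in> A"
  shows "(\<Oplus>\<^bsub>sub_ring R A\<^esub>i \<in> I. f i) = (\<Oplus>i \<in> I. f i)"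
proof (cases "finite I")
  interpret S: cring "sub_ring R A" using sub_cring[OF A] .
  case True
  then show ?thesis using f
  proof (induction I rule: finite_induct)
    case empty
    show ?case using S.finsum_empty[of f] finsum_empty[of f] by simp
  next
    case (insert i I)
    have 1: "f \<in> I \<rightarrow> carrier R" "f i \<in> carrier R" using insert.prems subcringE(1)[OF A] by auto
    have 2: "f \<in> I \<rightarrow> carrier (sub_ring R A)" "f i \<in> carrier (sub_ring R A)" using insert.prems by auto
    show ?case
      using S.finsum_insert[OF insert.hyps 2] finsum_insert[OF insert.hyps 1] insert.IH insert.prems by simp
  qed
next
  interpret S: cring "sub_ring R A" using sub_cring[OF A] .
  case False
  then show ?thesis using S.finsum_infinite[OF False] finsum_infinite[OF False] by simp
qed

lemma integral_equation_sub_ring: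
  assumes A: "subcring A R" and x: "x \<in> A" and F: "\<And>i. i \<ge> 1 \<Longrightarrow> F i \<subseteq> A"
  shows "integral_equation (sub_ring R A) F x \<longleftrightarrow> integral_equation R F x"
proof -
  have pow: "x [^]\<^bsub>sub_ring R A\<^esub> (n::nat) = x [^] n" for n
    using nat_pow_consistent[of x n A] by simp
  have powA: "x [^] (n::nat) \<in> A" for n
    by (induction n) (use x subcringE(3,6)[OF A] in simp_all)
  have "(\<Oplus>\<^bsub>sub_ring R A\<^esub>i \<in> {1..n}. a i \<otimes> x [^] (n - i)) = (\<Oplus>i \<in> {1..n}. a i \<otimes> x [^] (n - i))"
    if "\<forall>i \<in> {1..n}. a i \<in> F i" for a and n :: nat
  proof (rule finsum_sub_ring[OF A])
    fix i assume "i \<in> {1..n}"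
    then have "a i \<in> A" using that F[of i] by auto
    then show "a i \<otimes> x [^] (n - i) \<in> A" using powA subcringE(6)[OF A] by simp
  qed
  then show ?thesis unfolding integral_equation_def pow by (auto cong: conj_cong)
qed

text \<open>Multiply the equation of degree n by c^n and distribute: c^n a_i x^(n-i) = (c^i a_i) (c
  x)^(n-i). This one computation drives every comparison of integral closures below, with c equal to
  a, \<open>inv a\<close> or 1.\<close>

lemma integral_equation_scale:
  assumes eq: "integral_equation R F x" and c: "x \<in> carrier R" "c \<in> carrier R"
    and F: "\<And>i. i \<ge> 1 \<Longrightarrow> F i \<subseteq> carrier R"
    and G: "\<And>i y. i \<ge> 1 \<Longrightarrow> y \<in> F i \<Longrightarrow> c [^] i \<otimes> y \<in> G i"
  shows "integral_equation R G (c \<otimes> x)"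
proof -
  from eq obtain n a where n: "n \<ge> (1::nat)" and a: "\<forall>i \<in> {1..n}. a i \<in> F i"
    and 0: "x [^] n \<oplus> (\<Oplus>i \<in> {1..n}. a i \<otimes> x [^] (n - i)) = \<zero>"
    unfolding integral_equation_def by (elim exE conjE)
  have ac: "a i \<in> carrier R" if "i \<in> {1..n}" for i
    using a F[of i] that by auto
  have "(\<Oplus>i \<in> {1..n}. (c [^] i \<otimes> a i) \<otimes> (c \<otimes> x) [^] (n - i))
    = (\<Oplus>i \<in> {1..n}. c [^] n \<otimes> (a i \<otimes> x [^] (n - i)))"
  proof (rule finsum_cong')
    fix i assume i: "i \<in> {1..n}"
    have "c [^] n = c [^] i \<otimes> c [^] (n - i)" using i c by (simp add: nat_pow_mult)
    then show "(c [^] i \<otimes> a i) \<otimes> (c \<otimes> x) [^] (n - i) = c [^] n \<otimes> (a i \<otimes> x [^] (n - i))"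
      using ac[OF i] c by (simp add: nat_pow_distrib m_ac)
  qed (use ac c in auto)
  also have "\<dots> = c [^] n \<otimes> (\<Oplus>i \<in> {1..n}. a i \<otimes> x [^] (n - i))"
    by (rule finsum_rdistr[symmetric]) (use ac c in auto)
  finally have sum: "(\<Oplus>i \<in> {1..n}. (c [^] i \<otimes> a i) \<otimes> (c \<otimes> x) [^] (n - i))
    = c [^] n \<otimes> (\<Oplus>i \<in> {1..n}. a i \<otimes> x [^] (n - i))" .
  have sc: "(\<Oplus>i \<in> {1..n}. a i \<otimes> x [^] (n - i)) \<in> carrier R"
    by (rule finsum_closed) (use ac c in auto)
  have "(c \<otimes> x) [^] n \<oplus> (\<Oplus>i \<in> {1..n}. (c [^] i \<otimes> a i) \<otimes> (c \<otimes> x) [^] (n - i))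
    = c [^] n \<otimes> (x [^] n \<oplus> (\<Oplus>i \<in> {1..n}. a i \<otimes> x [^] (n - i)))"
    unfolding sum using c sc by (simp add: nat_pow_distrib r_distr)
  also have "\<dots> = \<zero>" unfolding 0 using c by simp
  finally have "(c \<otimes> x) [^] n \<oplus> (\<Oplus>i \<in> {1..n}. (c [^] i \<otimes> a i) \<otimes> (c \<otimes> x) [^] (n - i)) = \<zero>" .
  moreover have "\<forall>i \<in> {1..n}. c [^] i \<otimes> a i \<in> G i" using a G by simp
  ultimately show ?thesis
    unfolding integral_equation_def using n by (intro exI[of _ n] exI[of _ "\<lambda>i. c [^] i \<otimes> a i"]) simp
qed

text \<open>Solving the equation for x^n leaves a sum of elements of \<open>J\<close>. This serves
  to show that a radical is integrally closed and that the generator of a regular closed ideal is a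
  unit of Q.\<close>

lemma integral_equation_pow_mem:
  assumes A: "subcring A R" and J: "ideal J (sub_ring R A)" and x: "x \<in> A"
    and eq: "integral_equation R F x" and F: "\<And>i. i \<ge> 1 \<Longrightarrow> F i \<subseteq> J"
  shows "\<exists>n \<ge> 1. x [^] (n::nat) \<in> J"
proof -
  from eq obtain n a where n: "n \<ge> (1::nat)" and a: "\<forall>i \<in> {1..n}. a i \<in> F i"
    and 0: "x [^] n \<oplus> (\<Oplus>i \<in> {1..n}. a i \<otimes> x [^] (n - i)) = \<zero>"
    unfolding integral_equation_def by (elim exE conjE)
  have J': "J \<subseteq> A" "\<zero> \<in> J" "\<And>x y. x \<in> J \<Longrightarrow> y \<in> J \<Longrightarrow> x \<oplus> y \<in> J" "\<And>r x. r \<in> A \<Longrightarrow> x \<in> J \<Longrightarrow> r \<otimes> x \<in> J"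
    using J unfolding ideal_sub_ring_iff[OF A] by auto
  have Ac: "A \<subseteq> carrier R" using subcringE(1)[OF A] .
  then have Jc: "J \<subseteq> carrier R" using J'(1) by auto
  have powA: "x [^] (n::nat) \<in> A" for n
    by (induction n) (use x subcringE(3,6)[OF A] in simp_all)
  let ?s = "\<Oplus>i \<in> {1..n}. a i \<otimes> x [^] (n - i)"
  have s: "?s \<in> J"
  proof (rule finsum_subset_closed[OF Jc J'(2,3)])
    fix i assume "i \<in> {1..n}"
    then have "a i \<in> J" using a F[of i] by auto
    then have "x [^] (n - i) \<otimes> a i \<in> J" "a i \<in> carrier R" using J'(4)[OF powA] Jc by auto
    moreover have "x [^] (n - i) \<in> carrier R" using powA Ac by auto
    ultimately show "a i \<otimes> x [^] (n - i) \<in> J" by (simp add: m_comm)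
  qed
  have xc: "x [^] n \<in> carrier R" using powA Ac by auto
  have sc: "?s \<in> carrier R" using s Jc by auto
  have "x [^] n = \<ominus> ?s" using sum_zero_eq_neg[OF xc sc 0] .
  also have "\<dots> = (\<ominus> \<one>) \<otimes> ?s" using sc by (simp add: l_minus)
  also have "\<dots> \<in> J" using J'(4)[OF _ s] subcringE(3,5)[OF A] by simp
  finally show ?thesis using n by auto
qed

section \<open>Ideal powers and integral closures of ideals in subrings\<close>

abbreviation ideal_pow :: "'a set \<Rightarrow> 'a set \<Rightarrow> nat \<Rightarrow> 'a set"
  where "ideal_pow A J i \<equiv> J [^]\<^bsub>ideals_set (sub_ring R A)\<^esub> i"

lemma ideal_prod_sub_ring: "ideal_prod (sub_ring R A) I J = ideal_prod R I J"
proof (intro equalityI subsetI)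
  fix x assume "x \<in> ideal_prod (sub_ring R A) I J"
  then show "x \<in> ideal_prod R I J"
    by (induction rule: ideal_prod.induct) (auto intro: ideal_prod.intros)
next
  fix x assume "x \<in> ideal_prod R I J"
  then show "x \<in> ideal_prod (sub_ring R A) I J"
  proof (induction rule: ideal_prod.induct)
    case (prod i j)
    then show ?case using ideal_prod.prod[of i I j J "sub_ring R A"] by simp
  next
    case (sum s t)
    then show ?case using ideal_prod.sum[of s "sub_ring R A" I J t] by simp
  qed
qed

lemma ideal_pow_0: "ideal_pow A J 0 = A"
  by (simp add: ideals_set_def)

lemma ideal_pow_Suc: "ideal_pow A J (Suc i) = ideal_prod R (ideal_pow A J i) J"
  using ideal_prod_sub_ring[of A] by (simp add: ideals_set_def)

context
  fixes A assumes A: "subcring A R"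
begin

lemma ideal_pow_ideal:
  assumes "ideal J (sub_ring R A)"
  shows "ideal (ideal_pow A J i) (sub_ring R A)"
proof (induction i)
  interpret S: cring "sub_ring R A" using sub_cring[OF A] .
  case 0
  then show ?case using S.oneideal unfolding ideal_pow_0 by simp
next
  interpret S: cring "sub_ring R A" using sub_cring[OF A] .
  case (Suc i)
  show ?case
    using S.ideal_prod_is_ideal[OF Suc assms] unfolding ideal_pow_Suc ideal_prod_sub_ring .
qed

lemma ideal_pow_1:
  assumes "ideal J (sub_ring R A)"
  shows "ideal_pow A J (Suc 0) = J"
proof -
  interpret S: cring "sub_ring R A" using sub_cring[OF A] .
  interpret M: comm_monoid "ideals_set (sub_ring R A)" by (rule S.ideals_set_is_comm_monoid)
  have "J \<in> carrier (ideals_set (sub_ring R A))" using assms by (simp add: ideals_set_def)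
  then show ?thesis by simp
qed

lemma ideal_pow_subset:
  assumes "ideal J (sub_ring R A)" "i \<ge> 1"
  shows "ideal_pow A J i \<subseteq> J"
proof -
  interpret S: cring "sub_ring R A" using sub_cring[OF A] .
  from assms(2) obtain k where i: "i = Suc k" by (cases i) auto
  show ?thesis
    using S.ideal_prod_inter[OF ideal_pow_ideal[OF assms(1), of k] assms(1)]
    unfolding i ideal_pow_Suc ideal_prod_sub_ring by simp
qed

lemma ideal_pow_carrier:
  assumes "ideal J (sub_ring R A)"
  shows "ideal_pow A J i \<subseteq> A" "ideal_pow A J i \<subseteq> carrier R"
  using ideal_pow_ideal[OF assms, of i] subcringE(1)[OF A] unfolding ideal_sub_ring_iff[OF A] by auto

lemma ideal_closure_iff:
  assumes "ideal J (sub_ring R A)"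
  shows "x \<in> ideal_closure (sub_ring R A) J \<longleftrightarrow> x \<in> A \<and> integral_equation R (ideal_pow A J) x"
  unfolding ideal_closure_def
  using integral_equation_sub_ring[OF A, of x "ideal_pow A J"] ideal_pow_carrier[OF assms] by auto

text \<open>An equation of degree one suffices: x + (-x) = 0, with -x in the first power of
  \<open>J\<close>.\<close>

lemma ideal_subset_closure:
  assumes J: "ideal J (sub_ring R A)"
  shows "J \<subseteq> ideal_closure (sub_ring R A) J"
proof
  fix x assume x: "x \<in> J"
  have *: "J \<subseteq> A" "\<And>r x. r \<in> A \<Longrightarrow> x \<in> J \<Longrightarrow> r \<otimes> x \<in> J"
    using J unfolding ideal_sub_ring_iff[OF A] by auto
  have xc: "x \<in> carrier R" using * x subcringE(1)[OF A] by auto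
  have "\<ominus> x = \<ominus> \<one> \<otimes> x" using xc by (simp add: l_minus)
  then have "\<ominus> x \<in> J" using *(2)[of "\<ominus> \<one>" x] subcringE(3,5)[OF A] x by simp
  moreover have "x [^] (1::nat) \<oplus> (\<Oplus>i \<in> {1..1::nat}. (\<ominus> x) \<otimes> x [^] (1 - i)) = \<zero>"
    using xc by (simp add: r_neg)
  moreover have "\<ominus> x \<in> ideal_pow A J i" if "i \<in> {1..1}" for i
    using that \<open>\<ominus> x \<in> J\<close> ideal_pow_1[OF J] by (metis One_nat_def atLeastAtMost_singleton singletonD)
  ultimately have "integral_equation R (ideal_pow A J) x"
    unfolding integral_equation_def
    by (intro exI[of _ "1::nat"] exI[of _ "\<lambda>_. \<ominus> x"] conjI ballI) simp_all
  then show "x \<in> ideal_closure (sub_ring R A) J"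
    unfolding ideal_closure_iff[OF J] using x * by auto
qed

end

text \<open>Products of i factors pick up one c per factor. The exponent 0 is excluded because the
  power is then the ring itself, and \<open>A\<close> need not lie in \<open>B\<close>.\<close>

lemma ideal_pow_scale:
  assumes A: "subcring A R" and B: "subcring B R" and J: "ideal J (sub_ring R A)" and K: "ideal K (sub_ring R B)"
    and c: "c \<in> carrier R" "\<And>x. x \<in> J \<Longrightarrow> c \<otimes> x \<in> K"
    and i: "i \<ge> 1" and x: "x \<in> ideal_pow A J i"
  shows "c [^] i \<otimes> x \<in> ideal_pow B K i"
  using i x
proof (induction i arbitrary: x rule: dec_induct)
  case base
  then have "x \<in> J" using ideal_pow_1[OF A J] by (metis One_nat_def)
  then have "c \<otimes> x \<in> ideal_pow B K 1" using c(2) ideal_pow_1[OF B K] by (metis One_nat_def)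
  then show ?case using c(1) by (metis l_one nat_pow_0 nat_pow_Suc One_nat_def)
next
  case (step i)
  from step.prems show ?case unfolding ideal_pow_Suc
  proof (induction rule: ideal_prod.induct)
    case (prod u v)
    have uv: "u \<in> carrier R" "v \<in> carrier R"
      using prod ideal_pow_carrier(2)[OF A J] J subcringE(1)[OF A] unfolding ideal_sub_ring_iff[OF A] by auto
    have "c [^] Suc i \<otimes> (u \<otimes> v) = (c [^] i \<otimes> u) \<otimes> (c \<otimes> v)"
      using uv c by (simp add: m_ac)
    also have "\<dots> \<in> ideal_prod R (ideal_pow B K i) K"
      using step.IH[OF prod(1)] c(2)[OF prod(2)] by (rule ideal_prod.prod)
    finally show ?case .
  next
    case (sum s t)
    have st: "s \<in> carrier R" "t \<in> carrier R"
      using sum(1,2) ideal_pow_carrier(2)[OF A J, of "Suc i"] unfolding ideal_pow_Suc by auto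
    have "c [^] Suc i \<otimes> (s \<oplus> t) = c [^] Suc i \<otimes> s \<oplus> c [^] Suc i \<otimes> t"
      using st c by (simp add: r_distr)
    then show ?case using ideal_prod.sum[OF sum(3,4)] by simp
  qed
qed

text \<open>The scaled equation has its i-th coefficient in the i-th power of \<open>K\<close>. That
  \<open>c \<otimes> x\<close> lies in \<open>B\<close> is assumed separately, because c is an
  element of the big ring only and may be a fraction such as \<open>inv a\<close>.\<close>

lemma ideal_closure_scale:
  assumes A: "subcring A R" and B: "subcring B R"
    and J: "ideal J (sub_ring R A)" and K: "ideal K (sub_ring R B)"
    and c: "c \<in> carrier R" "\<And>x. x \<in> J \<Longrightarrow> c \<otimes> x \<in> K"
    and x: "x \<in> ideal_closure (sub_ring R A) J" "c \<otimes> x \<in> B"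
  shows "c \<otimes> x \<in> ideal_closure (sub_ring R B) K"
proof -
  have x': "x \<in> A" "integral_equation R (ideal_pow A J) x"
    using x(1) unfolding ideal_closure_iff[OF A J] by auto
  have "integral_equation R (ideal_pow B K) (c \<otimes> x)"
    by (rule integral_equation_scale[OF x'(2) _ c(1) ideal_pow_carrier(2)[OF A J]
        ideal_pow_scale[OF A B J K c]]) (use x'(1) subcringE(1)[OF A] in auto)
  then show ?thesis unfolding ideal_closure_iff[OF B K] using x(2) by simp
qed

end

section \<open>Integral closure in the total ring of fractions\<close>

lemma (in comm_monoid) unit_cancel:
  assumes "a \<in> Units G" "x \<in> carrier G"
  shows "inv a \<otimes> (a \<otimes> x) = x" "a \<otimes> (inv a \<otimes> x) = x" "a \<otimes> (x \<otimes> inv a) = x"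
    "(a \<otimes> x) \<otimes> inv a = x"
proof -
  have a: "a \<in> carrier G" "inv a \<in> carrier G" using assms by auto
  show 1: "inv a \<otimes> (a \<otimes> x) = x" "a \<otimes> (inv a \<otimes> x) = x"
    using a assms by (simp_all add: m_assoc[symmetric])
  show "a \<otimes> (x \<otimes> inv a) = x" "(a \<otimes> x) \<otimes> inv a = x"
    using 1 a assms m_comm[of x "inv a"] m_comm[of "a \<otimes> x" "inv a"] by simp_all
qed

locale total_fractions = cring Q for Q (structure) +
  fixes A
  assumes total_fractions: "total_ring_of_fractions Q A"
begin

lemma A_subcring: "subcring A Q"
  using total_fractions by (simp add: total_ring_of_fractions_def)

lemmas A_closed = subcringE[OF A_subcring]

lemma A_carrier: "x \<in> A \<Longrightarrow> x \<in> carrier Q"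
  using A_closed(1) by blast

lemma A_pow: "x \<in> A \<Longrightarrow> x [^] (n::nat) \<in> A"
  by (induction n) (simp_all add: A_closed(3,6))

sublocale A: cring "sub_ring Q A"
  using sub_cring[OF A_subcring] .

text \<open>Regularity becomes invertibility in Q, a condition that does not change when
  \<open>A\<close> is replaced by a larger ring of the tower.\<close>

lemma nonzerodivisors_eq: "nonzerodivisors (sub_ring Q A) = A \<inter> Units Q"
proof (intro equalityI subsetI)
  fix x assume "x \<in> nonzerodivisors (sub_ring Q A)"
  then show "x \<in> A \<inter> Units Q"
    using total_fractions unfolding total_ring_of_fractions_def nonzerodivisors_def by auto
next
  fix x assume x: "x \<in> A \<inter> Units Q"
  have "y = \<zero>" if "y \<in> A" "x \<otimes> y = \<zero>" for y
    using unit_cancel(1)[of x y] that x A_carrier by auto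
  then show "x \<in> nonzerodivisors (sub_ring Q A)"
    unfolding nonzerodivisors_def using x by simp
qed

lemma fraction_exists:
  assumes "q \<in> carrier Q"
  obtains u s where "u \<in> A" "s \<in> A" "s \<in> Units Q" "s \<otimes> q = u"
proof -
  from assms obtain u s where us: "u \<in> A" "s \<in> nonzerodivisors (sub_ring Q A)" "q = u \<otimes> inv s"
    using total_fractions unfolding total_ring_of_fractions_def by (elim conjE) (drule (1) bspec, elim bexE)
  then have s: "s \<in> A" "s \<in> Units Q" using nonzerodivisors_eq by auto
  show thesis
    using that[OF us(1) s] unit_cancel(3)[OF s(2) A_carrier[OF us(1)]] us(3) by simp
qed

lemma principal_ideal:
  assumes "a \<in> A"
  shows "ideal (cgenideal (sub_ring Q A) a) (sub_ring Q A)"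
    "x \<in> cgenideal (sub_ring Q A) a \<longleftrightarrow> (\<exists>r \<in> A. x = r \<otimes> a)"
  using A.cgenideal_ideal[of a] assms unfolding cgenideal_def by auto

lemma principal_ideal_pow_mem:
  assumes a: "a \<in> A" and r: "r \<in> A"
  shows "a [^] (i::nat) \<otimes> r \<in> ideal_pow A (cgenideal (sub_ring Q A) a) i"
proof (induction i)
  case 0
  then show ?case unfolding ideal_pow_0 using r A_carrier by simp
next
  case (Suc i)
  have "a \<in> cgenideal (sub_ring Q A) a"
    using A.cgenideal_self[of a] a by simp
  from ideal_prod.prod[OF Suc this, of Q]
  show ?case unfolding ideal_pow_Suc using a r A_carrier by (simp add: m_ac)
qed

lemma principal_ideal_pow_div:
  assumes a: "a \<in> A" and x: "x \<in> ideal_pow A (cgenideal (sub_ring Q A) a) i"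
  shows "\<exists>r \<in> A. x = a [^] (i::nat) \<otimes> r"
  using x
proof (induction i arbitrary: x)
  case 0
  then show ?case unfolding ideal_pow_0 using A_carrier by (intro bexI[of _ x]) simp_all
next
  case (Suc i)
  from Suc.prems show ?case unfolding ideal_pow_Suc
  proof (induction rule: ideal_prod.induct)
    case (prod u v)
    obtain r where r: "r \<in> A" "u = a [^] i \<otimes> r" using Suc.IH[OF prod(1)] by (elim bexE)
    obtain t where t: "t \<in> A" "v = t \<otimes> a" using prod(2) unfolding principal_ideal(2)[OF a] by (elim bexE)
    have "u \<otimes> v = a [^] Suc i \<otimes> (r \<otimes> t)"
      using r t a A_carrier by (simp add: m_ac)
    then show ?case using A_closed(6) r(1) t(1) by (intro bexI[of _ "r \<otimes> t"])
  next
    case (sum s t)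
    from sum(3) obtain u where u: "u \<in> A" "s = a [^] Suc i \<otimes> u" by (elim bexE)
    from sum(4) obtain v where v: "v \<in> A" "t = a [^] Suc i \<otimes> v" by (elim bexE)
    have "s \<oplus> t = a [^] Suc i \<otimes> (u \<oplus> v)"
      using u v a A_carrier by (simp add: r_distr)
    then show ?case using A_closed(7) u(1) v(1) by (intro bexI[of _ "u \<oplus> v"])
  qed
qed

text \<open>The closure of aA is the intersection of \<open>A\<close> with a times the closure of
  \<open>A\<close>: scaling by \<open>inv a\<close> turns a coefficient a^i r into r, and scaling by
  a turns it back.\<close>

lemma principal_ideal_closure:
  assumes a: "a \<in> A" "a \<in> Units Q"
  shows "x \<in> ideal_closure (sub_ring Q A) (cgenideal (sub_ring Q A) a) \<longleftrightarrow>
    x \<in> A \<and> x \<otimes> inv a \<in> ring_closure Q A"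
proof -
  let ?J = "cgenideal (sub_ring Q A) a"
  note J = principal_ideal(1)[OF a(1)]
  have inva: "inv a \<in> carrier Q" using a by simp
  have "integral_equation Q (ideal_pow A ?J) x \<longleftrightarrow> integral_equation Q (\<lambda>_. A) (x \<otimes> inv a)" if x: "x \<in> A"
  proof
    assume *: "integral_equation Q (ideal_pow A ?J) x"
    have "integral_equation Q (\<lambda>_. A) (inv a \<otimes> x)"
    proof (rule integral_equation_scale[OF * A_carrier[OF x] inva ideal_pow_carrier(2)[OF A_subcring J]])
      fix i y assume "y \<in> ideal_pow A ?J i"
      then obtain r where r: "r \<in> A" "y = a [^] i \<otimes> r" using principal_ideal_pow_div[OF a(1)] by blast
      have "inv a [^] i \<otimes> (a [^] i \<otimes> r) = (inv a \<otimes> a) [^] i \<otimes> r"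
        using A_carrier[OF a(1)] inva A_carrier[OF r(1)] by (simp add: nat_pow_distrib m_assoc)
      then show "inv a [^] i \<otimes> y \<in> A" using r a A_carrier by simp
    qed
    then show "integral_equation Q (\<lambda>_. A) (x \<otimes> inv a)"
      using m_comm[OF inva A_carrier[OF x]] by simp
  next
    assume *: "integral_equation Q (\<lambda>_. A) (x \<otimes> inv a)"
    have "integral_equation Q (ideal_pow A ?J) (a \<otimes> (x \<otimes> inv a))"
      by (rule integral_equation_scale[OF *])
        (use a x A_carrier A_closed(1) principal_ideal_pow_mem in auto)
    then show "integral_equation Q (ideal_pow A ?J) x"
      using unit_cancel(3)[OF a(2) A_carrier[OF x]] by simp
  qed
  moreover have "x \<otimes> inv a \<in> carrier Q" if "x \<in> A" using that A_carrier inva by simp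
  ultimately show ?thesis
    unfolding ideal_closure_iff[OF A_subcring J] ring_closure_def by auto
qed

text \<open>A common denominator for the powers of an integral element is \<open>s^n\<close>, where \<open>s x \<in> A\<close> and
  \<open>n\<close> is the degree of the equation.\<close>

lemma ring_closure_denominator:
  assumes "x \<in> ring_closure Q A"
  shows "\<exists>d \<in> A \<inter> Units Q. \<forall>k::nat. d \<otimes> x [^] k \<in> A"
proof -
  from assms have x: "x \<in> carrier Q" and eq: "integral_equation Q (\<lambda>_. A) x"
    unfolding ring_closure_def by auto
  from eq obtain n a where n: "n \<ge> (1::nat)" and a: "\<forall>i \<in> {1..n}. a i \<in> A"
    and 0: "x [^] n \<oplus> (\<Oplus>i \<in> {1..n}. a i \<otimes> x [^] (n - i)) = \<zero>"
    unfolding integral_equation_def by (elim exE conjE)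
  obtain u s where us: "u \<in> A" "s \<in> A" "s \<in> Units Q" "s \<otimes> x = u" using fraction_exists[OF x] .
  have sc: "s \<in> carrier Q" using us A_carrier by simp
  have "s [^] n \<otimes> x [^] k \<in> A" for k :: nat
  proof (induction k rule: less_induct)
    case (less k)
    show ?case
    \<comment> \<open>Up to exponent n, the factor s^n clears x^k directly. Beyond n, the equation
      replaces x^n by lower powers with coefficients in \<open>A\<close>, which are covered by the
      induction hypothesis.\<close>
    proof (cases "k \<le> n")
      case True
      then have "s [^] n = s [^] (n - k) \<otimes> s [^] k" using sc by (simp add: nat_pow_mult)
      then have "s [^] n \<otimes> x [^] k = s [^] (n - k) \<otimes> u [^] k"
        using sc x us(4) by (simp add: m_assoc nat_pow_distrib[symmetric])
      then show ?thesis using A_pow us A_closed(6) by simp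
    next
      case False
      define d where "d = s [^] n \<otimes> x [^] (k - n)"
      have dc: "d \<in> carrier Q" unfolding d_def using sc x by simp
      have ac: "a i \<otimes> x [^] (n - i) \<in> carrier Q" if "i \<in> {1..n}" for i
        using a that A_carrier x by auto
      have ds: "d \<otimes> (\<Oplus>i \<in> {1..n}. a i \<otimes> x [^] (n - i)) \<in> A"
      proof -
        have "d \<otimes> (\<Oplus>i \<in> {1..n}. a i \<otimes> x [^] (n - i)) = (\<Oplus>i \<in> {1..n}. d \<otimes> (a i \<otimes> x [^] (n - i)))"
          by (rule finsum_rdistr) (use dc ac in auto)
        also have "\<dots> \<in> A"
        proof (rule finsum_subset_closed[OF A_closed(1,2,7)])
          fix i assume i: "i \<in> {1..n}"
          have "x [^] (k - n) \<otimes> x [^] (n - i) = x [^] (k - i)"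
            using x False i by (simp add: nat_pow_mult)
          then have "d \<otimes> (a i \<otimes> x [^] (n - i)) = a i \<otimes> (s [^] n \<otimes> x [^] (k - i))"
            unfolding d_def using sc x a i A_carrier by (simp add: m_ac)
          moreover have "s [^] n \<otimes> x [^] (k - i) \<in> A" using less[of "k - i"] i False by simp
          ultimately show "d \<otimes> (a i \<otimes> x [^] (n - i)) \<in> A" using a i A_closed(6) by simp
        qed
        finally show ?thesis .
      qed
      have Sc: "(\<Oplus>i \<in> {1..n}. a i \<otimes> x [^] (n - i)) \<in> carrier Q"
        by (rule finsum_closed) (use ac in auto)
      have "x [^] (k - n) \<otimes> x [^] n = x [^] k" using x False by (simp add: nat_pow_mult)
      then have "s [^] n \<otimes> x [^] k = d \<otimes> x [^] n"
        unfolding d_def using sc x by (simp add: m_assoc)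
      also have "x [^] n = \<ominus> (\<Oplus>i \<in> {1..n}. a i \<otimes> x [^] (n - i))"
        using sum_zero_eq_neg[OF _ Sc 0] x by simp
      also have "d \<otimes> \<ominus> (\<Oplus>i \<in> {1..n}. a i \<otimes> x [^] (n - i)) = \<ominus> (d \<otimes> (\<Oplus>i \<in> {1..n}. a i \<otimes> x [^] (n - i)))"
        using dc Sc by (simp add: r_minus)
      also have "\<dots> \<in> A" using A_closed(5)[OF ds] .
      finally show ?thesis .
    qed
  qed
  moreover have "s [^] n \<in> A \<inter> Units Q" using us A_pow Units_pow_closed by simp
  ultimately show ?thesis by blast
qed

end

locale noetherian_fractions = total_fractions +
  assumes noetherian: "noetherian_ring (sub_ring Q A)"
begin

text \<open>The ideals \<open>d (A + A x + \<dots> + A x^(k - 1))\<close> of \<open>A\<close> form an ascending chain.\<close>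

lemma denominator_ring_closure:
  assumes x: "x \<in> carrier Q" and d: "d \<in> A" "d \<in> Units Q" "\<And>k::nat. d \<otimes> x [^] k \<in> A"
  shows "x \<in> ring_closure Q A"
proof -
  define N where "N k = {(\<Oplus>i \<in> {..<k}. r i \<otimes> (d \<otimes> x [^] i)) | r. \<forall>i. r i \<in> A}" for k :: nat
  have NI: "(\<Oplus>i \<in> {..<k}. r i \<otimes> (d \<otimes> x [^] i)) \<in> N k" if "\<forall>i. r i \<in> A" for k r
    unfolding N_def using that by auto
  have NE: "\<exists>r. (\<forall>i. r i \<in> A) \<and> y = (\<Oplus>i \<in> {..<k}. r i \<otimes> (d \<otimes> x [^] i))" if "y \<in> N k" for k y
    using that unfolding N_def by auto
  have dx: "d \<otimes> x [^] i \<in> carrier Q" for i :: nat using A_carrier[OF d(3)] .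
  have fc: "(\<lambda>i. r i \<otimes> (d \<otimes> x [^] i)) \<in> I \<rightarrow> carrier Q" if "\<forall>i. r i \<in> A" for r and I :: "nat set"
    using that A_carrier dx by auto
  have ideal: "ideal (N k) (sub_ring Q A)" for k
    unfolding ideal_sub_ring_iff[OF A_subcring]
  proof (intro conjI ballI subsetI)
    fix y assume "y \<in> N k"
    from NE[OF this] obtain r where r: "\<forall>i. r i \<in> A" "y = (\<Oplus>i \<in> {..<k}. r i \<otimes> (d \<otimes> x [^] i))" by (elim exE conjE)
    show "y \<in> A" unfolding r(2)
      by (rule finsum_subset_closed[OF A_closed(1,2,7)]) (use r(1) d(3) A_closed(6) in auto)
    {
      fix z assume "z \<in> N k"
      from NE[OF this] obtain t where t: "\<forall>i. t i \<in> A" "z = (\<Oplus>i \<in> {..<k}. t i \<otimes> (d \<otimes> x [^] i))" by (elim exE conjE)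
      have "y \<oplus> z = (\<Oplus>i \<in> {..<k}. r i \<otimes> (d \<otimes> x [^] i) \<oplus> t i \<otimes> (d \<otimes> x [^] i))"
        unfolding r(2) t(2) using finsum_addf[OF fc[OF r(1)] fc[OF t(1)]] by simp
      also have "\<dots> = (\<Oplus>i \<in> {..<k}. (r i \<oplus> t i) \<otimes> (d \<otimes> x [^] i))"
        by (rule finsum_cong') (use r t A_carrier dx in \<open>auto simp: l_distr\<close>)
      finally show "y \<oplus> z \<in> N k" using NI[of "\<lambda>i. r i \<oplus> t i" k] r(1) t(1) A_closed(7) by simp
    }
    fix b assume b: "b \<in> A"
    have "b \<otimes> y = (\<Oplus>i \<in> {..<k}. b \<otimes> (r i \<otimes> (d \<otimes> x [^] i)))"
      unfolding r(2) by (rule finsum_rdistr) (use fc[OF r(1)] A_carrier[OF b] in auto)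
    also have "\<dots> = (\<Oplus>i \<in> {..<k}. (b \<otimes> r i) \<otimes> (d \<otimes> x [^] i))"
      by (rule finsum_cong') (use r(1) A_carrier b dx in \<open>auto simp: m_assoc\<close>)
    finally show "b \<otimes> y \<in> N k" using NI[of "\<lambda>i. b \<otimes> r i" k] r(1) b A_closed(6) by simp
  next
    have "(\<Oplus>i \<in> {..<k}. \<zero> \<otimes> (d \<otimes> x [^] i)) = (\<Oplus>i \<in> {..<k}. \<zero>)"
      by (rule finsum_cong') (use dx in auto)
    then show "\<zero> \<in> N k" using NI[of "\<lambda>_. \<zero>" k] A_closed(2) by (simp add: finsum_zero)
  qed
  have step: "N k \<subseteq> N (Suc k)" for k
  proof
    fix y assume "y \<in> N k"
    from NE[OF this] obtain r where r: "\<forall>i. r i \<in> A" "y = (\<Oplus>i \<in> {..<k}. r i \<otimes> (d \<otimes> x [^] i))" by (elim exE conjE)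
    let ?r = "\<lambda>i. if i < k then r i else \<zero>"
    have rA: "\<forall>i. ?r i \<in> A" using r(1) A_closed(2) by simp
    have "(\<Oplus>i \<in> {..<Suc k}. ?r i \<otimes> (d \<otimes> x [^] i)) = ?r k \<otimes> (d \<otimes> x [^] k) \<oplus> (\<Oplus>i \<in> {..<k}. ?r i \<otimes> (d \<otimes> x [^] i))"
      unfolding lessThan_Suc using fc[OF rA] A_carrier dx by (subst finsum_insert) auto
    also have "(\<Oplus>i \<in> {..<k}. ?r i \<otimes> (d \<otimes> x [^] i)) = y"
      unfolding r(2) by (rule finsum_cong') (use fc[OF r(1)] in auto)
    also have "?r k \<otimes> (d \<otimes> x [^] k) \<oplus> y = y"
      using dx \<open>y \<in> N k\<close> ideal[of k] A_carrier unfolding ideal_sub_ring_iff[OF A_subcring] by auto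
    finally show "y \<in> N (Suc k)" using NI[OF rA, of "Suc k"] by simp
  qed
  have mono: "N k \<subseteq> N l" if "k \<le> l" for k l using lift_Suc_mono_le[of N] step that by blast
  have "\<Union>(range N) \<in> range N"
  proof (rule noetherian_ring.ideal_chain_is_trivial[OF noetherian])
    show "subset.chain {I. ideal I (sub_ring Q A)} (range N)"
      unfolding subset_chain_def using ideal mono by (auto, metis nle_le subsetD)
  qed simp
  then obtain k where k: "\<Union>(range N) = N k" by auto
  have top: "N l \<subseteq> N (Suc k)" for l using k step[of k] by blast
  \<comment> \<open>The chain stops at k, which may be 0; passing to the successor makes the degree
    of the equation positive.\<close>
  define n where "n = Suc k"
  have "d \<otimes> x [^] n \<in> N (Suc n)"
  proof -
    let ?r = "\<lambda>i. if i = n then \<one> else \<zero>"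
    have rA: "\<forall>i. ?r i \<in> A" using A_closed(2,3) by simp
    have "(\<Oplus>i \<in> {..<Suc n}. ?r i \<otimes> (d \<otimes> x [^] i)) = ?r n \<otimes> (d \<otimes> x [^] n) \<oplus> (\<Oplus>i \<in> {..<n}. ?r i \<otimes> (d \<otimes> x [^] i))"
      unfolding lessThan_Suc using fc[OF rA] A_carrier dx by (subst finsum_insert) auto
    also have "(\<Oplus>i \<in> {..<n}. ?r i \<otimes> (d \<otimes> x [^] i)) = (\<Oplus>i \<in> {..<n}. \<zero>)"
      by (rule finsum_cong') (use dx in auto)
    finally show ?thesis using NI[OF rA, of "Suc n"] dx by (simp add: finsum_zero)
  qed
  then have "d \<otimes> x [^] n \<in> N n" using top n_def by auto
  from NE[OF this] obtain r where r: "\<forall>i. r i \<in> A"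
    and eq: "d \<otimes> x [^] n = (\<Oplus>i \<in> {..<n}. r i \<otimes> (d \<otimes> x [^] i))" by (elim exE conjE)
  have rc: "r i \<in> carrier Q" for i using r A_carrier by simp
  have dc: "d \<in> carrier Q" "inv d \<in> carrier Q" using d A_carrier by simp_all
  have "(\<Oplus>i \<in> {..<n}. r i \<otimes> (d \<otimes> x [^] i)) = (\<Oplus>i \<in> {..<n}. d \<otimes> (r i \<otimes> x [^] i))"
    by (rule finsum_cong') (use rc dc x in \<open>auto simp: m_ac\<close>)
  also have "\<dots> = d \<otimes> (\<Oplus>i \<in> {..<n}. r i \<otimes> x [^] i)"
    by (rule finsum_rdistr[symmetric]) (use rc dc x in auto)
  finally have "inv d \<otimes> (d \<otimes> x [^] n) = inv d \<otimes> (d \<otimes> (\<Oplus>i \<in> {..<n}. r i \<otimes> x [^] i))"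
    using eq by simp
  moreover have sc: "(\<Oplus>i \<in> {..<n}. r i \<otimes> x [^] i) \<in> carrier Q"
    by (rule finsum_closed) (use rc x in auto)
  ultimately have xn: "x [^] n = (\<Oplus>i \<in> {..<n}. r i \<otimes> x [^] i)"
    using unit_cancel(1)[OF d(2)] x by simp
  \<comment> \<open>After cancelling d, the relation for x^n is brought into the form of
    \<open>integral_equation\<close> by the substitution j = n - i and a change of sign.\<close>
  have "(\<Oplus>j \<in> {1..n}. \<ominus> r (n - j) \<otimes> x [^] (n - j)) = (\<Oplus>i \<in> {..<n}. \<ominus> \<one> \<otimes> (r i \<otimes> x [^] i))"
  proof -
    have img: "(\<lambda>i. n - i) ` {..<n} = {1..n}"
    proof (intro equalityI subsetI)
      fix j assume "j \<in> {1..n}"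
      then show "j \<in> (\<lambda>i. n - i) ` {..<n}" by (intro image_eqI[of _ _ "n - j"]) auto
    qed auto
    have "(\<Oplus>j \<in> (\<lambda>i. n - i) ` {..<n}. \<ominus> r (n - j) \<otimes> x [^] (n - j))
      = (\<Oplus>i \<in> {..<n}. \<ominus> r (n - (n - i)) \<otimes> x [^] (n - (n - i)))"
      by (rule finsum_reindex) (use rc x in \<open>auto simp: inj_on_def\<close>)
    also have "\<dots> = (\<Oplus>i \<in> {..<n}. \<ominus> \<one> \<otimes> (r i \<otimes> x [^] i))"
      by (rule finsum_cong') (use rc x in \<open>auto simp: l_minus\<close>)
    finally show ?thesis unfolding img .
  qed
  also have "\<dots> = \<ominus> \<one> \<otimes> x [^] n"
    unfolding xn by (rule finsum_rdistr[symmetric]) (use rc x in auto)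
  finally have "x [^] n \<oplus> (\<Oplus>j \<in> {1..n}. \<ominus> r (n - j) \<otimes> x [^] (n - j)) = \<zero>"
    using x by (simp add: l_minus r_neg)
  moreover have "n \<ge> 1" unfolding n_def by simp
  moreover have "\<forall>j \<in> {1..n}. \<ominus> r (n - j) \<in> A" using r A_closed(5) by simp
  ultimately have "integral_equation Q (\<lambda>_. A) x"
    unfolding integral_equation_def by (intro exI[of _ n] exI[of _ "\<lambda>j. \<ominus> r (n - j)"] conjI)
  then show ?thesis unfolding ring_closure_def using x by simp
qed

text \<open>The working description of integrality over a Noetherian ring: products and changes of
  the base ring only require a new denominator.\<close>

lemma ring_closure_iff:
  "x \<in> ring_closure Q A \<longleftrightarrow> x \<in> carrier Q \<and> (\<exists>d \<in> A \<inter> Units Q. \<forall>k::nat. d \<otimes> x [^] k \<in> A)"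
  using ring_closure_denominator[of x] denominator_ring_closure[of x]
  unfolding ring_closure_def by blast

lemma ring_closure_carrier: "x \<in> ring_closure Q A \<Longrightarrow> x \<in> carrier Q"
  unfolding ring_closure_def by simp

lemma subset_ring_closure: "A \<subseteq> ring_closure Q A"
proof
  fix x assume x: "x \<in> A"
  show "x \<in> ring_closure Q A"
    by (rule denominator_ring_closure[of x \<one>]) (use x A_carrier A_pow A_closed(3) in auto)
qed

text \<open>If d clears all powers of x and e all powers of y, then d e clears all powers of x
  y.\<close>

lemma ring_closure_mult:
  assumes x: "x \<in> ring_closure Q A" and y: "y \<in> ring_closure Q A"
  shows "x \<otimes> y \<in> ring_closure Q A"
proof -
  obtain d where d: "d \<in> A \<inter> Units Q" "\<forall>k::nat. d \<otimes> x [^] k \<in> A"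
    using ring_closure_denominator[OF x] by (elim bexE)
  obtain e where e: "e \<in> A \<inter> Units Q" "\<forall>k::nat. e \<otimes> y [^] k \<in> A"
    using ring_closure_denominator[OF y] by (elim bexE)
  note c = ring_closure_carrier[OF x] ring_closure_carrier[OF y]
  show ?thesis
  proof (rule denominator_ring_closure[of _ "d \<otimes> e"])
    fix k :: nat
    have "(d \<otimes> e) \<otimes> (x \<otimes> y) [^] k = (d \<otimes> x [^] k) \<otimes> (e \<otimes> y [^] k)"
      using c d(1) e(1) A_carrier by (simp add: nat_pow_distrib m_ac)
    then show "(d \<otimes> e) \<otimes> (x \<otimes> y) [^] k \<in> A" using d e A_closed(6) by simp
  qed (use c d e A_closed(6) in auto)
qed

end

section \<open>The ring \<open>J : J\<close>\<close>

lemma (in comm_monoid) unit_quotient_cancel: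
  assumes "a \<in> Units G" "c \<in> Units G" "x \<in> carrier G"
  shows "(a \<otimes> x) \<otimes> inv (a \<otimes> c) = x \<otimes> inv c"
proof -
  have ac: "a \<in> carrier G" "c \<in> carrier G" "inv a \<in> carrier G" "inv c \<in> carrier G"
    using assms by auto
  have "(a \<otimes> c) \<otimes> (inv c \<otimes> inv a) = (a \<otimes> (c \<otimes> inv c)) \<otimes> inv a"
    using ac by (simp add: m_assoc del: Units_r_inv)
  also have "\<dots> = \<one>" using assms ac by simp
  finally have "inv (a \<otimes> c) = inv c \<otimes> inv a"
    using ac by (intro comm_inv_char) simp_all
  then have "(a \<otimes> x) \<otimes> inv (a \<otimes> c) = (a \<otimes> (x \<otimes> inv c)) \<otimes> inv a"
    using ac assms(3) by (simp add: m_assoc)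
  then show ?thesis using unit_cancel(4)[OF assms(1)] ac assms(3) by simp
qed

lemma (in cring) one_minus_plus: "x \<in> carrier R \<Longrightarrow> (\<one> \<ominus> x) \<oplus> x = \<one>"
  by algebra

lemma (in cring) radical_ideal:
  assumes "ideal I R"
  shows "ideal (radical R I) R"
proof -
  interpret I: ideal I R by fact
  have pow_I: "x [^] i \<in> I" if "x \<in> carrier R" "x [^] n \<in> I" "n \<le> i" for x and n i :: nat
  proof -
    have "x [^] i = x [^] n \<otimes> x [^] (i - n)" using that by (simp add: nat_pow_mult)
    then show ?thesis using that by (simp add: I.I_r_closed)
  qed
  have "radical R I \<subseteq> carrier R" unfolding radical_def by auto
  moreover have "\<zero> \<in> radical R I"
    unfolding radical_def using I.zero_closed by (auto intro!: exI[of _ 1])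
  moreover have "x \<oplus> y \<in> radical R I" if x: "x \<in> radical R I" and y: "y \<in> radical R I" for x y
  proof -
    from x obtain n where n: "x \<in> carrier R" "x [^] (n::nat) \<in> I" "n \<ge> 1" unfolding radical_def by auto
    from y obtain m where m: "y \<in> carrier R" "y [^] (m::nat) \<in> I" "m \<ge> 1" unfolding radical_def by auto
    \<comment> \<open>A generalization of (x + y)^(n+m) in I that allows induction on k: splitting
      off one factor x + y raises either i or j, so the binomial theorem is bypassed.\<close>
    have "x [^] i \<otimes> y [^] j \<otimes> (x \<oplus> y) [^] k \<in> I" if "n + m \<le> i + j + k" for i j k :: nat
      using that
    proof (induction k arbitrary: i j)
      case 0
      then consider "n \<le> i" | "m \<le> j" by linarith
      then show ?case
      proof cases
        case 1
        then show ?thesis using pow_I[OF n(1,2)] n m by (simp add: I.I_r_closed)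
      next
        case 2
        then show ?thesis using pow_I[OF m(1,2)] n m by (simp add: I.I_l_closed)
      qed
    next
      case (Suc k)
      have "x [^] i \<otimes> y [^] j \<otimes> (x \<oplus> y) [^] Suc k =
        x [^] Suc i \<otimes> y [^] j \<otimes> (x \<oplus> y) [^] k \<oplus> x [^] i \<otimes> y [^] Suc j \<otimes> (x \<oplus> y) [^] k"
      proof -
        have "u \<otimes> v \<otimes> (p \<otimes> (x \<oplus> y)) = (u \<otimes> x) \<otimes> v \<otimes> p \<oplus> u \<otimes> (v \<otimes> y) \<otimes> p"
          if "u \<in> carrier R" "v \<in> carrier R" "p \<in> carrier R" for u v p
          using that n(1) m(1) by algebra
        then show ?thesis using n(1) m(1) by simp
      qed
      moreover have "x [^] Suc i \<otimes> y [^] j \<otimes> (x \<oplus> y) [^] k \<in> I" "x [^] i \<otimes> y [^] Suc j \<otimes> (x \<oplus> y) [^] k \<in> I"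
        using Suc.IH[of "Suc i" j] Suc.IH[of i "Suc j"] Suc.prems by simp_all
      ultimately show ?case using I.a_closed by simp
    qed
    from this[of 0 0 "n + m"] have "(x \<oplus> y) [^] (n + m) \<in> I" using n(1) m(1) by simp
    then show ?thesis unfolding radical_def using n m by (auto intro!: exI[of _ "n + m"])
  qed
  moreover have "r \<otimes> x \<in> radical R I" if r: "r \<in> carrier R" and x: "x \<in> radical R I" for r x
  proof -
    from x obtain n where n: "x \<in> carrier R" "x [^] (n::nat) \<in> I" "n \<ge> 1" unfolding radical_def by auto
    have "(r \<otimes> x) [^] n \<in> I" using n r by (simp add: nat_pow_distrib I.I_l_closed)
    then show ?thesis unfolding radical_def using n r by auto
  qed
  ultimately show ?thesis
    using ideal_sub_ring_iff[OF carrier_is_subcring, of "radical R I"] by simp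
qed

locale arf_ring_fractions = cring Q for Q (structure) +
  fixes A
  assumes arf: "arf_ring Q A"

sublocale arf_ring_fractions \<subseteq> noetherian_fractions
proof (intro noetherian_fractions.intro total_fractions.intro total_fractions_axioms.intro
    noetherian_fractions_axioms.intro)
  show "cring Q" by (rule is_cring)
  show "total_ring_of_fractions Q A" using arf unfolding arf_ring_def by (elim conjE)
  show "noetherian_ring (sub_ring Q A)"
    using arf unfolding arf_ring_def cohen_macaulay_def by (elim conjE)
qed

context arf_ring_fractions
begin

lemma one_dim_ring_A: "one_dim_ring (sub_ring Q A)"
proof (rule one_dim_ringI)
  show "cohen_macaulay (sub_ring Q A)" using arf unfolding arf_ring_def by (elim conjE)
  show "krull_dim (sub_ring Q A) = 1" using arf unfolding arf_ring_def by (elim conjE)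
  have "\<forall>M. maximalideal M (sub_ring Q A) \<longrightarrow> krull_dim (local_ring_at (sub_ring Q A) M) = 1"
    using arf unfolding arf_ring_def by (elim conjE)
  then show "krull_dim (local_ring_at (sub_ring Q A) M) = 1" if "maximalideal M (sub_ring Q A)" for M
    using that by simp
qed

lemma finite_maximalideals: "finite {M. maximalideal M (sub_ring Q A)}"
  using arf unfolding arf_ring_def semi_local_def by (elim conjE)

lemma quotient_product:
  assumes "x \<in> A" "x \<in> Units Q" "y \<in> A" "z \<in> A"
    "y \<otimes> inv x \<in> ring_closure Q A" "z \<otimes> inv x \<in> ring_closure Q A"
  shows "y \<otimes> z \<otimes> inv x \<in> A"
proof -
  have "\<forall>x \<in> nonzerodivisors (sub_ring Q A). \<forall>y \<in> A. \<forall>z \<in> A.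
    y \<otimes> inv x \<in> ring_closure Q A \<longrightarrow> z \<otimes> inv x \<in> ring_closure Q A \<longrightarrow> y \<otimes> z \<otimes> inv x \<in> A"
    using arf unfolding arf_ring_def by (elim conjE)
  then show ?thesis using assms nonzerodivisors_eq by simp
qed

text \<open>The Arf condition gives J as the closure of some aA. As b is integral over aA, a power
  of b is a multiple r a; that power is a unit of Q, hence so is a, and
  \<open>principal_ideal_closure\<close> applies.\<close>

lemma closed_ideal_generator:
  assumes J: "integrally_closed_ideal (sub_ring Q A) J" and b: "b \<in> J" "b \<in> Units Q"
  shows "\<exists>a \<in> J. a \<in> Units Q \<and> (\<forall>x. x \<in> J \<longleftrightarrow> x \<in> A \<and> x \<otimes> inv a \<in> ring_closure Q A)"
proof -
  have id: "ideal J (sub_ring Q A)" using J by (simp add: integrally_closed_ideal_def)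
  then have JA: "J \<subseteq> A" unfolding ideal_sub_ring_iff[OF A_subcring] by simp
  have "J \<in> regular_closed_ideals (sub_ring Q A)"
    unfolding regular_closed_ideals_def nonzerodivisors_eq using J b JA by auto
  moreover have "\<forall>J \<in> regular_closed_ideals (sub_ring Q A).
    \<exists>a \<in> J. J = ideal_closure (sub_ring Q A) (cgenideal (sub_ring Q A) a)"
    using arf unfolding arf_ring_def by (elim conjE)
  ultimately obtain a where a: "a \<in> J" "J = ideal_closure (sub_ring Q A) (cgenideal (sub_ring Q A) a)"
    by (auto dest: bspec)
  have aA: "a \<in> A" using a(1) JA by auto
  note P = principal_ideal[OF aA]
  have "b \<in> ideal_closure (sub_ring Q A) (cgenideal (sub_ring Q A) a)" using b(1) a(2) by simp
  then have "b \<in> A" "integral_equation Q (ideal_pow A (cgenideal (sub_ring Q A) a)) b"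
    unfolding ideal_closure_iff[OF A_subcring P(1)] by auto
  from integral_equation_pow_mem[OF A_subcring P(1) this ideal_pow_subset[OF A_subcring P(1)]]
  obtain n where n: "b [^] (n::nat) \<in> cgenideal (sub_ring Q A) a" by auto
  then obtain r where r: "r \<in> A" "b [^] n = r \<otimes> a" unfolding P(2) by (elim bexE)
  have "a \<otimes> r \<in> Units Q"
    using Units_pow_closed[OF b(2), of n] r A_carrier aA by (simp add: m_comm)
  then have "a \<in> Units Q" using unit_factor[of a r] A_carrier aA r by simp
  then show ?thesis using a principal_ideal_closure[OF aA] by blast
qed

end

text \<open>One step of the tower. \<open>J\<close> stands for the radical, but only its closedness
  and its generator enter; \<open>J_iff\<close> is the form in which the closure of aA is
  used.\<close>

locale arf_blowup = arf_ring_fractions +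
  fixes J a
  assumes J_integrally_closed: "integrally_closed_ideal (sub_ring Q A) J"
    and a_J: "a \<in> J" and a_unit: "a \<in> Units Q"
    and J_iff: "\<And>x. x \<in> J \<longleftrightarrow> x \<in> A \<and> x \<otimes> inv a \<in> ring_closure Q A"
begin

section \<open>The ring \<open>B = J : J\<close>, its fractions and its ideals\<close>

abbreviation B where "B \<equiv> colon Q J J"

lemma J_ideal: "ideal J (sub_ring Q A)" and J_closure: "ideal_closure (sub_ring Q A) J = J"
  using J_integrally_closed by (simp_all add: integrally_closed_ideal_def)

lemma J_closed: "J \<subseteq> A" "\<zero> \<in> J" "\<And>x y. x \<in> J \<Longrightarrow> y \<in> J \<Longrightarrow> x \<oplus> y \<in> J"
    "\<And>r x. r \<in> A \<Longrightarrow> x \<in> J \<Longrightarrow> r \<otimes> x \<in> J"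
  using J_ideal unfolding ideal_sub_ring_iff[OF A_subcring] by auto

lemma J_carrier: "x \<in> J \<Longrightarrow> x \<in> carrier Q"
  using J_closed(1) A_carrier by auto

lemma a_A: "a \<in> A" and a_carrier: "a \<in> carrier Q" and inv_a_carrier: "inv a \<in> carrier Q"
  using a_J J_closed(1) A_carrier a_unit by auto

text \<open>The second Arf condition with denominator a puts y z / a into \<open>A\<close>. Dividing
  once more by a gives (y/a)(z/a), a product of integral elements, so \<open>J_iff\<close>
  applies.\<close>

lemma J_square:
  assumes "y \<in> J" "z \<in> J"
  shows "y \<otimes> z \<otimes> inv a \<in> J"
proof -
  have yz: "y \<in> A" "z \<in> A" "y \<otimes> inv a \<in> ring_closure Q A" "z \<otimes> inv a \<in> ring_closure Q A"
    using assms unfolding J_iff by auto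
  have "y \<otimes> z \<otimes> inv a \<otimes> inv a = (y \<otimes> inv a) \<otimes> (z \<otimes> inv a)"
    using A_carrier yz inv_a_carrier by (simp add: m_ac)
  then show ?thesis
    unfolding J_iff using quotient_product[OF a_A a_unit yz] ring_closure_mult[OF yz(3,4)] by simp
qed

text \<open>Testing on a alone is enough, because q z = (a q) z / a and \<open>J_square\<close>
  keeps such quotients in \<open>J\<close>.\<close>

lemma B_iff: "q \<in> B \<longleftrightarrow> q \<in> carrier Q \<and> a \<otimes> q \<in> J"
proof
  assume "q \<in> B"
  then have "q \<in> carrier Q" "q \<otimes> a \<in> J" unfolding colon_def using a_J by auto
  then show "q \<in> carrier Q \<and> a \<otimes> q \<in> J" using a_carrier by (simp add: m_comm)
next
  assume q: "q \<in> carrier Q \<and> a \<otimes> q \<in> J"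
  have "q \<otimes> z \<in> J" if z: "z \<in> J" for z
  proof -
    have "a \<otimes> q \<otimes> z \<otimes> inv a = (a \<otimes> (q \<otimes> z)) \<otimes> inv a"
      using q J_carrier[OF z] a_carrier by (simp add: m_assoc)
    also have "\<dots> = q \<otimes> z" using unit_cancel(4)[OF a_unit] q J_carrier[OF z] by simp
    finally show ?thesis using J_square[of "a \<otimes> q" z] q z by simp
  qed
  then show "q \<in> B" unfolding colon_def using q by simp
qed

lemma B_subcring: "subcring B Q"
proof (rule subcringI'[OF subringI])
  show "B \<subseteq> carrier Q" unfolding colon_def by auto
  show "\<one> \<in> B" unfolding B_iff using a_J a_carrier by simp
  fix x assume x: "x \<in> B"
  then have xc: "x \<in> carrier Q" "a \<otimes> x \<in> J" unfolding B_iff by auto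
  have "a \<otimes> \<ominus> x = \<ominus> \<one> \<otimes> (a \<otimes> x)" using xc a_carrier by (simp add: r_minus l_minus)
  also have "\<dots> \<in> J" using J_closed(4)[OF _ xc(2)] A_closed(3,5) by simp
  finally show "\<ominus> x \<in> B" unfolding B_iff using xc by simp
  fix y assume y: "y \<in> B"
  then have yc: "y \<in> carrier Q" "a \<otimes> y \<in> J" unfolding B_iff by auto
  show "x \<oplus> y \<in> B" unfolding B_iff using xc yc a_carrier J_closed(3) by (simp add: r_distr)
  have "x \<otimes> (a \<otimes> y) \<in> J" using x yc(2) unfolding colon_def by simp
  moreover have "x \<otimes> (a \<otimes> y) = a \<otimes> (x \<otimes> y)" using xc yc a_carrier by (simp add: m_ac)
  ultimately show "x \<otimes> y \<in> B" unfolding B_iff using xc yc by simp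
qed

lemmas B_closed = subcringE[OF B_subcring]

lemma B_carrier: "x \<in> B \<Longrightarrow> x \<in> carrier Q"
  unfolding B_iff by simp

lemma A_subset_B: "A \<subseteq> B"
  unfolding colon_def using A_carrier J_closed(4) by auto

lemma a_B: "x \<in> B \<Longrightarrow> a \<otimes> x \<in> A"
  using J_closed(1) unfolding B_iff by auto

text \<open>The factor a pushes \<open>B\<close> into \<open>A\<close>. Together with
  \<open>inj_a\<close> this embeds the ideals of \<open>B\<close> into those of \<open>A\<close>
  compatibly with inclusion, which carries over chain conditions and generators of closed
  ideals.\<close>

lemma scale_ideal:
  assumes "ideal K (sub_ring Q B)"
  shows "ideal ((\<lambda>x. a \<otimes> x) ` K) (sub_ring Q A)"
proof -
  have K: "K \<subseteq> B" "\<zero> \<in> K" "\<And>x y. x \<in> K \<Longrightarrow> y \<in> K \<Longrightarrow> x \<oplus> y \<in> K"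
    "\<And>r x. r \<in> B \<Longrightarrow> x \<in> K \<Longrightarrow> r \<otimes> x \<in> K"
    using assms unfolding ideal_sub_ring_iff[OF B_subcring] by auto
  have Kc: "x \<in> carrier Q" if "x \<in> K" for x using subsetD[OF K(1) that] by (rule B_carrier)
  have "a \<otimes> x \<oplus> a \<otimes> y \<in> (\<lambda>x. a \<otimes> x) ` K" if "x \<in> K" "y \<in> K" for x y
    using K(3)[OF that] Kc that a_carrier by (intro image_eqI[of _ _ "x \<oplus> y"]) (auto simp: r_distr)
  moreover have "r \<otimes> (a \<otimes> x) \<in> (\<lambda>x. a \<otimes> x) ` K" if "r \<in> A" "x \<in> K" for r x
    using K(4)[of r x] Kc that A_carrier subsetD[OF A_subset_B] a_carrier
    by (intro image_eqI[of _ _ "r \<otimes> x"]) (auto simp: m_ac)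
  moreover have "\<zero> \<in> (\<lambda>x. a \<otimes> x) ` K"
    using K(2) a_carrier by (intro image_eqI[of _ _ \<zero>]) auto
  moreover have "(\<lambda>x. a \<otimes> x) ` K \<subseteq> A" using a_B K(1) by auto
  ultimately show ?thesis unfolding ideal_sub_ring_iff[OF A_subcring] by auto
qed

lemma inj_a: "inj_on (\<lambda>x. a \<otimes> x) (carrier Q)"
  by (rule inj_on_inverseI[of _ "\<lambda>x. inv a \<otimes> x"]) (use unit_cancel(1)[OF a_unit] in simp)

lemma scale_eq_iff:
  assumes "ideal K (sub_ring Q B)" "ideal L (sub_ring Q B)"
  shows "(\<lambda>x. a \<otimes> x) ` K = (\<lambda>x. a \<otimes> x) ` L \<longleftrightarrow> K = L"
  using assms inj_on_image_eq_iff[OF inj_a, of K L] B_closed(1)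
  unfolding ideal_sub_ring_iff[OF B_subcring] by auto

text \<open>If x is regular on \<open>B\<close>, then a x lies in \<open>A\<close> and is regular
  there: from (a x) r = 0 follows x (a r) = 0 with a r in \<open>B\<close>. So a x, and with it x,
  is a unit of Q.\<close>

lemma total_fractions_B: "total_fractions Q B"
proof unfold_locales
  have "nonzerodivisors (sub_ring Q B) \<subseteq> Units Q"
  proof
    fix x assume x: "x \<in> nonzerodivisors (sub_ring Q B)"
    then have xB: "x \<in> B" and reg: "\<And>y. y \<in> B \<Longrightarrow> x \<otimes> y = \<zero> \<Longrightarrow> y = \<zero>"
      unfolding nonzerodivisors_def by auto
    have "r = \<zero>" if r: "r \<in> A" "(a \<otimes> x) \<otimes> r = \<zero>" for r
    proof -
      have "x \<otimes> (a \<otimes> r) = \<zero>" using r A_carrier B_carrier[OF xB] a_carrier by (simp add: m_ac)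
      moreover have "a \<otimes> r \<in> B" using r A_closed(6) a_A A_subset_B by auto
      ultimately have "a \<otimes> r = \<zero>" using reg by simp
      then show ?thesis using unit_cancel(1)[OF a_unit, of r] A_carrier[OF r(1)] inv_a_carrier by simp
    qed
    then have "a \<otimes> x \<in> nonzerodivisors (sub_ring Q A)"
      unfolding nonzerodivisors_def using a_B[OF xB] by simp
    then have "x \<otimes> a \<in> Units Q"
      unfolding nonzerodivisors_eq using a_carrier B_carrier[OF xB] by (simp add: m_comm)
    then show "x \<in> Units Q" using unit_factor[of x a] a_carrier B_carrier[OF xB] by simp
  qed
  moreover have "\<exists>b \<in> B. \<exists>s \<in> nonzerodivisors (sub_ring Q B). q = b \<otimes> inv s" if q: "q \<in> carrier Q" for q
  proof -
    obtain u s where us: "u \<in> A" "s \<in> A" "s \<in> Units Q" "s \<otimes> q = u" using fraction_exists[OF q] .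
    have "y = \<zero>" if "y \<in> B" "s \<otimes> y = \<zero>" for y
      using unit_cancel(1)[OF us(3) B_carrier[OF that(1)]] that us(3) by simp
    then have "s \<in> nonzerodivisors (sub_ring Q B)"
      unfolding nonzerodivisors_def using us A_subset_B by auto
    moreover have "q = u \<otimes> inv s"
      using unit_cancel(4)[OF us(3) q] us(4) by simp
    ultimately show ?thesis using us(1) A_subset_B by auto
  qed
  ultimately show "total_ring_of_fractions Q B"
    unfolding total_ring_of_fractions_def using B_subcring cring_axioms by simp
qed

text \<open>Multiplied by a, a chain of ideals of \<open>B\<close> becomes a chain in
  \<open>A\<close> that contains its union; injectivity pulls this back.\<close>

lemma noetherian_B: "noetherian_ring (sub_ring Q B)"
proof -
  interpret B: total_fractions Q B by (rule total_fractions_B)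
  show ?thesis
  proof (rule B.A.trivial_ideal_chain_imp_noetherian)
    fix C assume C: "C \<noteq> {}" "subset.chain {I. ideal I (sub_ring Q B)} C"
    have id: "ideal K (sub_ring Q B)" if "K \<in> C" for K
      using C(2) that unfolding subset_chain_def by auto
    let ?f = "\<lambda>K. (\<lambda>x. a \<otimes> x) ` K"
    have "subset.chain {I. ideal I (sub_ring Q A)} (?f ` C)"
      unfolding subset_chain_def
    proof (intro conjI ballI)
      show "?f ` C \<subseteq> {I. ideal I (sub_ring Q A)}" using scale_ideal id by auto
      fix U V assume "U \<in> ?f ` C" "V \<in> ?f ` C"
      then obtain K L where KL: "K \<in> C" "L \<in> C" "U = ?f K" "V = ?f L" by auto
      then have "K \<subseteq> L \<or> L \<subseteq> K" using C(2) unfolding subset_chain_def by simp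
      then show "U \<subseteq> V \<or> V \<subseteq> U" unfolding KL(3,4) by (auto intro: image_mono)
    qed
    from noetherian_ring.ideal_chain_is_trivial[OF noetherian _ this] C(1)
    obtain K where K: "K \<in> C" "\<Union>(?f ` C) = ?f K" by auto
    have "?f (\<Union>C) = ?f K" using K(2) by (simp add: image_Union)
    moreover have "ideal (\<Union>C) (sub_ring Q B)"
      using B.A.chain_Union_is_ideal[OF C(2)] C(1) by simp
    ultimately have "\<Union>C = K" using scale_eq_iff[OF _ id[OF K(1)]] by simp
    then show "\<Union>C \<in> C" using K(1) by simp
  qed
qed

sublocale B: noetherian_fractions Q B
  using total_fractions_B noetherian_B by (simp add: noetherian_fractions_def noetherian_fractions_axioms_def)

section \<open>Prime and maximal ideals of \<open>B\<close> in comparison with those of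
  \<open>A\<close>\<close>

sublocale dim: one_dim_ring "sub_ring Q A"
  by (rule one_dim_ring_A)

lemma B_ideal_closed:
  assumes "ideal K (sub_ring Q B)"
  shows "K \<subseteq> B" "\<zero> \<in> K" "\<And>x y. x \<in> K \<Longrightarrow> y \<in> K \<Longrightarrow> x \<oplus> y \<in> K"
    "\<And>r x. r \<in> B \<Longrightarrow> x \<in> K \<Longrightarrow> r \<otimes> x \<in> K"
  using assms unfolding ideal_sub_ring_iff[OF B_subcring] by auto

lemma contraction_primeideal:
  assumes "primeideal P (sub_ring Q B)"
  shows "primeideal (P \<inter> A) (sub_ring Q A)"
proof (rule primeidealI)
  interpret P: primeideal P "sub_ring Q B" by fact
  note P = B_ideal_closed[OF P.is_ideal]
  show "ideal (P \<inter> A) (sub_ring Q A)"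
    unfolding ideal_sub_ring_iff[OF A_subcring]
    using P A_closed(2,6,7) A_subset_B by auto
  show "cring (sub_ring Q A)" by (rule A.is_cring)
  have "\<one> \<notin> P" using P.one_imp_carrier P.I_notcarr by auto
  then show "carrier (sub_ring Q A) \<noteq> P \<inter> A" using A_closed(3) by auto
  show "x \<in> P \<inter> A \<or> y \<in> P \<inter> A"
    if "x \<in> carrier (sub_ring Q A)" "y \<in> carrier (sub_ring Q A)"
      "x \<otimes>\<^bsub>sub_ring Q A\<^esub> y \<in> P \<inter> A" for x y
    using that P.I_prime[of x y] A_subset_B by auto
qed

text \<open>If a is outside \<open>P\<close>, membership of x can be tested on a x, which lies in
  \<open>A\<close>. Primes of \<open>B\<close> avoiding a are thus determined by their
  contractions.\<close>

lemma mem_iff_contraction: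
  assumes "primeideal P (sub_ring Q B)" "a \<notin> P" "x \<in> B"
  shows "x \<in> P \<longleftrightarrow> a \<otimes> x \<in> P \<inter> A"
proof -
  interpret P: primeideal P "sub_ring Q B" by fact
  note P = B_ideal_closed[OF P.is_ideal]
  have aB: "a \<in> B" using a_A A_subset_B by auto
  show ?thesis using P(4)[OF aB] a_B[OF assms(3)] P.I_prime[of a x] aB assms by auto
qed

lemma contraction_strict:
  assumes "primeideal P (sub_ring Q B)" "primeideal P' (sub_ring Q B)" "P \<subset> P'" "a \<notin> P"
  shows "P \<inter> A \<subset> P' \<inter> A"
proof -
  obtain x where x: "x \<in> P'" "x \<notin> P" using assms(3) by auto
  note P' = B_ideal_closed[OF primeideal.axioms(1)[OF assms(2)]]
  have xB: "x \<in> B" using x(1) P'(1) by auto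
  have "a \<otimes> x \<in> P' \<inter> A" using P'(4)[of a x] a_A A_subset_B x a_B[OF xB] by auto
  moreover have "a \<otimes> x \<notin> P \<inter> A" using mem_iff_contraction[OF assms(1,4) xB] x(2) by simp
  ultimately show ?thesis using assms(3) by auto
qed

text \<open>For y outside P, \<open>stationary_powers\<close> above P gives y^N (1 - r y) in P,
  hence 1 - r y in P. So y is invertible modulo P.\<close>

lemma primeideal_a_maximal:
  assumes P: "primeideal P (sub_ring Q B)" and aP: "a \<in> P"
  shows "maximalideal P (sub_ring Q B)"
proof (rule maximalidealI)
  interpret P: primeideal P "sub_ring Q B" by fact
  note Pc = B_ideal_closed[OF P.is_ideal]
  show "ideal P (sub_ring Q B)" "carrier (sub_ring Q B) \<noteq> P" using P.is_ideal P.I_notcarr .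
  fix L assume L: "ideal L (sub_ring Q B)" "P \<subseteq> L" "L \<subseteq> carrier (sub_ring Q B)"
  note Lc = B_ideal_closed[OF L(1)]
  interpret L: ideal L "sub_ring Q B" by (rule L(1))
  show "L = P \<or> L = carrier (sub_ring Q B)"
  proof (cases "L = P")
    case False
    then obtain y where y: "y \<in> L" "y \<notin> P" using L(2) by auto
    have yB: "y \<in> carrier (sub_ring Q B)" using y(1) L(3) by auto
    have "\<exists>N::nat. \<exists>r \<in> carrier (sub_ring Q B). y [^]\<^bsub>sub_ring Q B\<^esub> N \<otimes>\<^bsub>sub_ring Q B\<^esub>
      (\<one>\<^bsub>sub_ring Q B\<^esub> \<ominus>\<^bsub>sub_ring Q B\<^esub> r \<otimes>\<^bsub>sub_ring Q B\<^esub> y) \<in> P"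
    proof (rule B.A.stationary_powers[OF P.is_ideal yB])
      fix K :: "nat \<Rightarrow> _"
      assume K: "\<And>n. ideal (K n) (sub_ring Q B)" "\<And>n. P \<subseteq> K n" "\<And>n. K (Suc n) \<subseteq> K n"
      let ?f = "\<lambda>K. (\<lambda>x. a \<otimes> x) ` K"
      have "\<exists>N. \<forall>n \<ge> N. ?f (K (Suc n)) = ?f (K n)"
      \<comment> \<open>Since a lies in \<open>P\<close> and so in every \<open>K n\<close>, all the
        scaled ideals contain the regular element a a; this is what brings the chain condition of
        \<open>A\<close> into play.\<close>
      proof (rule dim.descending_chain_regular[of "a \<otimes> a"])
        show "a \<otimes> a \<in> nonzerodivisors (sub_ring Q A)"
          unfolding nonzerodivisors_eq using a_A a_unit A_closed(6) by simp
        show "ideal (?f (K n)) (sub_ring Q A)" for n using scale_ideal K(1) .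
        show "a \<otimes> a \<in> ?f (K n)" for n using K(2) aP by auto
        show "?f (K (Suc n)) \<subseteq> ?f (K n)" for n using K(3) by (rule image_mono)
      qed
      then obtain N where "?f (K (Suc N)) = ?f (K N)" by auto
      then show "\<exists>N. K (Suc N) = K N" using scale_eq_iff[OF K(1) K(1)] by auto
    qed
    then obtain N :: nat and r where r: "r \<in> carrier (sub_ring Q B)"
      "y [^]\<^bsub>sub_ring Q B\<^esub> N \<otimes>\<^bsub>sub_ring Q B\<^esub>
      (\<one>\<^bsub>sub_ring Q B\<^esub> \<ominus>\<^bsub>sub_ring Q B\<^esub> r \<otimes>\<^bsub>sub_ring Q B\<^esub> y) \<in> P" by auto
    have "y [^]\<^bsub>sub_ring Q B\<^esub> (n::nat) \<notin> P" for n
    proof (induction n)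
      case 0
      then show ?case using P.one_imp_carrier P.I_notcarr by auto
    next
      case (Suc n)
      then show ?case using P.I_prime[of "y [^]\<^bsub>sub_ring Q B\<^esub> n" y] y(2) yB B.A.nat_pow_closed[OF yB] by auto
    qed
    then have one: "\<one>\<^bsub>sub_ring Q B\<^esub> \<ominus>\<^bsub>sub_ring Q B\<^esub> r \<otimes>\<^bsub>sub_ring Q B\<^esub> y \<in> L"
      using P.I_prime[OF B.A.nat_pow_closed[OF yB]
          B.A.minus_closed[OF B.A.one_closed B.A.m_closed[OF r(1) yB]] r(2)] L(2) by auto
    have "r \<otimes>\<^bsub>sub_ring Q B\<^esub> y \<in> L" using L.I_l_closed[OF y(1) r(1)] .
    with one have "(\<one>\<^bsub>sub_ring Q B\<^esub> \<ominus>\<^bsub>sub_ring Q B\<^esub> r \<otimes>\<^bsub>sub_ring Q B\<^esub> y)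
      \<oplus>\<^bsub>sub_ring Q B\<^esub> r \<otimes>\<^bsub>sub_ring Q B\<^esub> y \<in> L" by (rule L.a_closed)
    moreover have "(\<one>\<^bsub>sub_ring Q B\<^esub> \<ominus>\<^bsub>sub_ring Q B\<^esub> r \<otimes>\<^bsub>sub_ring Q B\<^esub> y)
      \<oplus>\<^bsub>sub_ring Q B\<^esub> r \<otimes>\<^bsub>sub_ring Q B\<^esub> y = \<one>\<^bsub>sub_ring Q B\<^esub>"
      by (rule B.A.one_minus_plus[OF B.A.m_closed[OF r(1) yB]])
    ultimately show ?thesis using L.one_imp_carrier by simp
  qed simp
qed

text \<open>If a maximal N above the contraction had an element r outside M, then 1 = m + s r with s
  only in \<open>B\<close>. Multiplying by a relation 1 = m' + t a replaces s by a s t, which is in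
  \<open>A\<close>, and forces 1 into N.\<close>

lemma contraction_maximalideal:
  assumes M: "maximalideal M (sub_ring Q B)" and aM: "a \<notin> M"
  shows "maximalideal (M \<inter> A) (sub_ring Q A)"
proof -
  interpret M: maximalideal M "sub_ring Q B" by fact
  note Mc = B_ideal_closed[OF M.is_ideal]
  have prime: "primeideal M (sub_ring Q B)" by (rule B.A.maximalideal_prime[OF M])
  note MA = contraction_primeideal[OF prime]
  obtain N where N: "maximalideal N (sub_ring Q A)" "M \<inter> A \<subseteq> N"
    using A.ex_maximalideal[OF primeideal.axioms(1)[OF MA]] primeideal.I_notcarr[OF MA] by blast
  interpret N: maximalideal N "sub_ring Q A" by fact
  have Nc: "N \<subseteq> A" "\<And>x y. x \<in> N \<Longrightarrow> y \<in> N \<Longrightarrow> x \<oplus> y \<in> N" "\<And>r x. r \<in> A \<Longrightarrow> x \<in> N \<Longrightarrow> r \<otimes> x \<in> N"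
    using N.is_ideal unfolding ideal_sub_ring_iff[OF A_subcring] by auto
  have comax: "\<exists>m \<in> M. \<exists>s \<in> B. \<one> = m \<oplus> s \<otimes> x" if x: "x \<in> B" "x \<notin> M" for x
  proof -
    note L = B.A.ideal_add_cgenideal[OF M.is_ideal, of x]
    let ?L = "M <+>\<^bsub>sub_ring Q B\<^esub> cgenideal (sub_ring Q B) x"
    have "?L = M \<or> ?L = carrier (sub_ring Q B)"
      using M.I_maximal[OF L(1) L(2) ideal.Icarr[OF L(1), THEN subsetI]] x(1) by simp
    then have "\<one> \<in> ?L" using L(3) x B_closed(3) by auto
    then show ?thesis using L(4)[of \<one>] x(1) by simp
  qed
  have "N \<subseteq> M \<inter> A"
  proof (rule ccontr)
    assume "\<not> N \<subseteq> M \<inter> A"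
    then obtain r where r: "r \<in> N" "r \<notin> M" using Nc(1) by auto
    then have rA: "r \<in> A" using Nc(1) by auto
    obtain m s where ms: "m \<in> M" "s \<in> B" "\<one> = m \<oplus> s \<otimes> r"
      using comax[of r] rA A_subset_B r(2) by auto
    obtain m' t where mt: "m' \<in> M" "t \<in> B" "\<one> = m' \<oplus> t \<otimes> a"
      using comax[of a] a_A A_subset_B aM by auto
    have c: "r \<in> carrier Q" "m \<in> carrier Q" "s \<in> carrier Q" "m' \<in> carrier Q" "t \<in> carrier Q"
      using rA A_carrier ms mt Mc(1) B_carrier by auto
    let ?u = "a \<otimes> (s \<otimes> t)"
    have uA: "?u \<in> A" using a_B ms(2) mt(2) B_closed(6) by simp
    \<comment> \<open>In the expanded product every term except u r has a factor m or m'. Their sum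
      lies in M and, being 1 - u r, also in \<open>A\<close>; hence it lies in N.\<close>
    have "\<one> = (m \<oplus> s \<otimes> r) \<otimes> (m' \<oplus> t \<otimes> a)" using ms(3) mt(3) by (metis r_one one_closed)
    also have "\<dots> = (m' \<otimes> m \<oplus> (s \<otimes> r) \<otimes> m' \<oplus> (t \<otimes> a) \<otimes> m) \<oplus> ?u \<otimes> r"
      using c a_carrier by algebra
    finally have eq: "\<one> = (m' \<otimes> m \<oplus> (s \<otimes> r) \<otimes> m' \<oplus> (t \<otimes> a) \<otimes> m) \<oplus> ?u \<otimes> r" .
    let ?w = "m' \<otimes> m \<oplus> (s \<otimes> r) \<otimes> m' \<oplus> (t \<otimes> a) \<otimes> m"
    have aB: "a \<in> B" and rB: "r \<in> B" using a_A rA A_subset_B by auto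
    have w: "?w \<in> M"
      using ms mt Mc(1) aB rB by (intro Mc(3) Mc(4) B_closed(6)) auto
    have wc: "?w \<in> carrier Q" using c a_carrier by simp
    have ur: "?u \<otimes> r \<in> A" using A_closed(6) uA rA by simp
    have "\<one> \<ominus> ?u \<otimes> r = ?w"
      using c a_carrier wc by (subst eq) (simp add: a_minus_def a_assoc r_neg)
    moreover have "\<one> \<ominus> ?u \<otimes> r \<in> A" using A_closed(3,5,7) ur by (simp add: a_minus_def)
    ultimately have "?w \<in> N" using w N(2) by auto
    moreover have "?u \<otimes> r \<in> N" using Nc(3) uA r(1) by simp
    ultimately have "\<one> \<in> N" using Nc(2) eq by metis
    then show False using N.one_imp_carrier N.I_notcarr by simp
  qed
  then have "M \<inter> A = N" using N(2) by (rule antisym[rotated])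
  then show ?thesis using N(1) by simp
qed

text \<open>Contraction is strict as soon as the smaller prime avoids a. So either the middle prime
  contains a and is already maximal, or P0 and P1 avoid a and the whole chain contracts strictly to
  \<open>A\<close>.\<close>

lemma one_dim_ring_B: "one_dim_ring (sub_ring Q B)"
proof (intro one_dim_ring.intro one_dim_ring_axioms.intro)
  show "cring (sub_ring Q B)" by (rule B.A.is_cring)
  show "noetherian_ring (sub_ring Q B)" by (rule noetherian_B)
  show "\<one>\<^bsub>sub_ring Q B\<^esub> \<noteq> \<zero>\<^bsub>sub_ring Q B\<^esub>" using dim.one_not_zero by simp
  show "M \<inter> nonzerodivisors (sub_ring Q B) \<noteq> {}" if M: "maximalideal M (sub_ring Q B)" for M
  proof (cases "a \<in> M")
    case True
    then show ?thesis unfolding B.nonzerodivisors_eq using a_unit a_A A_subset_B by auto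
  next
    case False
    from dim.maximal_regular[OF contraction_maximalideal[OF M this]]
    show ?thesis unfolding B.nonzerodivisors_eq nonzerodivisors_eq using A_subset_B by auto
  qed
  fix P0 P1 P2
  assume P: "primeideal P0 (sub_ring Q B)" "primeideal P1 (sub_ring Q B)" "primeideal P2 (sub_ring Q B)"
    and sub: "P0 \<subset> P1" "P1 \<subset> P2"
  show False
  proof (cases "a \<in> P1")
    case True
    interpret P1: maximalideal P1 "sub_ring Q B" by (rule primeideal_a_maximal[OF P(2) True])
    interpret P2: primeideal P2 "sub_ring Q B" by fact
    have "P2 = P1 \<or> P2 = carrier (sub_ring Q B)"
      by (rule P1.I_maximal[OF P2.is_ideal]) (use sub P2.a_subset in auto)
    then show False using sub(2) P2.I_notcarr by auto
  next
    case False
    then have "a \<notin> P0" using sub(1) by auto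
    from dim.no_prime_chain[OF contraction_primeideal[OF P(1)] contraction_primeideal[OF P(2)]
        contraction_primeideal[OF P(3)] contraction_strict[OF P(1,2) sub(1) this]
        contraction_strict[OF P(2,3) sub(2) False]]
    show False .
  qed
qed

text \<open>The maximal ideals containing the regular element a are finitely many by the chain
  condition; the others inject by contraction into the maximal ideals of \<open>A\<close>.\<close>

lemma finite_maximalideals_B: "finite {M. maximalideal M (sub_ring Q B)}"
proof -
  interpret dimB: one_dim_ring "sub_ring Q B" by (rule one_dim_ring_B)
  have "a \<in> nonzerodivisors (sub_ring Q B)"
    unfolding B.nonzerodivisors_eq using a_A A_subset_B a_unit by auto
  from dimB.finite_maximalideals_containing[OF this]
  have "finite {M. maximalideal M (sub_ring Q B) \<and> a \<in> M}" .
  moreover have "finite {M. maximalideal M (sub_ring Q B) \<and> a \<notin> M}" (is "finite ?S")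
  proof (rule finite_imageD)
    have "(\<lambda>M. M \<inter> A) ` ?S \<subseteq> {M. maximalideal M (sub_ring Q A)}"
      using contraction_maximalideal by auto
    then show "finite ((\<lambda>M. M \<inter> A) ` ?S)" using finite_maximalideals by (rule finite_subset)
    show "inj_on (\<lambda>M. M \<inter> A) ?S"
    proof (rule inj_onI)
      fix M M' assume M: "M \<in> ?S" "M' \<in> ?S" and eq: "M \<inter> A = M' \<inter> A"
      have pr: "primeideal M (sub_ring Q B)" "primeideal M' (sub_ring Q B)"
        using M B.A.maximalideal_prime by auto
      have "M \<subseteq> B" "M' \<subseteq> B" using pr[THEN primeideal.axioms(1), THEN B_ideal_closed(1)] .
      moreover have "x \<in> M \<longleftrightarrow> x \<in> M'" if "x \<in> B" for x
        using mem_iff_contraction[OF pr(1) _ that] mem_iff_contraction[OF pr(2) _ that] M eq by simp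
      ultimately show "M = M'" by auto
    qed
  qed
  moreover have "{M. maximalideal M (sub_ring Q B)} =
    {M. maximalideal M (sub_ring Q B) \<and> a \<in> M} \<union> {M. maximalideal M (sub_ring Q B) \<and> a \<notin> M}" by auto
  ultimately show ?thesis by simp
qed

section \<open>Transfer of the two Arf conditions to \<open>B\<close>\<close>

lemma ring_closure_B: "ring_closure Q B = ring_closure Q A"
proof (intro equalityI subsetI)
  fix x assume "x \<in> ring_closure Q B"
  then obtain d where x: "x \<in> carrier Q" and d: "d \<in> B" "d \<in> Units Q" "\<And>k::nat. d \<otimes> x [^] k \<in> B"
    unfolding B.ring_closure_iff by auto
  \<comment> \<open>A denominator d over \<open>B\<close> becomes the denominator a d over
    \<open>A\<close>, since multiplication by a sends \<open>B\<close> into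
    \<open>A\<close>.\<close>
  have "(a \<otimes> d) \<otimes> x [^] k \<in> A" for k :: nat
    using a_B[OF d(3)[of k]] a_carrier B_carrier[OF d(1)] x by (simp add: m_assoc)
  then show "x \<in> ring_closure Q A"
    unfolding ring_closure_iff using x d a_unit a_B[OF d(1)] by (intro conjI bexI[of _ "a \<otimes> d"]) auto
next
  fix x assume "x \<in> ring_closure Q A"
  then show "x \<in> ring_closure Q B"
    unfolding B.ring_closure_iff ring_closure_iff using A_subset_B by auto
qed

text \<open>The ideal aK of \<open>A\<close> is again integrally closed, so it has a generator of
  the form a c with c in K. As (a x)/(a c) = x/c and the two rings have the same closure, c
  generates K in the same sense.\<close>

lemma B_closed_ideal_generator:
  assumes K: "integrally_closed_ideal (sub_ring Q B) K" and b: "b \<in> K" "b \<in> Units Q"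
  shows "\<exists>c \<in> K. K = ideal_closure (sub_ring Q B) (cgenideal (sub_ring Q B) c)"
proof -
  let ?L = "(\<lambda>x. a \<otimes> x) ` K"
  have Ki: "ideal K (sub_ring Q B)" and Kc: "ideal_closure (sub_ring Q B) K = K"
    using K by (simp_all add: integrally_closed_ideal_def)
  note KB = B_ideal_closed[OF Ki]
  have Li: "ideal ?L (sub_ring Q A)" by (rule scale_ideal[OF Ki])
  have "ideal_closure (sub_ring Q A) ?L \<subseteq> ?L"
  proof
    fix x assume x: "x \<in> ideal_closure (sub_ring Q A) ?L"
    have xA: "x \<in> A" using x unfolding ideal_closure_def by simp
    then have xc: "x \<in> carrier Q" by (rule A_carrier)
    \<comment> \<open>Scaling by 1 is monotonicity of the closure under the inclusion of aK in
      \<open>J\<close>. It places x in \<open>J\<close>, so that x/a is an element of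
      \<open>B\<close>.\<close>
    have "\<one> \<otimes> x \<in> ideal_closure (sub_ring Q A) J"
      by (rule ideal_closure_scale[OF A_subcring A_subcring Li J_ideal _ _ x])
        (use KB(1) B_iff xA xc J_carrier in auto)
    then have xJ: "x \<in> J" using J_closure xc by simp
    have "a \<otimes> (inv a \<otimes> x) = x" using unit_cancel(2)[OF a_unit xc] .
    then have inB: "inv a \<otimes> x \<in> B" unfolding B_iff using xJ inv_a_carrier xc by simp
    \<comment> \<open>Scaling by \<open>inv a\<close> maps aK back to K; it is applicable because
      x/a is already known to lie in \<open>B\<close>.\<close>
    have "inv a \<otimes> x \<in> ideal_closure (sub_ring Q B) K"
      by (rule ideal_closure_scale[OF A_subcring B_subcring Li Ki inv_a_carrier _ x inB])
        (use KB(1) unit_cancel(1)[OF a_unit] B_carrier in auto)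
    then show "x \<in> ?L" using Kc \<open>a \<otimes> (inv a \<otimes> x) = x\<close> by (intro image_eqI[of _ _ "inv a \<otimes> x"]) auto
  qed
  then have "integrally_closed_ideal (sub_ring Q A) ?L"
    unfolding integrally_closed_ideal_def using Li ideal_subset_closure[OF A_subcring Li] by auto
  moreover have "a \<otimes> b \<in> ?L" "a \<otimes> b \<in> Units Q" using b a_unit by auto
  ultimately obtain e where e: "e \<in> ?L" "e \<in> Units Q"
    and L_iff: "\<And>x. x \<in> ?L \<longleftrightarrow> x \<in> A \<and> x \<otimes> inv e \<in> ring_closure Q A"
    using closed_ideal_generator by blast
  from e(1) obtain c where c: "c \<in> K" "e = a \<otimes> c" by auto
  have cB: "c \<in> B" using c(1) KB(1) by auto
  have cc: "c \<in> carrier Q" using cB B_carrier by simp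
  have cU: "c \<in> Units Q" using prod_unit_l[OF _ a_unit a_carrier cc] e(2) c(2) by simp
  note div = unit_quotient_cancel[OF a_unit cU, folded c(2)]
  have "x \<in> K \<longleftrightarrow> x \<in> B \<and> x \<otimes> inv c \<in> ring_closure Q B" for x
  proof
    assume x: "x \<in> K"
    then have "a \<otimes> x \<in> ?L" by simp
    then show "x \<in> B \<and> x \<otimes> inv c \<in> ring_closure Q B"
      unfolding L_iff ring_closure_B using div[of x] x KB(1) B_carrier by auto
  next
    assume x: "x \<in> B \<and> x \<otimes> inv c \<in> ring_closure Q B"
    then have "a \<otimes> x \<in> ?L"
      unfolding L_iff ring_closure_B using div[of x] a_B B_carrier by auto
    then obtain y where "y \<in> K" "a \<otimes> x = a \<otimes> y" by auto
    then show "x \<in> K" using inj_a x KB(1) B_carrier unfolding inj_on_def by auto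
  qed
  then have "K = ideal_closure (sub_ring Q B) (cgenideal (sub_ring Q B) c)"
    using B.principal_ideal_closure[OF cB cU] by auto
  with c(1) show ?thesis by auto
qed

text \<open>The Arf condition of \<open>A\<close> for a x, a y, a z gives a (y z / x) in
  \<open>A\<close>. It even lies in \<open>J\<close>: dividing by a leaves y (z/x), which is
  integral since y is in \<open>B\<close>. By \<open>B_iff\<close> this is the claim.\<close>

lemma B_quotient_product:
  assumes x: "x \<in> B" "x \<in> Units Q" and yz: "y \<in> B" "z \<in> B"
    "y \<otimes> inv x \<in> ring_closure Q B" "z \<otimes> inv x \<in> ring_closure Q B"
  shows "y \<otimes> z \<otimes> inv x \<in> B"
proof -
  have c: "x \<in> carrier Q" "y \<in> carrier Q" "z \<in> carrier Q" "inv x \<in> carrier Q"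
    using x yz B_carrier by auto
  have xU: "a \<otimes> x \<in> Units Q" using x a_unit by simp
  note div = unit_quotient_cancel[OF a_unit x(2)]
  have "(a \<otimes> y) \<otimes> (a \<otimes> z) \<otimes> inv (a \<otimes> x) \<in> A"
    by (rule quotient_product[OF a_B[OF x(1)] xU a_B[OF yz(1)] a_B[OF yz(2)]])
      (use yz(3,4) div c ring_closure_B in auto)
  moreover have "(a \<otimes> y) \<otimes> (a \<otimes> z) \<otimes> inv (a \<otimes> x) = a \<otimes> (y \<otimes> z \<otimes> inv x)"
    using div[of "y \<otimes> (a \<otimes> z)"] c a_carrier inv_a_carrier by (simp add: m_ac)
  ultimately have inA: "a \<otimes> (y \<otimes> z \<otimes> inv x) \<in> A" by simp
  have "y \<otimes> (z \<otimes> inv x) \<in> ring_closure Q A"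
    using ring_closure_mult[of y "z \<otimes> inv x"] yz(1,4) B.subset_ring_closure ring_closure_B by auto
  moreover have "a \<otimes> (y \<otimes> z \<otimes> inv x) \<otimes> inv a = y \<otimes> (z \<otimes> inv x)"
    using unit_cancel(4)[OF a_unit, of "y \<otimes> z \<otimes> inv x"] c by (simp add: m_assoc)
  ultimately have "a \<otimes> (y \<otimes> z \<otimes> inv x) \<in> J" unfolding J_iff using inA by simp
  then show ?thesis unfolding B_iff using c by simp
qed

lemma arf_ring_B: "arf_ring Q B"
  unfolding arf_ring_def
proof (intro conjI allI ballI impI)
  interpret dimB: one_dim_ring "sub_ring Q B" by (rule one_dim_ring_B)
  show "total_ring_of_fractions Q B" by (rule B.total_fractions)
  show "cohen_macaulay (sub_ring Q B)" by (rule dimB.cohen_macaulay)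
  show "semi_local (sub_ring Q B)" unfolding semi_local_def by (rule finite_maximalideals_B)
  show "krull_dim (sub_ring Q B) = 1" by (rule dimB.krull_dim_eq_1)
  show "krull_dim (local_ring_at (sub_ring Q B) M) = 1" if "maximalideal M (sub_ring Q B)" for M
    by (rule dimB.krull_dim_localization[OF that])
  show "\<exists>c \<in> K. K = ideal_closure (sub_ring Q B) (cgenideal (sub_ring Q B) c)"
    if "K \<in> regular_closed_ideals (sub_ring Q B)" for K
    using that B_closed_ideal_generator unfolding regular_closed_ideals_def B.nonzerodivisors_eq by auto
  show "y \<otimes> z \<otimes> inv x \<in> B"
    if "x \<in> nonzerodivisors (sub_ring Q B)" "y \<in> B" "z \<in> B"
      "y \<otimes> inv x \<in> ring_closure Q B" "z \<otimes> inv x \<in> ring_closure Q B" for x y z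
    using that B_quotient_product unfolding B.nonzerodivisors_eq by auto
qed

section \<open>The ideal \<open>I : J\<close> of \<open>B\<close>, for a regular closed ideal
  \<open>I\<close> inside \<open>J\<close>\<close>

context
  fixes I
  assumes I: "integrally_closed_ideal (sub_ring Q A) I" "I \<inter> nonzerodivisors (sub_ring Q A) \<noteq> {}" "I \<subseteq> J"
begin

lemma I_closed: "ideal I (sub_ring Q A)" "I \<subseteq> A" "\<zero> \<in> I" "\<And>x y. x \<in> I \<Longrightarrow> y \<in> I \<Longrightarrow> x \<oplus> y \<in> I"
    "ideal_closure (sub_ring Q A) I = I"
  using I(1) unfolding integrally_closed_ideal_def ideal_sub_ring_iff[OF A_subcring] by auto

text \<open>With c the generator of \<open>I\<close>, dividing y z / a by c leaves (y/c)(z/a), a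
  product of integral elements. That y z / a lies in \<open>A\<close> at all comes from
  \<open>J_square\<close>, as \<open>I\<close> is contained in \<open>J\<close>.\<close>

lemma I_mult_J:
  assumes "y \<in> I" "z \<in> J"
  shows "y \<otimes> z \<otimes> inv a \<in> I"
proof -
  obtain b where "b \<in> I" "b \<in> Units Q" using I(2) unfolding nonzerodivisors_eq by auto
  then obtain c where c: "c \<in> Units Q" "\<And>x. x \<in> I \<longleftrightarrow> x \<in> A \<and> x \<otimes> inv c \<in> ring_closure Q A"
    using closed_ideal_generator[OF I(1)] by blast
  have yJ: "y \<in> J" using assms(1) I(3) by auto
  have "(y \<otimes> inv c) \<otimes> (z \<otimes> inv a) \<in> ring_closure Q A"
    by (rule ring_closure_mult) (use assms c(2) J_iff in auto)
  moreover have "(y \<otimes> z \<otimes> inv a) \<otimes> inv c = (y \<otimes> inv c) \<otimes> (z \<otimes> inv a)"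
    using J_carrier[OF yJ] J_carrier[OF assms(2)] inv_a_carrier c(1) by (simp add: m_ac)
  ultimately show ?thesis unfolding c(2) using J_square[OF yJ assms(2)] J_closed(1) by auto
qed

lemma colon_ideal_iff: "q \<in> colon Q I J \<longleftrightarrow> q \<in> carrier Q \<and> a \<otimes> q \<in> I"
proof
  assume "q \<in> colon Q I J"
  then have "q \<in> carrier Q" "q \<otimes> a \<in> I" unfolding colon_def using a_J by auto
  then show "q \<in> carrier Q \<and> a \<otimes> q \<in> I" using a_carrier by (simp add: m_comm)
next
  assume q: "q \<in> carrier Q \<and> a \<otimes> q \<in> I"
  have "q \<otimes> z \<in> I" if z: "z \<in> J" for z
  proof -
    have "a \<otimes> q \<otimes> z \<otimes> inv a = (a \<otimes> (q \<otimes> z)) \<otimes> inv a"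
      using q J_carrier[OF z] a_carrier by (simp add: m_assoc)
    also have "\<dots> = q \<otimes> z" using unit_cancel(4)[OF a_unit] q J_carrier[OF z] by simp
    finally show ?thesis using I_mult_J[of "a \<otimes> q" z] q z by simp
  qed
  then show "q \<in> colon Q I J" unfolding colon_def using q by simp
qed

text \<open>Multiplication by a carries \<open>I : J\<close> into \<open>I\<close>, and hence its
  closure into the closure of \<open>I\<close>, which is \<open>I\<close>. Stability under r in
  \<open>B\<close> is \<open>I_mult_J\<close>, since a (r x) = (a x)(a r)/a.\<close>

lemma colon_ideal_closed: "integrally_closed_ideal (sub_ring Q B) (colon Q I J)"
proof -
  let ?K = "colon Q I J"
  have Ki: "ideal ?K (sub_ring Q B)"
    unfolding ideal_sub_ring_iff[OF B_subcring]
  proof (intro conjI ballI)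
    show "?K \<subseteq> B" using colon_ideal_iff B_iff I(3) by auto
    show "\<zero> \<in> ?K" unfolding colon_ideal_iff using I_closed(3) a_carrier by simp
    show "x \<oplus> y \<in> ?K" if "x \<in> ?K" "y \<in> ?K" for x y
      using that I_closed(4) a_carrier unfolding colon_ideal_iff by (simp add: r_distr)
    fix r x assume "r \<in> B" "x \<in> ?K"
    then have r: "r \<in> carrier Q" "a \<otimes> r \<in> J" and x: "x \<in> carrier Q" "a \<otimes> x \<in> I"
      unfolding B_iff colon_ideal_iff by auto
    have "(a \<otimes> x) \<otimes> (a \<otimes> r) \<otimes> inv a = (a \<otimes> (x \<otimes> (a \<otimes> r))) \<otimes> inv a"
      using x(1) r(1) a_carrier by (simp add: m_assoc)
    also have "\<dots> = a \<otimes> (r \<otimes> x)"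
      using unit_cancel(4)[OF a_unit, of "x \<otimes> (a \<otimes> r)"] x(1) r(1) a_carrier by (simp add: m_ac)
    finally show "r \<otimes> x \<in> ?K"
      unfolding colon_ideal_iff using I_mult_J[OF x(2) r(2)] x r by simp
  qed
  moreover have "ideal_closure (sub_ring Q B) ?K \<subseteq> ?K"
  proof
    fix x assume x: "x \<in> ideal_closure (sub_ring Q B) ?K"
    have xB: "x \<in> B" using x unfolding ideal_closure_def by simp
    have "a \<otimes> x \<in> ideal_closure (sub_ring Q A) I"
      by (rule ideal_closure_scale[OF B_subcring A_subcring Ki I_closed(1) a_carrier _ x a_B[OF xB]])
        (simp add: colon_ideal_iff)
    then show "x \<in> ?K" unfolding colon_ideal_iff I_closed(5) using xB B_carrier by simp
  qed
  ultimately show ?thesis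
    unfolding integrally_closed_ideal_def using ideal_subset_closure[OF B_subcring Ki] by auto
qed

text \<open>The witness is b/a for a unit b in \<open>I\<close>. Regularity has to be kept so that
  the next level of the tower satisfies the same hypotheses.\<close>

lemma colon_ideal_regular: "colon Q I J \<inter> nonzerodivisors (sub_ring Q B) \<noteq> {}"
proof -
  obtain b where b: "b \<in> I" "b \<in> Units Q" using I(2) unfolding nonzerodivisors_eq by auto
  have "inv a \<otimes> b \<in> colon Q I J"
    unfolding colon_ideal_iff using unit_cancel(2)[OF a_unit, of b] b inv_a_carrier by auto
  moreover have "colon Q I J \<subseteq> B" using colon_ideal_iff B_iff I(3) by auto
  moreover have "inv a \<otimes> b \<in> Units Q" using b a_unit by simp
  ultimately show ?thesis unfolding B.nonzerodivisors_eq by auto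
qed

end

end

section \<open>The tower\<close>

text \<open>An element integral over the radical has a power in the radical, hence a further power
  in \<open>I\<close>. So the radical is integrally closed, and it inherits a regular element from
  \<open>I\<close>.\<close>

lemma (in arf_ring_fractions) radical_blowup:
  assumes I: "integrally_closed_ideal (sub_ring Q A) I" "I \<inter> nonzerodivisors (sub_ring Q A) \<noteq> {}"
  shows "I \<subseteq> radical (sub_ring Q A) I" "\<exists>a. arf_blowup Q A (radical (sub_ring Q A) I) a"
proof -
  let ?J = "radical (sub_ring Q A) I"
  have Ii: "ideal I (sub_ring Q A)" using I(1) by (simp add: integrally_closed_ideal_def)
  then have IA: "I \<subseteq> A" unfolding ideal_sub_ring_iff[OF A_subcring] by simp
  have pow: "x [^]\<^bsub>sub_ring Q A\<^esub> (n::nat) = x [^] n" for x n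
    using nat_pow_consistent[of x n A] by simp
  have J_iff: "x \<in> ?J \<longleftrightarrow> x \<in> A \<and> (\<exists>n::nat. n \<ge> 1 \<and> x [^] n \<in> I)" for x
    unfolding radical_def pow by simp
  show sub: "I \<subseteq> ?J"
  proof
    fix x assume "x \<in> I"
    then have "x \<in> A" "x [^] (1::nat) \<in> I" using IA A_carrier by auto
    then show "x \<in> ?J" unfolding J_iff by blast
  qed
  have Ji: "ideal ?J (sub_ring Q A)" by (rule A.radical_ideal[OF Ii])
  have "ideal_closure (sub_ring Q A) ?J \<subseteq> ?J"
  proof
    fix x assume "x \<in> ideal_closure (sub_ring Q A) ?J"
    then have x: "x \<in> A" "integral_equation Q (ideal_pow A ?J) x"
      unfolding ideal_closure_iff[OF A_subcring Ji] by auto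
    from integral_equation_pow_mem[OF A_subcring Ji x ideal_pow_subset[OF A_subcring Ji]]
    obtain n where n: "n \<ge> 1" "x [^] (n::nat) \<in> ?J" by auto
    then obtain m where m: "m \<ge> 1" "(x [^] n) [^] (m::nat) \<in> I" unfolding J_iff by auto
    then have "x [^] (n * m) \<in> I" using x(1) A_carrier by (simp add: nat_pow_pow)
    moreover have "n * m \<ge> 1" using n(1) m(1) by simp
    ultimately show "x \<in> ?J" unfolding J_iff using x(1) by blast
  qed
  then have J: "integrally_closed_ideal (sub_ring Q A) ?J"
    unfolding integrally_closed_ideal_def using Ji ideal_subset_closure[OF A_subcring Ji] by auto
  obtain b where "b \<in> I" "b \<in> Units Q" using I(2) unfolding nonzerodivisors_eq by auto
  then have "b \<in> ?J" "b \<in> Units Q" using sub by auto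
  from closed_ideal_generator[OF J this] obtain a where a: "a \<in> ?J" "a \<in> Units Q"
    "\<And>x. x \<in> ?J \<longleftrightarrow> x \<in> A \<and> x \<otimes> inv a \<in> ring_closure Q A" by blast
  have "arf_blowup Q A ?J a"
    by (intro arf_blowup.intro arf_blowup_axioms.intro arf_ring_fractions_axioms J a)
  then show "\<exists>a. arf_blowup Q A ?J a" by blast
qed

lemma (in cring) scale_image_mult:
  assumes "c \<in> carrier R" "a \<in> carrier R" "S \<subseteq> carrier R"
  shows "(\<lambda>x. c \<otimes> x) ` (\<lambda>x. a \<otimes> x) ` S = (\<lambda>x. (c \<otimes> a) \<otimes> x) ` S"
  unfolding image_image by (rule image_cong) (use assms in \<open>auto simp: m_assoc\<close>)

lemma (in cring) scale_image_unit_cancel: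
  assumes "c \<in> Units R" "S \<subseteq> carrier R" "T \<subseteq> carrier R" "(\<lambda>x. c \<otimes> x) ` S = (\<lambda>x. c \<otimes> x) ` T"
  shows "S = T"
proof -
  have "inj_on (\<lambda>x. c \<otimes> x) (carrier R)"
    by (rule inj_on_inverseI[of _ "\<lambda>x. inv c \<otimes> x"]) (use unit_cancel(1)[OF assms(1)] in simp)
  from inj_on_image_eq_iff[OF this assms(2,3)] assms(4) show ?thesis by simp
qed

text \<open>The induction step of the product formula: the radicals multiplied so far form a
  multiple cB of the next ring, and multiplying by an ideal \<open>J\<close> of that ring only
  changes cB to cJ.\<close>

lemma (in cring) ideal_prod_scaled_ring:
  assumes B: "subcring B R" and J: "ideal J (sub_ring R B)" and c: "c \<in> carrier R"
  shows "ideal_prod R ((\<lambda>x. c \<otimes> x) ` B) J = (\<lambda>x. c \<otimes> x) ` J"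
proof (intro equalityI subsetI)
  have J': "J \<subseteq> B" "\<And>x y. x \<in> J \<Longrightarrow> y \<in> J \<Longrightarrow> x \<oplus> y \<in> J" "\<And>r x. r \<in> B \<Longrightarrow> x \<in> J \<Longrightarrow> r \<otimes> x \<in> J"
    using J unfolding ideal_sub_ring_iff[OF B] by auto
  have Bc: "x \<in> carrier R" if "x \<in> B" for x using subsetD[OF subcringE(1)[OF B] that] .
  have Jc: "x \<in> carrier R" if "x \<in> J" for x using Bc subsetD[OF J'(1) that] .
  fix x assume "x \<in> ideal_prod R ((\<lambda>x. c \<otimes> x) ` B) J"
  then show "x \<in> (\<lambda>x. c \<otimes> x) ` J"
  proof (induction rule: ideal_prod.induct)
    case (prod i j)
    then obtain r where r: "r \<in> B" "i = c \<otimes> r" by auto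
    show ?case
      by (rule image_eqI[of _ _ "r \<otimes> j"]) (use r prod c Bc Jc J'(3) in \<open>auto simp: m_assoc\<close>)
  next
    case (sum s t)
    from sum(3) obtain u where u: "u \<in> J" "s = c \<otimes> u" by auto
    from sum(4) obtain v where v: "v \<in> J" "t = c \<otimes> v" by auto
    show ?case
      by (rule image_eqI[of _ _ "u \<oplus> v"]) (use u v c Jc J'(2) in \<open>auto simp: r_distr\<close>)
  qed
next
  fix x assume "x \<in> (\<lambda>x. c \<otimes> x) ` J"
  then obtain j where j: "j \<in> J" "x = c \<otimes> j" by auto
  have "c \<otimes> \<one> \<in> (\<lambda>x. c \<otimes> x) ` B" using subcringE(3)[OF B] by auto
  from ideal_prod.prod[OF this j(1), of R] show "x \<in> ideal_prod R ((\<lambda>x. c \<otimes> x) ` B) J"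
    using j(2) c by simp
qed

lemma arf_tower:
  fixes Q :: "('a, 'b) ring_scheme" (structure) and R I :: "'a set"
  assumes "arf_ring Q R"
    and "integrally_closed_ideal (sub_ring Q R) I"
    and "I \<inter> nonzerodivisors (sub_ring Q R) \<noteq> {}"
  shows "\<exists>n.
    R = tower_ring Q R I 0 \<and>
    (\<forall>i < n. tower_ring Q R I i \<subseteq> tower_ring Q R I (Suc i)) \<and>
    tower_ring Q R I n \<subseteq> ring_closure Q R \<and>
    (\<forall>i \<le> n. arf_ring Q (tower_ring Q R I i)) \<and>
    (\<forall>i \<le> n. integrally_closed_ideal (sub_ring Q (tower_ring Q R I i)) (tower_ideal Q R I i)) \<and>
    I = set_product Q (tower_rad Q R I) n"
proof -
  interpret cring Q
    using assms(1) unfolding arf_ring_def total_ring_of_fractions_def by (elim conjE)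
  define B where "B n = tower_ring Q R I n" for n
  define L where "L n = tower_ideal Q R I n" for n
  define J where "J n = tower_rad Q R I n" for n
  have zero: "B 0 = R" "L 0 = I" unfolding B_def L_def by simp_all
  have rec: "J n = radical (sub_ring Q (B n)) (L n)" "B (Suc n) = colon Q (J n) (J n)"
    "L (Suc n) = colon Q (L n) (J n)" for n
    unfolding B_def L_def J_def by simp_all
  \<comment> \<open>Regularity of \<open>L n\<close> belongs to the invariant, because both the
    generator of the radical and the description of the next ideal depend on it.\<close>
  have inv: "arf_ring Q (B n) \<and> integrally_closed_ideal (sub_ring Q (B n)) (L n) \<and>
    L n \<inter> nonzerodivisors (sub_ring Q (B n)) \<noteq> {}" for n
  proof (induction n)
    case 0
    show ?case unfolding zero using assms by simp
  next
    case (Suc n)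
    then interpret arf_ring_fractions Q "B n" by unfold_locales simp
    have Ln: "integrally_closed_ideal (sub_ring Q (B n)) (L n)" "L n \<inter> nonzerodivisors (sub_ring Q (B n)) \<noteq> {}"
      using Suc by auto
    obtain a where "arf_blowup Q (B n) (J n) a" using radical_blowup(2)[OF Ln] unfolding rec by auto
    then interpret blowup: arf_blowup Q "B n" "J n" a .
    have LJ: "L n \<subseteq> J n" using radical_blowup(1)[OF Ln] unfolding rec .
    show ?case
      unfolding rec(2,3)
      using blowup.arf_ring_B blowup.colon_ideal_closed[OF Ln LJ] blowup.colon_ideal_regular[OF Ln LJ] by simp
  qed
  have arf: "arf_ring_fractions Q (B n)" for n
    using inv[of n] by (intro arf_ring_fractions.intro arf_ring_fractions_axioms.intro is_cring) simp
  have Ln: "integrally_closed_ideal (sub_ring Q (B n)) (L n)"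
    "L n \<inter> nonzerodivisors (sub_ring Q (B n)) \<noteq> {}" for n
    using inv by auto
  have LJ: "L n \<subseteq> J n" for n
    using arf_ring_fractions.radical_blowup(1)[OF arf Ln] unfolding rec .
  \<comment> \<open>The generators in the preceding induction were local to one step; here one is
    chosen for every level at once, so that their products can be formed.\<close>
  obtain a where a: "\<And>n. arf_blowup Q (B n) (J n) (a n)"
    using arf_ring_fractions.radical_blowup(2)[OF arf Ln] unfolding rec(1) by metis
  have a_unit: "a n \<in> Units Q" for n by (rule arf_blowup.a_unit[OF a])
  then have ac: "a n \<in> carrier Q" for n by (rule Units_closed)
  have B_iff: "q \<in> B (Suc n) \<longleftrightarrow> q \<in> carrier Q \<and> a n \<otimes> q \<in> J n" for q n
    unfolding rec(2) by (rule arf_blowup.B_iff[OF a])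
  have L_iff: "q \<in> L (Suc n) \<longleftrightarrow> q \<in> carrier Q \<and> a n \<otimes> q \<in> L n" for q n
    unfolding rec(3) by (rule arf_blowup.colon_ideal_iff[OF a Ln LJ])
  have B_sub: "subcring (B n) Q" for n
    using arf_ring_fractions.arf[OF arf[of n]] unfolding arf_ring_def total_ring_of_fractions_def
    by (elim conjE)
  have J_ideal: "ideal (J n) (sub_ring Q (B n))" for n
    by (rule arf_blowup.J_ideal[OF a])
  have JB: "J n \<subseteq> B n" for n
    using J_ideal unfolding ideal_sub_ring_iff[OF B_sub] by simp
  have Bc: "B n \<subseteq> carrier Q" for n by (rule subcringE(1)[OF B_sub])
  have B_mono: "B n \<subseteq> B (Suc n)" for n
    unfolding rec(2) by (rule arf_blowup.A_subset_B[OF a])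
  have closure: "ring_closure Q (B n) = ring_closure Q R" for n
  proof (induction n)
    case 0
    show ?case unfolding zero ..
  next
    case (Suc n)
    then show ?case unfolding rec(2) using arf_blowup.ring_closure_B[OF a] by simp
  qed
  have aB: "(\<lambda>x. a n \<otimes> x) ` B (Suc n) = J n" for n
  proof (intro equalityI subsetI)
    fix x assume x: "x \<in> J n"
    then have xc: "x \<in> carrier Q" using JB Bc by auto
    show "x \<in> (\<lambda>x. a n \<otimes> x) ` B (Suc n)"
      by (rule image_eqI[of _ _ "inv (a n) \<otimes> x"])
        (use unit_cancel(2)[OF a_unit xc] x xc a_unit in \<open>auto simp: B_iff\<close>)
  qed (auto simp: B_iff)
  have aL: "(\<lambda>x. a n \<otimes> x) ` L (Suc n) = L n" for n
  proof (intro equalityI subsetI)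
    fix x assume x: "x \<in> L n"
    then have xc: "x \<in> carrier Q" using LJ JB Bc by blast
    show "x \<in> (\<lambda>x. a n \<otimes> x) ` L (Suc n)"
      by (rule image_eqI[of _ _ "inv (a n) \<otimes> x"])
        (use unit_cancel(2)[OF a_unit xc] x xc a_unit in \<open>auto simp: L_iff\<close>)
  qed (auto simp: L_iff)
  define c where "c = rec_nat \<one> (\<lambda>n u. u \<otimes> a n)"
  have c_rec: "c 0 = \<one>" "c (Suc n) = c n \<otimes> a n" for n unfolding c_def by simp_all
  have c_unit: "c n \<in> Units Q" for n by (induction n) (simp_all add: c_rec a_unit)
  then have cc: "c n \<in> carrier Q" for n by (rule Units_closed)
  have Lc: "L n \<subseteq> carrier Q" "J n \<subseteq> carrier Q" for n using LJ JB Bc by blast+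
  have cB: "(\<lambda>x. c (Suc n) \<otimes> x) ` B (Suc n) = (\<lambda>x. c n \<otimes> x) ` J n" for n
    unfolding c_rec scale_image_mult[OF cc ac Bc, symmetric] aB ..
  have cL: "(\<lambda>x. c n \<otimes> x) ` L n = I" for n
  proof (induction n)
    case 0
    have "(\<lambda>x. \<one> \<otimes> x) ` I = id ` I"
      by (rule image_cong) (use Lc(1)[of 0] zero in auto)
    then show ?case unfolding c_rec zero by simp
  next
    case (Suc n)
    have "(\<lambda>x. c (Suc n) \<otimes> x) ` L (Suc n) = (\<lambda>x. c n \<otimes> x) ` L n"
      unfolding c_rec scale_image_mult[OF cc ac Lc(1), symmetric] aL ..
    then show ?case using Suc by simp
  qed
  have prod: "set_product Q J n = (\<lambda>x. c n \<otimes> x) ` J n" for n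
  proof (induction n)
    case 0
    have "(\<lambda>x. \<one> \<otimes> x) ` J 0 = id ` J 0"
      by (rule image_cong) (use Lc(2)[of 0] in auto)
    then show ?case unfolding c_rec by simp
  next
    case (Suc n)
    have "ideal_prod Q ((\<lambda>x. c (Suc n) \<otimes> x) ` B (Suc n)) (J (Suc n)) = (\<lambda>x. c (Suc n) \<otimes> x) ` J (Suc n)"
      by (rule ideal_prod_scaled_ring[OF B_sub J_ideal cc])
    then show ?case using Suc unfolding cB by simp
  qed
  define K where "K n = (\<lambda>x. c n \<otimes> x) ` B n" for n
  have K_dec: "K (Suc n) \<subseteq> K n" for n
    unfolding K_def cB using JB by (rule image_mono)
  have K0: "K 0 = R"
  proof -
    have "(\<lambda>x. \<one> \<otimes> x) ` R = id ` R"
      by (rule image_cong) (use Bc[of 0] zero in auto)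
    then show ?thesis unfolding K_def c_rec zero by simp
  qed
  have K_R: "K n \<subseteq> R" for n
    by (induction n) (use K0 K_dec in auto)
  have R_B: "R \<subseteq> B n" for n
    by (induction n) (use zero B_mono in auto)
  have R_sub: "subcring R Q" using B_sub[of 0] zero by simp
  have K_ideal: "ideal (K n) (sub_ring Q R)" for n
    unfolding ideal_sub_ring_iff[OF R_sub]
  proof (intro conjI ballI)
    show "K n \<subseteq> R" by (rule K_R)
    show "\<zero> \<in> K n" unfolding K_def
      by (rule image_eqI[of _ _ \<zero>]) (use subcringE(2)[OF B_sub] cc in auto)
    show "x \<oplus> y \<in> K n" if xy: "x \<in> K n" "y \<in> K n" for x y
    proof -
      from xy obtain u v where uv: "u \<in> B n" "x = c n \<otimes> u" "v \<in> B n" "y = c n \<otimes> v"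
        unfolding K_def by auto
      show ?thesis unfolding K_def
        by (rule image_eqI[of _ _ "u \<oplus> v"])
          (use uv subcringE(7)[OF B_sub] subsetD[OF Bc] cc in \<open>auto simp: r_distr\<close>)
    qed
    show "r \<otimes> x \<in> K n" if r: "r \<in> R" and x: "x \<in> K n" for r x
    proof -
      from x obtain u where u: "u \<in> B n" "x = c n \<otimes> u" unfolding K_def by auto
      have rB: "r \<in> B n" using r R_B by auto
      show ?thesis unfolding K_def
        by (rule image_eqI[of _ _ "r \<otimes> u"])
          (use u rB subcringE(6)[OF B_sub] subsetD[OF Bc] cc in \<open>auto simp: m_ac\<close>)
    qed
  qed
  interpret R: arf_ring_fractions Q R using arf[of 0] zero by simp
  interpret dim: one_dim_ring "sub_ring Q R" by (rule R.one_dim_ring_A)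
  obtain b where b: "b \<in> I" "b \<in> nonzerodivisors (sub_ring Q R)" using assms(3) by auto
  \<comment> \<open>I = c_n L_n is contained in c_n B_n, so a single regular element of
    \<open>I\<close> lies below the whole chain.\<close>
  have "b \<in> K n" for n
    using b(1) cL[of n] LJ[of n] JB[of n] unfolding K_def by blast
  from dim.descending_chain_regular[where K = K, OF b(2) K_ideal this K_dec]
  obtain n where n: "K (Suc n) = K n" by auto
  \<comment> \<open>The next ideal of the chain is c_n J_n, so stationarity reads c_n J_n = c_n B_n,
    and the unit c_n cancels.\<close>
  then have "J n = B n"
    unfolding K_def cB by (intro scale_image_unit_cancel[OF c_unit Lc(2) Bc])
  then have "\<one> \<in> J n" using subcringE(3)[OF B_sub] by auto
  \<comment> \<open>A power of 1 lies in \<open>L n\<close>, so the ideal, its radical and the ring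
    coincide at this level. Hence I = c_n L_n = c_n J_n, which is the product of the
    radicals.\<close>
  then have "\<one> \<in> L n"
    using nat_pow_consistent[of \<one> _ "B n", symmetric] unfolding rec(1) radical_def by auto
  moreover have "ideal (L n) (sub_ring Q (B n))" using Ln(1) by (simp add: integrally_closed_ideal_def)
  ultimately have "L n = B n" using ideal.one_imp_carrier by fastforce
  then have "L n = J n" using \<open>J n = B n\<close> by simp
  then have I_prod: "I = set_product Q J n" unfolding prod using cL[of n] by simp
  have "B n \<subseteq> ring_closure Q R"
  proof -
    interpret Bn: arf_ring_fractions Q "B n" by (rule arf)
    show ?thesis using Bn.subset_ring_closure closure by simp
  qed
  then have "R = B 0 \<and> (\<forall>i < n. B i \<subseteq> B (Suc i)) \<and> B n \<subseteq> ring_closure Q R \<and>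
    (\<forall>i \<le> n. arf_ring Q (B i)) \<and> (\<forall>i \<le> n. integrally_closed_ideal (sub_ring Q (B i)) (L i)) \<and>
    I = set_product Q J n"
    using zero B_mono inv I_prod by simp
  then show ?thesis unfolding B_def L_def J_def by (rule exI[of _ n])
qed

theorem theorem1p1:
  fixes Q :: "('a, 'b) ring_scheme" and R I :: "'a set"
  assumes "arf_ring Q R"
    and "integrally_closed_ideal (sub_ring Q R) I"
    and "I \<inter> nonzerodivisors (sub_ring Q R) \<noteq> {}"
  shows "\<exists>n.
    R = tower_ring Q R I 0 \<and>
    (\<forall>i < n. tower_ring Q R I i \<subseteq> tower_ring Q R I (Suc i)) \<and>
    tower_ring Q R I n \<subseteq> ring_closure Q R \<and>
    (\<forall>i \<le> n. arf_ring Q (tower_ring Q R I i)) \<and>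
    (\<forall>i \<le> n. integrally_closed_ideal (sub_ring Q (tower_ring Q R I i)) (tower_ideal Q R I i)) \<and>
    I = set_product Q (tower_rad Q R I) n"
  using assms by (rule arf_tower)

end
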